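(* Let $G$ be a cograph with countably many vertices. Then the number of siblings of $G$, counted up to isomorphism, is either exactly $1$ or infinite.
   Context: Graphs are undirected and loopless. A graph $G$ embeds into a graph $G'$ if $G$ is isomorphic to an induced subgraph of $G'$. Two graphs are equimorphic if each embeds into the other. A sibling of $G$ is any graph equimorphic to $G$ (in particular $G$ is a sibling of itself); siblings are counted up to isomorphism. A cograph is a graph with no induced subgraph isomorphic to $P_4$, the path on four vertices. *)

theory Defs
  imports "HOL-Library.Countable_Set"
begin

type_synonym 'a graph = "'a set \<times> ('a \<Rightarrow> 'a \<Rightarrow> bool)"

definition verts :: "'a graph \<Rightarrow> 'a set" where "verts G = fst G"
definition adj :: "'a graph \<Rightarrow> 'a \<Rightarrow> 'a \<Rightarrow> bool" where "adj G = snd G"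

definition is_graph :: "'a graph \<Rightarrow> bool" where
  "is_graph G \<longleftrightarrow>
     (\<forall>x y. adj G x y \<longrightarrow> x \<in> verts G \<and> y \<in> verts G) \<and>
     (\<forall>x y. adj G x y \<longrightarrow> adj G y x) \<and>
     (\<forall>x. \<not> adj G x x)"

definition embeds :: "'a graph \<Rightarrow> 'b graph \<Rightarrow> bool" where
  "embeds G H \<longleftrightarrow> (\<exists>f. inj_on f (verts G) \<and> f ` verts G \<subseteq> verts H \<and>
     (\<forall>x\<in>verts G. \<forall>y\<in>verts G. adj G x y \<longleftrightarrow> adj H (f x) (f y)))"

definition graph_iso :: "'a graph \<Rightarrow> 'b graph \<Rightarrow> bool" where
  "graph_iso G H \<longleftrightarrow> (\<exists>f. bij_betw f (verts G) (verts H) \<and>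
     (\<forall>x\<in>verts G. \<forall>y\<in>verts G. adj G x y \<longleftrightarrow> adj H (f x) (f y)))"

definition equimorphic :: "'a graph \<Rightarrow> 'b graph \<Rightarrow> bool" where
  "equimorphic G H \<longleftrightarrow> embeds G H \<and> embeds H G"

definition P4 :: "nat graph" where
  "P4 = ({0,1,2,3}, (\<lambda>x y. x \<in> {0,1,2,3} \<and> y \<in> {0,1,2,3} \<and> (x = y + 1 \<or> y = x + 1)))"

definition cograph :: "'a graph \<Rightarrow> bool" where
  "cograph G \<longleftrightarrow> \<not> embeds P4 G"

text \<open>Siblings of G, represented as graphs on subsets of nat (every sibling of a countable
  graph is countable, hence isomorphic to such a graph).\<close>
definition siblings :: "'a graph \<Rightarrow> nat graph set" where
  "siblings G = {H. is_graph H \<and> equimorphic H G}"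

definition sibling_classes :: "'a graph \<Rightarrow> nat graph set set" where
  "sibling_classes G = siblings G // {(H, H'). graph_iso H H'}"

end

theory Submission
  imports Defs "HOL-Library.Ramsey"
begin

text \<open>
Siblings of a countable cograph \<open>G\<close> are represented by subsets \<open>A\<close> of its vertex set into which \<open>G\<close>
embeds. The tree structure of a cograph is carried by its strong modules (modules overlapping no other
module): the least strong module containing two vertices is disconnected or co-disconnected and separates
them. Assume that \<open>G\<close> has only finitely many siblings.

Two rigidity facts follow. First (\<open>shift\<close>), if \<open>f\<close> is a self-embedding, the preimage of a strong module \<open>M\<close>
is not a nonempty proper subset of \<open>M\<close>: otherwise iterating \<open>f\<close> makes room to insert an infinite alternating
chain of modules with an arbitrary pattern of block sizes. There are continuum many patterns, but a chain is
determined by two vertices, so each sibling realizes only countably many. Second (\<open>soft\<close>), a strong module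
that is connected (co-connected) has no self-embedding leaving out a vertex without edges (non-edges) to the
image: otherwise its copies could be replaced by siblings having exactly \<open>p\<close> isolated vertices, for every
\<open>p\<close>. It follows that nested strong modules are never equimorphic, and that all strong modules equimorphic to
a given \<open>M\<close> can be replaced by siblings of \<open>M\<close> while remaining recognizable, so that \<open>M\<close> has at most as many
siblings as \<open>G\<close>.

Now let \<open>X\<close> be a graph with finitely many but at least two siblings, their number being minimal. The strong
modules of \<open>X\<close> that have several siblings form a chain, each is preserved by every self-embedding, and each
determines the sibling of \<open>X\<close> outside of it. A least element of the chain is impossible: it would be a sum of
components with one sibling each, or an increasing union of strong modules with one sibling each, and in
both cases infinitely many siblings appear as soon as there are two. If there is no least element, the
isomorphisms outside the members of the chain glue to an isomorphism between \<open>X\<close> and any of its siblings.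
\<close>

text \<open>A self-embedding need not map strong modules to strong modules; only preimages of
  modules are again modules (\<open>modl_vimg\<close>), which is why \<open>shift\<close> speaks of
  preimages. The absence of \<open>P4\<close> enters only through \<open>dist2\<close> and
  \<open>common_complete\<close>, from which \<open>node\<close> and \<open>soft_dominator\<close>
  are derived. The obstacle is a threatening circle. The proof of \<open>soft\<close> replaces
  copies of a module, which must be pairwise disjoint and recognizable afterwards; but that
  equimorphic strong modules are never nested is itself a consequence of \<open>soft\<close>. The
  way out is to replace only those copies \<open>M\<close> that have a prescribed position in the
  union of all copies above \<open>M\<close> (\<open>KK\<close>): by \<open>shift\<close>, a chain
  contains at most one of them. Once \<open>soft\<close> is available, this family consists of all
  copies (\<open>KK_Eq\<close>). Minimality of the number of siblings is used as surjectivity: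
  replacing a module \<open>M\<close> by its siblings injects the siblings of \<open>M\<close> into
  those of \<open>X\<close>, and as the numbers agree, every sibling of \<open>X\<close> arises by
  changing \<open>M\<close> alone.\<close>

lemma infinite_chain_seq:
  fixes \<L> :: "'b set set"
  assumes "infinite \<L>" "\<And>A B. \<lbrakk>A \<in> \<L>; B \<in> \<L>\<rbrakk> \<Longrightarrow> A \<subseteq> B \<or> B \<subseteq> A"
  obtains s :: "nat \<Rightarrow> 'b set" where "\<And>i. s i \<in> \<L>"
    "(\<forall>i j. i < j \<longrightarrow> s i \<subset> s j) \<or> (\<forall>i j. i < j \<longrightarrow> s j \<subset> s i)"
proof -
  obtain w :: "nat \<Rightarrow> 'b set" where w: "inj w" "range w \<subseteq> \<L>"
    using infinite_countable_subset[OF assms(1)] by blast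
  \<comment> \<open>\<open>Ramsey2\<close> colours unordered pairs; \<open>Min\<close> and
    \<open>Max\<close> recover the order of the two indices.\<close>
  define f where "f S = (if w (Min S) \<subset> w (Max S) then 0 else 1 :: nat)" for S
  have "\<forall>x\<in>(UNIV::nat set). \<forall>y\<in>UNIV. x \<noteq> y \<longrightarrow> f {x, y} < 2" by (auto simp: f_def)
  from Ramsey2[OF infinite_UNIV_nat this] obtain Y t
    where Y: "infinite Y" "\<forall>x\<in>Y. \<forall>y\<in>Y. x \<noteq> y \<longrightarrow> f {x, y} = t" by blast
  define s where "s i = w (enumerate Y i)" for i
  have lt: "enumerate Y i < enumerate Y j" if "i < j" for i j using enumerate_mono[OF that Y(1)] .
  have ft: "f {enumerate Y i, enumerate Y j} = t" if "i < j" for i j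
    using Y(2) enumerate_in_set[OF Y(1)] lt[OF that] by (metis less_irrefl)
  have mm: "Min {enumerate Y i, enumerate Y j} = enumerate Y i" "Max {enumerate Y i, enumerate Y j} = enumerate Y j"
    if "i < j" for i j using lt[OF that] by auto
  have "s i \<in> \<L>" for i using w s_def by auto
  moreover have "(\<forall>i j. i < j \<longrightarrow> s i \<subset> s j) \<or> (\<forall>i j. i < j \<longrightarrow> s j \<subset> s i)"
  proof (cases "t = 0")
    case True
    have "s i \<subset> s j" if "i < j" for i j
      using ft[OF that] True mm[OF that] unfolding f_def s_def by (auto split: if_splits)
    then show ?thesis by blast
  next
    case False
    have "s j \<subset> s i" if "i < j" for i j
    proof -
      have "\<not> s i \<subset> s j" using ft[OF that] False mm[OF that] unfolding f_def s_def by (auto split: if_splits)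
      moreover have "s i \<noteq> s j" using lt[OF that] w(1) unfolding s_def by (metis injD less_irrefl)
      ultimately show ?thesis using assms(2)[of "s i" "s j"] \<open>\<And>i. s i \<in> \<L>\<close> by blast
    qed
    then show ?thesis by blast
  qed
  ultimately show ?thesis using that by blast
qed

section \<open>Modules and strong modules\<close>

text \<open>Cographs are closed under complementation. The truth value \<open>t\<close>, here and below, stands for ``edge''
  or ``non-edge'', so that each argument covers a graph and its complement at once. Nothing is assumed
  about \<open>e\<close> on the diagonal.\<close>

locale cog =
  fixes e :: "'a \<Rightarrow> 'a \<Rightarrow> bool" and U :: "'a set"
  assumes esym: "e x y = e y x"
    and ctb: "countable U"
    and p4: "\<lbrakk>a \<in> U; b \<in> U; c \<in> U; d \<in> U; distinct [a, b, c, d];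
      e a b = t; e b c = t; e c d = t; e a c = (\<not> t); e a d = (\<not> t); e b d = (\<not> t)\<rbrakk> \<Longrightarrow> False"
begin

definition emb :: "('a \<Rightarrow> 'a) \<Rightarrow> 'a set \<Rightarrow> 'a set \<Rightarrow> bool" where
  "emb f X Y \<longleftrightarrow> inj_on f X \<and> f ` X \<subseteq> Y \<and> (\<forall>x\<in>X. \<forall>y\<in>X. x \<noteq> y \<longrightarrow> e (f x) (f y) = e x y)"

definition le :: "'a set \<Rightarrow> 'a set \<Rightarrow> bool" where
  "le X Y \<longleftrightarrow> (\<exists>f. emb f X Y)"

definition ism :: "'a set \<Rightarrow> 'a set \<Rightarrow> bool" where
  "ism X Y \<longleftrightarrow> (\<exists>f. emb f X Y \<and> f ` X = Y)"

definition eqm :: "'a set \<Rightarrow> 'a set \<Rightarrow> bool" where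
  "eqm X Y \<longleftrightarrow> le X Y \<and> le Y X"

definition rel :: "bool \<Rightarrow> 'a set \<Rightarrow> 'a set \<Rightarrow> bool" where
  "rel t A B \<longleftrightarrow> (\<forall>a\<in>A. \<forall>b\<in>B. e a b = t)"

text \<open>\<open>disc False\<close> means disconnected and \<open>disc True\<close> means co-disconnected; accordingly, \<open>cpt False S x\<close> and
  \<open>cpt True S x\<close> are the component and the co-component of \<open>x\<close> in \<open>S\<close>.\<close>

definition disc :: "bool \<Rightarrow> 'a set \<Rightarrow> bool" where
  "disc t S \<longleftrightarrow> (\<exists>A B. A \<noteq> {} \<and> B \<noteq> {} \<and> A \<inter> B = {} \<and> A \<union> B = S \<and> rel t A B)"

definition cpt :: "bool \<Rightarrow> 'a set \<Rightarrow> 'a \<Rightarrow> 'a set" where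
  "cpt t S x = \<Inter>{A. x \<in> A \<and> A \<subseteq> S \<and> rel t A (S - A)}"

definition modl :: "'a set \<Rightarrow> 'a set \<Rightarrow> bool" where
  "modl M X \<longleftrightarrow> M \<subseteq> X \<and> M \<noteq> {} \<and> (\<forall>z\<in>X - M. \<forall>a\<in>M. \<forall>b\<in>M. e z a = e z b)"

definition strong :: "'a set \<Rightarrow> 'a set \<Rightarrow> bool" where
  "strong M X \<longleftrightarrow> modl M X \<and> (\<forall>N. modl N X \<longrightarrow> N \<subseteq> M \<or> M \<subseteq> N \<or> N \<inter> M = {})"

definition hull :: "'a set \<Rightarrow> 'a \<Rightarrow> 'a \<Rightarrow> 'a set" where
  "hull X x y = \<Inter>{S. strong S X \<and> x \<in> S \<and> y \<in> S}"

text \<open>Up to isomorphism, a sibling of \<open>X\<close> is a subset of \<open>X\<close> into which \<open>X\<close> embeds.\<close>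

definition Sib :: "'a set \<Rightarrow> 'a set set" where
  "Sib X = {A. A \<subseteq> X \<and> le X A}"

definition fin :: "'a set \<Rightarrow> bool" where
  "fin X \<longleftrightarrow> (\<exists>F. finite F \<and> (\<forall>A\<in>Sib X. \<exists>B\<in>F. ism A B))"

definition one :: "'a set \<Rightarrow> bool" where
  "one X \<longleftrightarrow> (\<forall>A\<in>Sib X. ism A X)"

section \<open>Embeddings, equimorphy and finiteness of the number of siblings\<close>

lemma embI:
  "\<lbrakk>inj_on f X; \<And>x. x \<in> X \<Longrightarrow> f x \<in> Y; \<And>x y. \<lbrakk>x \<in> X; y \<in> X; x \<noteq> y\<rbrakk> \<Longrightarrow> e (f x) (f y) = e x y\<rbrakk> \<Longrightarrow> emb f X Y"
  unfolding emb_def by blast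

lemma embD:
  assumes "emb f X Y"
  shows "inj_on f X" "\<And>x. x \<in> X \<Longrightarrow> f x \<in> Y"
    "\<And>x y. \<lbrakk>x \<in> X; y \<in> X; x \<noteq> y\<rbrakk> \<Longrightarrow> e (f x) (f y) = e x y"
    "\<And>x y. \<lbrakk>x \<in> X; y \<in> X; f x = f y\<rbrakk> \<Longrightarrow> x = y"
  using assms unfolding emb_def inj_on_def by auto

lemma emb_comp: "\<lbrakk>emb f X Y; emb g Y Z\<rbrakk> \<Longrightarrow> emb (g \<circ> f) X Z"
  unfolding emb_def inj_on_def by (auto; metis image_subset_iff)

lemma emb_id: "X \<subseteq> Y \<Longrightarrow> emb id X Y"
  by (auto simp: emb_def)

lemma emb_mono: "\<lbrakk>emb f X Y; X' \<subseteq> X; Y \<subseteq> Y'\<rbrakk> \<Longrightarrow> emb f X' Y'"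
  unfolding emb_def inj_on_def by blast

lemma emb_image: "\<lbrakk>emb f X Y; X' \<subseteq> X\<rbrakk> \<Longrightarrow> emb f X' (f ` X')"
  unfolding emb_def inj_on_def by blast

lemma emb_inv:
  assumes "emb f X Y" shows "emb (the_inv_into X f) (f ` X) X"
proof (rule embI)
  note d = embD[OF assms]
  show "inj_on (the_inv_into X f) (f ` X)"
    using d(1) inj_on_the_inv_into by blast
  show "\<And>x. x \<in> f ` X \<Longrightarrow> the_inv_into X f x \<in> X"
    using d(1) the_inv_into_into by fastforce
  fix x y assume a: "x \<in> f ` X" "y \<in> f ` X" "x \<noteq> y"
  then obtain u v where "u \<in> X" "v \<in> X" "x = f u" "y = f v" "u \<noteq> v" by auto
  then show "e (the_inv_into X f x) (the_inv_into X f y) = e x y"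
    using d by (simp add: the_inv_into_f_f)
qed

lemma emb_funpow: "emb f X X \<Longrightarrow> emb (f ^^ n) X X"
proof (induction n)
  case 0 show ?case using emb_id[of X X] by (simp add: id_def)
next
  case (Suc n)
  have "emb (f \<circ> (f ^^ n)) X X" using emb_comp Suc by blast
  then show ?case by (simp only: funpow.simps)
qed

lemma le_refl: "X \<subseteq> Y \<Longrightarrow> le X Y"
  using emb_id le_def by blast

lemma le_trans: "\<lbrakk>le X Y; le Y Z\<rbrakk> \<Longrightarrow> le X Z"
  using emb_comp unfolding le_def by blast

lemma ism_refl: "ism X X"
  unfolding ism_def using emb_id[of X X] by (metis image_id id_apply subset_refl)

lemma ism_sym: "ism X Y \<Longrightarrow> ism Y X"
proof -
  assume "ism X Y"
  then obtain f where f: "emb f X Y" "f ` X = Y" unfolding ism_def by blast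
  have "emb (the_inv_into X f) Y X" using emb_inv[OF f(1)] f(2) by simp
  moreover have "the_inv_into X f ` Y = X"
    using f embD(1)[OF f(1)] the_inv_into_onto by blast
  ultimately show "ism Y X" unfolding ism_def by blast
qed

lemma ism_trans: "\<lbrakk>ism X Y; ism Y Z\<rbrakk> \<Longrightarrow> ism X Z"
  unfolding ism_def using emb_comp by (metis image_comp)

lemma ism_le: "ism X Y \<Longrightarrow> le X Y"
  unfolding ism_def le_def by blast

lemma emb_ism: "emb f X Y \<Longrightarrow> X' \<subseteq> X \<Longrightarrow> ism X' (f ` X')"
  unfolding ism_def using emb_image by blast

lemma le_ism: "le X Y \<Longrightarrow> \<exists>Z\<subseteq>Y. ism X Z"
  unfolding le_def ism_def emb_def by blast

lemma eqm_refl: "eqm X X"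
  by (simp add: eqm_def le_refl)

lemma eqm_sym: "eqm X Y \<Longrightarrow> eqm Y X"
  by (simp add: eqm_def)

lemma eqm_trans: "\<lbrakk>eqm X Y; eqm Y Z\<rbrakk> \<Longrightarrow> eqm X Z"
  using le_trans by (auto simp: eqm_def)

lemma ism_eqm: "ism X Y \<Longrightarrow> eqm X Y"
  using ism_le ism_sym eqm_def by blast

lemma SibI: "\<lbrakk>A \<subseteq> X; emb f X A\<rbrakk> \<Longrightarrow> A \<in> Sib X"
  unfolding Sib_def le_def by blast

lemma Sib_self: "X \<in> Sib X"
  by (simp add: Sib_def le_refl)

lemma Sib_trans: "\<lbrakk>Y \<in> Sib X; A \<in> Sib Y\<rbrakk> \<Longrightarrow> A \<in> Sib X"
  unfolding Sib_def using le_trans by blast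

lemma Sib_eqm: "A \<in> Sib X \<Longrightarrow> eqm A X"
  unfolding Sib_def eqm_def using le_refl by blast

lemma Sib_between: "\<lbrakk>A \<in> Sib X; A \<subseteq> B; B \<subseteq> X\<rbrakk> \<Longrightarrow> B \<in> Sib X"
  unfolding Sib_def using le_trans le_refl by blast

lemma fin_Sib: "\<lbrakk>fin X; Y \<in> Sib X\<rbrakk> \<Longrightarrow> fin Y"
  unfolding fin_def using Sib_trans by meson

lemma oneD: "\<lbrakk>one X; A \<in> Sib X\<rbrakk> \<Longrightarrow> ism A X"
  by (simp add: one_def)

lemma not_fin_seq:
  assumes "\<And>p::nat. S p \<in> Sib X" and "\<And>p q. ism (S p) (S q) \<Longrightarrow> p = q"
  shows "\<not> fin X"
proof
  assume "fin X"
  then obtain F where F: "finite F" "\<And>A. A \<in> Sib X \<Longrightarrow> \<exists>B\<in>F. ism A B" unfolding fin_def by blast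
  have "\<forall>p. \<exists>B. B \<in> F \<and> ism (S p) B" using F assms(1) by blast
  then obtain c where c: "\<And>p. c p \<in> F \<and> ism (S p) (c p)" by metis
  have "inj c" 
    by (rule injI) (metis c assms(2) ism_sym ism_trans)
  moreover have "range c \<subseteq> F" using c by blast
  ultimately show False using F(1) finite_imageD[of c UNIV] finite_subset by auto
qed

section \<open>Uniform relations, components and co-components\<close>

lemma relD: "\<lbrakk>rel t A B; a \<in> A; b \<in> B\<rbrakk> \<Longrightarrow> e a b = t"
  by (simp add: rel_def)

lemma rel_sym: "rel t A B = rel t B A"
  unfolding rel_def using esym by blast

lemma discI: "\<lbrakk>A \<noteq> {}; B \<noteq> {}; A \<inter> B = {}; A \<union> B = S; rel t A B\<rbrakk> \<Longrightarrow> disc t S"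
  unfolding disc_def by blast

lemma disc_sub: "\<lbrakk>A \<subseteq> S; A \<noteq> {}; S - A \<noteq> {}; rel t A (S - A)\<rbrakk> \<Longrightarrow> disc t S"
  by (rule discI[of A "S - A"]) auto

lemma discE:
  assumes "disc t S"
  obtains A B where "A \<noteq> {}" "B \<noteq> {}" "A \<inter> B = {}" "A \<union> B = S" "rel t A B" "rel t B A"
proof -
  obtain A B where "A \<noteq> {}" "B \<noteq> {}" "A \<inter> B = {}" "A \<union> B = S" "rel t A B"
    using assms unfolding disc_def by blast
  moreover from this have "rel t B A" by (simp add: rel_sym[of t B A])
  ultimately show ?thesis using that by blast
qed

lemma ndiscD: "\<lbrakk>\<not> disc t S; A \<subseteq> S; A \<noteq> {}; rel t A (S - A)\<rbrakk> \<Longrightarrow> A = S"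
  using disc_sub by blast

lemma ndisc_cross:
  assumes "\<not> disc t S" "A \<subseteq> S" "a \<in> A" "b \<in> S" "b \<notin> A"
  obtains c d where "c \<in> A" "d \<in> S" "d \<notin> A" "e c d = (\<not> t)"
  using ndiscD[of t S A] assms unfolding rel_def by auto

text \<open>A graph and its complement are not both disconnected: opposite cells of the 2 x 2 table
  of intersections cannot both be inhabited, since the value between them would be \<open>t\<close>
  and \<open>\<not> t\<close>. So one cell of each opposite pair is empty, and two such cells make
  up a whole part.\<close>

lemma disc_both: "disc t S \<Longrightarrow> \<not> disc (\<not> t) S"
proof
  assume "disc t S" "disc (\<not> t) S"
  then obtain A B C D where *: "A \<noteq> {}" "B \<noteq> {}" "A \<inter> B = {}" "A \<union> B = S" "rel t A B"
    "C \<noteq> {}" "D \<noteq> {}" "C \<inter> D = {}" "C \<union> D = S" "rel (\<not> t) C D" "rel (\<not> t) D C"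
    by (elim discE) blast
  have 1: "A \<inter> C = {} \<or> B \<inter> D = {}" and 2: "A \<inter> D = {} \<or> B \<inter> C = {}"
    using *(5,10,11) unfolding rel_def by blast+
  show False using 1 2 *(1-4,6-9) by blast
qed

lemma ndisc_split:
  assumes "\<not> disc t C" "C \<subseteq> A \<union> B" "rel t A B" "A \<inter> B = {}"
  shows "C \<subseteq> A \<or> C \<subseteq> B"
proof (rule ccontr)
  assume "\<not> ?thesis"
  then have "disc t C" using assms(2-4)
    by (intro discI[of "C \<inter> A" "C \<inter> B"]) (auto simp: rel_def)
  then show False using assms(1) by blast
qed

lemma disc_emb_img:
  assumes "emb f X Y" shows "disc t (f ` X) = disc t X"
proof
  note d = embD[OF assms]
  assume "disc t X"
  then obtain A B where *: "A \<noteq> {}" "B \<noteq> {}" "A \<inter> B = {}" "A \<union> B = X" "rel t A B" by (elim discE)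
  show "disc t (f ` X)"
  proof (rule discI[of "f ` A" "f ` B"])
    show "f ` A \<inter> f ` B = {}" using * d(4) by auto
    show "rel t (f ` A) (f ` B)" unfolding rel_def
    proof safe
      fix a b assume ab: "a \<in> A" "b \<in> B"
      then have "a \<noteq> b" using * by blast
      then have "e (f a) (f b) = e a b" using ab * d(3)[of a b] by blast
      then show "e (f a) (f b) \<Longrightarrow> t" "t \<Longrightarrow> e (f a) (f b)" using ab *(5) by (auto simp: rel_def)
    qed
  qed (use * in auto)
next
  note d = embD[OF assms]
  assume "disc t (f ` X)"
  then obtain A B where *: "A \<noteq> {}" "B \<noteq> {}" "A \<inter> B = {}" "A \<union> B = f ` X" "rel t A B" by (elim discE)
  show "disc t X"
  proof (rule discI[of "{x\<in>X. f x \<in> A}" "{x\<in>X. f x \<in> B}"])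
    show "{x\<in>X. f x \<in> A} \<noteq> {}" using * by (metis (mono_tags, lifting) Un_iff all_not_in_conv imageE mem_Collect_eq)
    show "{x\<in>X. f x \<in> B} \<noteq> {}" using * by (metis (mono_tags, lifting) Un_iff all_not_in_conv imageE mem_Collect_eq)
    show "rel t {x\<in>X. f x \<in> A} {x\<in>X. f x \<in> B}" unfolding rel_def
    proof safe
      fix a b assume ab: "a \<in> X" "f a \<in> A" "b \<in> X" "f b \<in> B"
      then have "a \<noteq> b" using * by blast
      then have "e (f a) (f b) = e a b" using ab d(3)[of a b] by blast
      moreover have "e (f a) (f b) = t" using ab *(5) by (auto simp: rel_def)
      ultimately show "e a b \<Longrightarrow> t" "t \<Longrightarrow> e a b" by auto
    qed
  qed (use * in auto)
qed

lemma disc_ism: "ism X Y \<Longrightarrow> disc t X = disc t Y"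
  unfolding ism_def using disc_emb_img by blast

lemma cpt_self: "x \<in> S \<Longrightarrow> x \<in> cpt t S x"
  unfolding cpt_def by auto

lemma cpt_sub: "x \<in> S \<Longrightarrow> cpt t S x \<subseteq> S"
  unfolding cpt_def by (rule Inter_lower) (auto simp: rel_def)

lemma cpt_rel: "rel t (cpt t S x) (S - cpt t S x)"
  unfolding rel_def
proof (intro ballI)
  fix a b assume a: "a \<in> cpt t S x" and b: "b \<in> S - cpt t S x"
  then obtain A where "x \<in> A" "A \<subseteq> S" "rel t A (S - A)" "b \<notin> A" unfolding cpt_def by blast
  then show "e a b = t" using a b unfolding cpt_def rel_def by blast
qed

lemma cpt_least: "\<lbrakk>x \<in> A; A \<subseteq> S; rel t A (S - A)\<rbrakk> \<Longrightarrow> cpt t S x \<subseteq> A"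
  unfolding cpt_def by blast

lemma cpt_ndisc: assumes "x \<in> S" shows "\<not> disc t (cpt t S x)"
proof
  let ?C = "cpt t S x"
  assume "disc t ?C"
  then obtain A B where *: "A \<noteq> {}" "B \<noteq> {}" "A \<inter> B = {}" "A \<union> B = ?C" "rel t A B" "rel t B A"
    by (elim discE)
  have cr: "rel t ?C (S - ?C)" by (rule cpt_rel)
  have S: "?C \<subseteq> S" by (rule cpt_sub[OF assms])
  have "cpt t S x \<subseteq> D" if "x \<in> D" "D \<union> D' = ?C" "rel t D D'" for D D'
  proof (rule cpt_least)
    show "rel t D (S - D)" unfolding rel_def
    proof (intro ballI)
      fix a b assume "a \<in> D" "b \<in> S - D"
      then show "e a b = t" using relD[OF that(3), of a b] relD[OF cr, of a b] that(2) by blast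
    qed
  qed (use that S in auto)
  from this[of A B] this[of B A] have "x \<in> A \<Longrightarrow> ?C \<subseteq> A" "x \<in> B \<Longrightarrow> ?C \<subseteq> B" using * by auto
  moreover have "x \<in> A \<or> x \<in> B" using cpt_self[OF assms, of t] *(4) by blast
  ultimately show False using *(1-4) by blast
qed

lemma cpt_max:
  assumes "x \<in> S" "C \<subseteq> S" "\<not> disc t C" "x \<in> C" shows "C \<subseteq> cpt t S x"
proof -
  have "C \<subseteq> cpt t S x \<or> C \<subseteq> S - cpt t S x"
    by (rule ndisc_split[OF assms(3)]) (use assms cpt_rel in auto)
  then show ?thesis using assms cpt_self by blast
qed

lemma cpt_eq:
  assumes "x \<in> S" "y \<in> cpt t S x" shows "cpt t S y = cpt t S x"
proof -
  have y: "y \<in> S" using assms cpt_sub by blast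
  have 1: "cpt t S x \<subseteq> cpt t S y"
    using cpt_max[OF y cpt_sub[OF assms(1)] cpt_ndisc[OF assms(1)] assms(2)] .
  then have "x \<in> cpt t S y" using cpt_self assms by blast
  then have "cpt t S y \<subseteq> cpt t S x"
    using cpt_max[OF assms(1) cpt_sub[OF y] cpt_ndisc[OF y]] by blast
  then show ?thesis using 1 by blast
qed

lemma cpt_proper: "\<lbrakk>disc t S; x \<in> S\<rbrakk> \<Longrightarrow> cpt t S x \<noteq> S"
  using cpt_ndisc by metis

section \<open>Modules\<close>

lemma modlD:
  assumes "modl M X"
  shows "M \<subseteq> X" "M \<noteq> {}" "\<And>z a b. \<lbrakk>z \<in> X; z \<notin> M; a \<in> M; b \<in> M\<rbrakk> \<Longrightarrow> e z a = e z b"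
  using assms unfolding modl_def by blast+

lemma modlI:
  "\<lbrakk>M \<subseteq> X; M \<noteq> {}; \<And>z a b. \<lbrakk>z \<in> X; z \<notin> M; a \<in> M; b \<in> M\<rbrakk> \<Longrightarrow> e z a = e z b\<rbrakk> \<Longrightarrow> modl M X"
  unfolding modl_def by blast

lemma modl_self: "X \<noteq> {} \<Longrightarrow> modl X X"
  by (auto simp: modl_def)

lemma modl_restrict: "\<lbrakk>modl M X; Y \<subseteq> X; M \<inter> Y \<noteq> {}\<rbrakk> \<Longrightarrow> modl (M \<inter> Y) Y"
  unfolding modl_def by blast

lemma modl_trans: "\<lbrakk>modl N M; modl M X\<rbrakk> \<Longrightarrow> modl N X"
  unfolding modl_def by blast

lemma modl_sub: "\<lbrakk>modl N X; N \<subseteq> M; M \<subseteq> X\<rbrakk> \<Longrightarrow> modl N M"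
  unfolding modl_def by blast

lemma modl_union:
  assumes "modl A X" "modl B X" "A \<inter> B \<noteq> {}" shows "modl (A \<union> B) X"
proof -
  obtain c where c: "c \<in> A" "c \<in> B" using assms by blast
  have "e z a = e z c" if "z \<in> X" "z \<notin> A \<union> B" "a \<in> A \<union> B" for z a
    using assms(1,2) c that unfolding modl_def by blast
  then show ?thesis using assms unfolding modl_def by blast
qed

text \<open>A source of overlapping modules: a vertex of \<open>M - A\<close> sees all of
  \<open>A\<close> and all of \<open>S - M\<close> with the value \<open>t\<close>. If
  \<open>M - A\<close> and \<open>S - M\<close> are nonempty, the new module overlaps
  \<open>M\<close>, which is impossible for a strong \<open>M\<close>.\<close>

lemma modl_disc_ext:
  assumes "modl S X" "M \<subseteq> S" "rel t (S - M) M" "A \<subseteq> M" "A \<noteq> {}" "rel t A (M - A)"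
  shows "modl (A \<union> (S - M)) X"
proof (rule modlI)
  show "A \<union> (S - M) \<subseteq> X" using assms(1,2,4) modlD(1) by blast
  fix z a b assume z: "z \<in> X" "z \<notin> A \<union> (S - M)" and ab: "a \<in> A \<union> (S - M)" "b \<in> A \<union> (S - M)"
  have sub: "A \<union> (S - M) \<subseteq> S" using assms by blast
  show "e z a = e z b"
  proof (cases "z \<in> S")
    case False then show ?thesis using modlD(3)[OF assms(1) z(1)] ab sub by blast
  next
    case True
    then have zM: "z \<in> M - A" using z by blast
    have "e z c = t" if "c \<in> A \<union> (S - M)" for c
      using that zM assms(3,6) esym[of z c] by (auto simp: rel_def)
    then show ?thesis using ab by blast
  qed
qed (use assms in auto)

lemma modl_rel:
  assumes "modl A X" "modl B X" "A \<inter> B = {}" "a \<in> A" "b \<in> B"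
  shows "rel (e a b) A B"
  unfolding rel_def
proof (intro ballI)
  fix x y assume xy: "x \<in> A" "y \<in> B"
  have "e x y = e x b" using modlD(3)[OF assms(2), of x y b] modlD(1)[OF assms(1)] xy assms by blast
  moreover have "e b x = e b a" using modlD(3)[OF assms(1), of b x a] modlD(1)[OF assms(2)] xy assms by blast
  ultimately show "e x y = e a b" using esym by metis
qed

text \<open>The value of one pair from \<open>A - B\<close> and \<open>B - A\<close> spreads through
  both modules, so the three parts \<open>A - B\<close>, \<open>A \<inter> B\<close> and
  \<open>B - A\<close> are pairwise related in the same way.\<close>

lemma overlap:
  assumes "modl A X" "modl B X" "A \<inter> B \<noteq> {}" "\<not> A \<subseteq> B" "\<not> B \<subseteq> A"
  obtains s where "disc s A" "rel s (B - A) A" "rel s (A - B) (A \<inter> B)"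
proof -
  obtain a b c where *: "a \<in> A" "a \<notin> B" "b \<in> B" "b \<notin> A" "c \<in> A" "c \<in> B" using assms by blast
  have AX: "A \<subseteq> X" "B \<subseteq> X" using assms modlD by auto
  define s where "s = e a b"
  have 1: "e x y = s" if "x \<in> A" "x \<notin> B" "y \<in> B" for x y
  proof -
    have "e x y = e x b" using modlD(3)[OF assms(2), of x y b] that * AX by blast
    moreover have "e b x = e b a" using modlD(3)[OF assms(1), of b x a] that * AX by blast
    ultimately show ?thesis unfolding s_def using esym by metis
  qed
  have 2: "e x y = s" if "x \<in> B" "x \<notin> A" "y \<in> A" for x y
  proof -
    have "e x y = e x a" using modlD(3)[OF assms(1), of x y a] that * AX by blast
    then show ?thesis using 1[of a x] that * esym by metis
  qed
  have r: "rel s (A - B) (A \<inter> B)" using 1 by (auto simp: rel_def)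
  moreover have "disc s A" by (rule discI[OF _ _ _ _ r]) (use * in auto)
  moreover have "rel s (B - A) A" using 2 by (auto simp: rel_def)
  ultimately show ?thesis using that by blast
qed

section \<open>Strong modules\<close>

lemma strongD:
  assumes "strong M X"
  shows "modl M X" "M \<subseteq> X" "M \<noteq> {}"
    "\<And>z a b. \<lbrakk>z \<in> X; z \<notin> M; a \<in> M; b \<in> M\<rbrakk> \<Longrightarrow> e z a = e z b"
    "\<And>N. modl N X \<Longrightarrow> N \<subseteq> M \<or> M \<subseteq> N \<or> N \<inter> M = {}"
  using assms unfolding strong_def modl_def by blast+

lemma strong_cmp: "\<lbrakk>strong M X; modl N X; x \<in> M; x \<in> N\<rbrakk> \<Longrightarrow> N \<subseteq> M \<or> M \<subseteq> N"
  unfolding strong_def by blast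

lemma strong_self: "X \<noteq> {} \<Longrightarrow> strong X X"
  unfolding strong_def modl_def by auto

lemma strong_trans: "\<lbrakk>strong N M; strong M X\<rbrakk> \<Longrightarrow> strong N X"
  unfolding strong_def
proof (intro conjI allI impI; elim conjE)
  assume "modl N M" "modl M X" then show "modl N X" using modl_trans by blast
next
  fix Q assume a: "modl N M" "\<forall>Na. modl Na M \<longrightarrow> Na \<subseteq> N \<or> N \<subseteq> Na \<or> Na \<inter> N = {}"
    "modl M X" "\<forall>N. modl N X \<longrightarrow> N \<subseteq> M \<or> M \<subseteq> N \<or> N \<inter> M = {}" "modl Q X"
  have "N \<subseteq> M" "M \<subseteq> X" using a modlD(1) by auto
  then show "Q \<subseteq> N \<or> N \<subseteq> Q \<or> Q \<inter> N = {}" using a modl_sub[of Q X M] by blast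
qed

text \<open>By \<open>overlap\<close>, a module overlapping \<open>M\<close> is related to
  \<open>M\<close> by a type in which \<open>M\<close> itself splits; strength has to be tested
  against such modules only.\<close>

lemma strongI_ndisc:
  assumes "modl M X"
    "\<And>s N. \<lbrakk>disc s M; modl N X; N \<inter> M \<noteq> {}; N - M \<noteq> {}; M - N \<noteq> {}; rel s (N - M) M\<rbrakk> \<Longrightarrow> False"
  shows "strong M X"
  unfolding strong_def
proof (intro conjI allI impI assms(1))
  fix N assume N: "modl N X"
  show "N \<subseteq> M \<or> M \<subseteq> N \<or> N \<inter> M = {}"
  proof (rule ccontr)
    assume c: "\<not> ?thesis"
    obtain s where "disc s M" "rel s (N - M) M" using overlap[OF assms(1) N] c by blast
    then show False using assms(2)[of s N] N c by blast
  qed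
qed

lemma strong_ndisc: "\<lbrakk>modl M X; \<not> disc True M; \<not> disc False M\<rbrakk> \<Longrightarrow> strong M X"
proof (rule strongI_ndisc)
  fix s assume "disc s M" "\<not> disc True M" "\<not> disc False M"
  then show False by (cases s) auto
qed

lemma strong_Inter:
  assumes "\<S> \<noteq> {}" "\<And>S. S \<in> \<S> \<Longrightarrow> strong S X" "\<Inter>\<S> \<noteq> {}"
  shows "strong (\<Inter>\<S>) X"
  unfolding strong_def
proof (intro conjI allI impI)
  obtain x where x: "x \<in> \<Inter>\<S>" using assms by blast
  show "modl (\<Inter>\<S>) X"
  proof (rule modlI)
    show "\<Inter>\<S> \<subseteq> X" using assms(1,2) strongD(2) by blast
    fix z a b assume z: "z \<in> X" "z \<notin> \<Inter>\<S>" "a \<in> \<Inter>\<S>" "b \<in> \<Inter>\<S>"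
    then obtain S where "S \<in> \<S>" "z \<notin> S" by blast
    then show "e z a = e z b" using strongD(4)[OF assms(2), of S z a b] z by blast
  qed (rule assms(3))
  fix N assume "modl N X"
  then show "N \<subseteq> \<Inter>\<S> \<or> \<Inter>\<S> \<subseteq> N \<or> N \<inter> \<Inter>\<S> = {}"
    using strongD(5)[OF assms(2)] by blast
qed

text \<open>Strong modules with a common vertex are comparable, so the family is a chain;
  \<open>x\<close> serves as the reference vertex for all values.\<close>

lemma strong_Union_chain:
  assumes "\<S> \<noteq> {}" "\<And>S. S \<in> \<S> \<Longrightarrow> strong S X" "x \<in> \<Inter>\<S>"
  shows "strong (\<Union>\<S>) X"
proof -
  show ?thesis unfolding strong_def
  proof (intro conjI allI impI)
    show "modl (\<Union>\<S>) X"
    proof (rule modlI)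
      show "\<Union>\<S> \<subseteq> X" using assms(2) strongD(2) by blast
      show "\<Union>\<S> \<noteq> {}" using assms by blast
      fix z a b assume z: "z \<in> X" "z \<notin> \<Union>\<S>" "a \<in> \<Union>\<S>" "b \<in> \<Union>\<S>"
      have "e z c = e z x" if cS: "c \<in> \<Union>\<S>" for c
      proof -
        obtain S where "S \<in> \<S>" "c \<in> S" using cS by blast
        then show ?thesis using strongD(4)[OF assms(2), of S z c x] z assms(3) by blast
      qed
      then show "e z a = e z b" using z by metis
    qed
    fix N assume N: "modl N X"
    show "N \<subseteq> \<Union>\<S> \<or> \<Union>\<S> \<subseteq> N \<or> N \<inter> \<Union>\<S> = {}"
    proof (cases "\<exists>S\<in>\<S>. N \<subseteq> S")
      case False
      have 1: "S \<subseteq> N \<or> N \<inter> S = {}" if "S \<in> \<S>" for S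
        using strongD(5)[OF assms(2)[OF that] N] False that by blast
      show ?thesis
      proof (cases "x \<in> N")
        case True
        then have "S \<subseteq> N" if "S \<in> \<S>" for S using 1[OF that] assms(3) that by blast
        then show ?thesis by blast
      next
        case False
        then have "N \<inter> S = {}" if "S \<in> \<S>" for S using 1[OF that] assms(3) that by blast
        then show ?thesis by blast
      qed
    qed blast
  qed
qed

text \<open>A module \<open>N\<close> overlapping the component contains a vertex \<open>r\<close>
  related to it by \<open>\<not> t\<close>, hence outside \<open>J\<close>. A vertex
  \<open>c\<close> of another component sees \<open>r\<close> with value \<open>\<not> t\<close>
  because \<open>J\<close> is a module, and with value \<open>t\<close> because \<open>N\<close> is
  one.\<close>

lemma strong_cpt:
  assumes "modl J X" "disc t J" "x \<in> J" shows "strong (cpt t J x) X"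
proof (rule strongI_ndisc)
  let ?C = "cpt t J x"
  have CJ: "?C \<subseteq> J" "x \<in> ?C" using cpt_sub cpt_self assms by auto
  have cr: "rel t ?C (J - ?C)" by (rule cpt_rel)
  have cr': "rel t (J - ?C) ?C" using cr rel_sym by blast
  have "modl ?C J" by (rule modlI) (use CJ relD[OF cr'] in auto)
  then show mC: "modl ?C X" using modl_trans assms(1) by blast
  fix s N assume s: "disc s ?C" and N: "modl N X" "N \<inter> ?C \<noteq> {}" "N - ?C \<noteq> {}" "?C - N \<noteq> {}" "rel s (N - ?C) ?C"
  have st: "s = (\<not> t)" using cpt_ndisc[OF assms(3), of t] s by (cases s; cases t) auto
  obtain c where c: "c \<in> J" "c \<notin> ?C" using cpt_proper[OF assms(2,3)] CJ by blast
  obtain r where r: "r \<in> N" "r \<notin> ?C" using N by blast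
  obtain y where y: "y \<in> N" "y \<in> ?C" using N by blast
  have JX: "J \<subseteq> X" "N \<subseteq> X" using assms N modlD by auto
  have ry: "e r y = s" using N(5) r y by (auto simp: rel_def)
  have "r \<notin> J" using cr r y ry st esym by (auto simp: rel_def)
  then have "e r c = s" using modlD(3)[OF assms(1), of r c y] r c y ry CJ JX by blast
  moreover have cy: "e c y = t" using cr c y esym by (auto simp: rel_def)
  have "c \<notin> N" using N(5) c y cy st by (auto simp: rel_def)
  then have "e c r = e c y" using modlD(3)[OF N(1), of c r y] r c y JX by blast
  ultimately show False using cy st esym by metis
qed

text \<open>Otherwise \<open>M' - M\<close> is related to \<open>M\<close> by \<open>t\<close>, and
  one part of a splitting of \<open>M\<close> together with \<open>M' - M\<close> is a module
  overlapping \<open>M\<close>. This lemma is the reason why types alternate along chains of strong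
  modules.\<close>

lemma strong_other_type:
  assumes "strong M X" "disc t M" "modl M' X" "M \<subset> M'"
  obtains u where "u \<in> M'" "u \<notin> M" "rel (\<not> t) {u} M"
proof -
  have "\<exists>u\<in>M' - M. \<exists>m\<in>M. e u m = (\<not> t)"
  proof (rule ccontr)
    assume "\<not> ?thesis"
    then have r: "rel t (M' - M) M" by (auto simp: rel_def)
    obtain A B where *: "A \<noteq> {}" "B \<noteq> {}" "A \<inter> B = {}" "A \<union> B = M" "rel t A B" using assms(2) by (elim discE)
    have "M - A = B" using * by blast
    then have "modl (A \<union> (M' - M)) X"
      using modl_disc_ext[OF assms(3) _ r, of A] * assms(4) by auto
    from strongD(5)[OF assms(1) this] show False
    proof (elim disjE)
      assume "A \<union> (M' - M) \<subseteq> M" then show False using assms(4) by blast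
    next
      assume "M \<subseteq> A \<union> (M' - M)" then show False using * by blast
    next
      assume "(A \<union> (M' - M)) \<inter> M = {}" then show False using * by blast
    qed
  qed
  then obtain u m where u: "u \<in> M' - M" "m \<in> M" "e u m = (\<not> t)" by blast
  have "e u x = (\<not> t)" if "x \<in> M" for x
    using strongD(4)[OF assms(1), of u x m] u that modlD(1)[OF assms(3)] by blast
  then have "rel (\<not> t) {u} M" unfolding rel_def by blast
  then show ?thesis using that u by blast
qed

section \<open>Hulls of two vertices\<close>

lemma hull_strong:
  assumes "x \<in> X" "y \<in> X" shows "strong (hull X x y) X"
  unfolding hull_def
  by (rule strong_Inter) (use assms strong_self[of X] in auto)

lemma hull_in: "x \<in> hull X x y" "y \<in> hull X x y"
  unfolding hull_def by auto

lemma hull_least: "\<lbrakk>strong S X; x \<in> S; y \<in> S\<rbrakk> \<Longrightarrow> hull X x y \<subseteq> S"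
  unfolding hull_def by blast

text \<open>A connected cograph has diameter at most two, where adjacency means the value
  \<open>\<not> t\<close>. An edge from \<open>z\<close> to \<open>w\<close> that leaves the ball
  \<open>A\<close> of radius two around \<open>x\<close> would complete an induced path
  \<open>x, n, z, w\<close>.\<close>

lemma dist2:
  assumes "S \<subseteq> U" "\<not> disc t S" "x \<in> S" "y \<in> S" "x \<noteq> y" "e x y = t"
  obtains d where "d \<in> S" "d \<noteq> x" "d \<noteq> y" "e d x = (\<not> t)" "e d y = (\<not> t)"
proof -
  define N where "N = {z\<in>S. z \<noteq> x \<and> e z x = (\<not> t)}"
  define A where "A = insert x N \<union> {z\<in>S. \<exists>n\<in>N. z \<noteq> n \<and> e z n = (\<not> t)}"
  have "A = S"
  proof (rule ccontr)
    assume "A \<noteq> S"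
    moreover have AS: "A \<subseteq> S" using assms by (auto simp: A_def N_def)
    ultimately obtain b where "b \<in> S" "b \<notin> A" by blast
    then obtain z w where zw: "z \<in> A" "w \<in> S" "w \<notin> A" "e z w = (\<not> t)"
      using ndisc_cross[OF assms(2) AS, of x] by (auto simp: A_def)
    have zx: "z \<noteq> x" using zw assms by (auto simp: A_def N_def esym)
    have zN: "z \<notin> N" using zw assms esym by (auto simp: A_def)
    then obtain n where n: "n \<in> N" "z \<noteq> n" "e z n = (\<not> t)" "z \<in> S" using zw zx by (auto simp: A_def)
    have d: "distinct [x, n, z, w]" using n zx zw by (auto simp: A_def N_def)
    show False
      using p4[OF _ _ _ _ d, of "\<not> t"] assms n zw zx zN d esym unfolding A_def N_def
      by (auto simp: subset_eq)
  qed
  then have "y \<in> A" using assms by simp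
  then obtain n where "n \<in> N" "y \<noteq> n" "e y n = (\<not> t)" using assms esym[of x y] by (auto simp: A_def N_def)
  then show ?thesis using that[of n] esym[of y n] by (auto simp: N_def)
qed

text \<open>\<open>D\<close> is the set of common neighbours of \<open>x\<close> and
  \<open>y\<close> for the value \<open>\<not> t\<close>. A component of \<open>S - D\<close>
  containing both would contain a further common neighbour by \<open>dist2\<close>. Hence each
  component misses one of them, say \<open>w\<close>; if \<open>d\<close> were adjacent to some but
  not all of the component, an edge \<open>a b\<close> inside it, with only \<open>a\<close>
  adjacent to \<open>d\<close>, would give the induced path \<open>w, d, a, b\<close>.\<close>

lemma common_complete:
  assumes "S \<subseteq> U" "x \<in> S" "y \<in> S" "x \<noteq> y" "e x y = t"
    and D: "D = {d\<in>S. d \<noteq> x \<and> d \<noteq> y \<and> e d x = (\<not> t) \<and> e d y = (\<not> t)}"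
  shows "y \<notin> cpt t (S - D) x" "\<lbrakk>d \<in> D; z \<in> S - D; z' \<in> cpt t (S - D) z; e d z = (\<not> t)\<rbrakk> \<Longrightarrow> e d z' = (\<not> t)"
proof -
  have xy: "x \<in> S - D" "y \<in> S - D" using assms by auto
  show ny: "y \<notin> cpt t (S - D) x"
  proof
    let ?C = "cpt t (S - D) x"
    assume y: "y \<in> ?C"
    have "?C \<subseteq> S - D" "x \<in> ?C" using cpt_sub cpt_self xy by auto
    then obtain d where "d \<in> ?C" "d \<noteq> x" "d \<noteq> y" "e d x = (\<not> t)" "e d y = (\<not> t)"
      using dist2[of ?C t x y] cpt_ndisc[OF xy(1)] y assms by blast
    then show False using \<open>?C \<subseteq> S - D\<close> D by blast
  qed
  then have nx: "x \<notin> cpt t (S - D) y" using cpt_eq[OF xy(2)] cpt_self[OF xy(2)] by metis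
  assume d: "d \<in> D" and z: "z \<in> S - D" and z': "z' \<in> cpt t (S - D) z" and dz: "e d z = (\<not> t)"
  let ?C = "cpt t (S - D) z"
  have C: "?C \<subseteq> S - D" "z \<in> ?C" using cpt_sub cpt_self z by auto
  obtain w where w: "w \<in> {x, y}" "w \<notin> ?C"
    using ny cpt_eq[OF z] cpt_self[OF xy(1)] cpt_self[OF xy(2)] by (metis insertCI)
  have wS: "w \<in> S - D" using w xy by auto
  show "e d z' = (\<not> t)"
  proof (rule ccontr)
    assume nd: "e d z' \<noteq> (\<not> t)"
    obtain a b where ab: "a \<in> {k\<in>?C. e d k = (\<not> t)}" "b \<in> ?C" "b \<notin> {k\<in>?C. e d k = (\<not> t)}" "e a b = (\<not> t)"
      using ndisc_cross[OF cpt_ndisc[OF z, of t], where A = "{k\<in>?C. e d k = (\<not> t)}" and a = z and b = z'] C z' dz nd by auto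
    have wa: "e a w = t" "e b w = t"
      using cpt_rel[of t "S - D" z] ab w wS by (auto simp: rel_def)
    have dw: "e d w = (\<not> t)" "d \<noteq> w" using d w D by auto
    have ds: "distinct [w, d, a, b]" using ab w d dw C by auto
    show False
      using p4[OF _ _ _ _ ds, of "\<not> t"] ab wa dw esym assms(1) C wS d D by auto
  qed
qed

text \<open>Suppose that \<open>x\<close> and \<open>y\<close> lie in one component of their hull
  \<open>H\<close>. The vertices of \<open>H - D\<close> that are adjacent, for
  \<open>\<not> t\<close>, to all common neighbours \<open>D\<close> then form a union
  \<open>A\<close> of components of \<open>H - D\<close>. It contains \<open>x\<close> and
  \<open>y\<close> and is a strong module, but it misses the nonempty set \<open>D\<close>, against
  the minimality of \<open>H\<close>.\<close>

lemma node:
  assumes "X \<subseteq> U" "x \<in> X" "y \<in> X" "x \<noteq> y"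
  shows "y \<notin> cpt (e x y) (hull X x y) x" "disc (e x y) (hull X x y)"
proof -
  define t where "t = e x y"
  define H where "H = hull X x y"
  have H: "strong H X" "x \<in> H" "y \<in> H" "H \<subseteq> X" "H \<subseteq> U"
    using hull_strong[OF assms(2,3)] hull_in strongD(2)[OF hull_strong[OF assms(2,3)]] assms(1) unfolding H_def by auto
  show ny: "y \<notin> cpt (e x y) (hull X x y) x"
  proof (fold H_def t_def, rule notI)
    assume y: "y \<in> cpt t H x"
    have nd: "\<not> disc t H"
    proof
      assume d: "disc t H"
      have "strong (cpt t H x) X" using strong_cpt[OF strongD(1)[OF H(1)] d H(2)] .
      then have "H \<subseteq> cpt t H x" using hull_least cpt_self[OF H(2)] y H_def by metis
      then show False using cpt_proper[OF d H(2)] cpt_sub[OF H(2)] by blast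
    qed
    define D where "D = {d\<in>H. d \<noteq> x \<and> d \<noteq> y \<and> e d x = (\<not> t) \<and> e d y = (\<not> t)}"
    note cc = common_complete[OF H(5,2,3) assms(4) t_def[symmetric] D_def]
    obtain d0 where d0: "d0 \<in> D" using dist2[OF H(5) nd H(2,3) assms(4) t_def[symmetric]] D_def by blast
    define A where "A = {z\<in>H - D. \<forall>d\<in>D. e d z = (\<not> t)}"
    have xyA: "x \<in> A" "y \<in> A" using H by (auto simp: A_def D_def)
    have Acomp: "cpt t (H - D) z \<subseteq> A" if "z \<in> A" for z
      using cc(2) that cpt_sub[of z "H - D" t] unfolding A_def by blast
    have relA: "e z a = t" if "z \<in> H - D" "z \<notin> A" "a \<in> A" for z a
      using cpt_rel[of t "H - D" a] cpt_self[of a "H - D" t] that Acomp[OF that(3)] esym[of z a] 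
      unfolding rel_def A_def by blast
    have "modl A H"
    proof (rule modlI)
      fix z a b assume z: "z \<in> H" "z \<notin> A" "a \<in> A" "b \<in> A"
      show "e z a = e z b"
        using z relA[of z] by (cases "z \<in> D") (auto simp: A_def)
    qed (use xyA in \<open>auto simp: A_def\<close>)
    then have mA: "modl A X" using modl_trans strongD(1)[OF H(1)] by blast
    have xAC: "cpt t (H - D) x \<subseteq> A" using Acomp xyA by blast
    have xin: "x \<in> cpt t (H - D) x" using cpt_self[of x "H - D"] xyA by (simp add: A_def)
    have "rel t (cpt t (H - D) x) (A - cpt t (H - D) x)"
      using cpt_rel[of t "H - D" x] unfolding rel_def A_def by blast
    then have dA: "disc t A" using disc_sub[OF xAC] xin xyA cc(1) by blast
    have "strong A X"
    proof (rule strongI_ndisc[OF mA])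
      fix s N assume s: "disc s A" and N: "modl N X" "N \<inter> A \<noteq> {}" "N - A \<noteq> {}" "A - N \<noteq> {}" "rel s (N - A) A"
      have st: "s = t" using s dA disc_both[of t A] by (cases s; cases t) auto
      have "N \<subseteq> H" using strongD(5)[OF H(1) N(1)] N(2,4) by (auto simp: A_def)
      obtain r a where r: "r \<in> N" "r \<notin> A" "a \<in> N" "a \<in> A" using N by blast
      have ra: "e r a = t" using N(5) r st by (auto simp: rel_def)
      have "r \<notin> D" using ra r by (auto simp: A_def)
      then obtain d where d: "d \<in> D" "e d r = t" using r \<open>N \<subseteq> H\<close> by (auto simp: A_def)
      have da: "e d a = (\<not> t)" using d r by (auto simp: A_def)
      have "d \<notin> A" using d by (auto simp: A_def)
      then have "d \<notin> N" using N(5) da r st by (auto simp: rel_def)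
      then have "e d r = e d a" using modlD(3)[OF N(1), of d r a] r d H(4) by (auto simp: D_def)
      then show False using d da by simp
    qed
    then have "H \<subseteq> A" using hull_least xyA H_def by metis
    then show False using d0 by (auto simp: A_def D_def)
  qed
  show "disc (e x y) (hull X x y)"
    using disc_sub[OF cpt_sub _ _ cpt_rel, of x "hull X x y" "e x y"] cpt_self[of x "hull X x y"] hull_in ny by blast
qed

section \<open>Alternating chains of modules\<close>

lemma modl_img:
  assumes "emb f X Y" "f ` X = Y" "modl M X" shows "modl (f ` M) Y"
proof (rule modlI)
  note d = embD[OF assms(1)] and m = modlD[OF assms(3)]
  show "f ` M \<subseteq> Y" "f ` M \<noteq> {}" using assms m by auto
  fix z a b assume z: "z \<in> Y" "z \<notin> f ` M" "a \<in> f ` M" "b \<in> f ` M"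
  then obtain z' a' b' where *: "z = f z'" "z' \<in> X" "a = f a'" "a' \<in> M" "b = f b'" "b' \<in> M"
    using assms(2) by blast
  have "z' \<notin> M" using z * by blast
  then have "e z' a' = e z' b'" "z' \<noteq> a'" "z' \<noteq> b'" "a' \<in> X" "b' \<in> X" using m * by blast+
  then show "e z a = e z b" using d(3)[of z' a'] d(3)[of z' b'] * by simp
qed

lemma modl_vimg:
  assumes "emb f X Y" "modl M Y" "{x\<in>X. f x \<in> M} \<noteq> {}" shows "modl {x\<in>X. f x \<in> M} X"
proof (rule modlI)
  note d = embD[OF assms(1)] and m = modlD[OF assms(2)]
  fix z a b assume z: "z \<in> X" "z \<notin> {x\<in>X. f x \<in> M}" "a \<in> {x\<in>X. f x \<in> M}" "b \<in> {x\<in>X. f x \<in> M}"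
  then have "f z \<notin> M" "z \<noteq> a" "z \<noteq> b" "f a \<in> M" "f b \<in> M" "a \<in> X" "b \<in> X" by auto
  moreover have "f z \<in> Y" using d z by blast
  ultimately have "e (f z) (f a) = e (f z) (f b)" using m(3)[of "f z" "f a" "f b"] by blast
  then show "e z a = e z b" using d(3)[of z a] d(3)[of z b] z \<open>z \<noteq> a\<close> \<open>z \<noteq> b\<close> by simp
qed (use assms in auto)

lemma strong_img:
  assumes "emb f X Y" "f ` X = Y" "strong M X" shows "strong (f ` M) Y"
  unfolding strong_def
proof (intro conjI allI impI)
  note d = embD[OF assms(1)]
  have MX: "M \<subseteq> X" using strongD assms by blast
  show "modl (f ` M) Y" using modl_img[OF assms(1,2)] strongD(1)[OF assms(3)] by blast
  fix N assume N: "modl N Y"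
  let ?N = "{x\<in>X. f x \<in> N}"
  have "N \<subseteq> Y" "N \<noteq> {}" using modlD[OF N] by auto
  then have NN: "f ` ?N = N" using assms(2) by auto
  then have "?N \<noteq> {}" using \<open>N \<noteq> {}\<close> by (metis image_empty)
  then have "?N \<subseteq> M \<or> M \<subseteq> ?N \<or> ?N \<inter> M = {}"
    using strongD(5)[OF assms(3) modl_vimg[OF assms(1) N]] by blast
  then show "N \<subseteq> f ` M \<or> f ` M \<subseteq> N \<or> N \<inter> f ` M = {}"
  proof (elim disjE)
    assume "?N \<subseteq> M" then show ?thesis using NN by blast
  next
    assume "M \<subseteq> ?N" then show ?thesis by blast
  next
    assume "?N \<inter> M = {}"
    then have "N \<inter> f ` M = {}" using MX by auto
    then show ?thesis by blast
  qed
qed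

text \<open>A module overlapping \<open>M\<close> contains a vertex \<open>r\<close> related to
  \<open>M\<close> by \<open>s\<close>, hence outside \<open>W\<close>; it omits a vertex
  \<open>z\<close> of \<open>W - M\<close>, which is related to \<open>M\<close> by
  \<open>\<not> s\<close>. The two modules then force different values on the pair \<open>z\<close>,
  \<open>r\<close>.\<close>

lemma strong_alt:
  assumes "modl M B" "disc s M" "modl W B" "M \<subset> W" "rel (\<not> s) (W - M) M"
  shows "strong M B"
proof (rule strongI_ndisc[OF assms(1)])
  fix s' N assume s': "disc s' M" and N: "modl N B" "N \<inter> M \<noteq> {}" "N - M \<noteq> {}" "rel s' (N - M) M"
  have ss: "s' = s" using s' assms(2) disc_both[of s M] by (cases s; cases s') auto
  obtain r y z where *: "r \<in> N" "r \<notin> M" "y \<in> N" "y \<in> M" "z \<in> W" "z \<notin> M" using N assms(4) by blast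
  have sub: "N \<subseteq> B" "W \<subseteq> B" using modlD(1) N(1) assms(3) by auto
  have ry: "e r y = s" using relD[OF N(4)] * ss by blast
  have zy: "e z y = (\<not> s)" using relD[OF assms(5)] * by blast
  have rW: "r \<notin> W" using relD[OF assms(5), of r y] ry * by auto
  have zN: "z \<notin> N" using relD[OF N(4), of z y] zy * ss by auto
  have "e z r = e z y" using modlD(3)[OF N(1), of z r y] zN * sub by blast
  moreover have "e r z = e r y" using modlD(3)[OF assms(3), of r z y] rW * sub assms(4) by blast
  ultimately show False using ry zy esym[of z r] by simp
qed

text \<open>If \<open>S\<close> were properly contained in \<open>W\<close>, then
  \<open>M \<union> (W - S)\<close> would be a module overlapping \<open>S\<close>. In an increasing
  alternating chain each member is thus determined by the preceding one.\<close>

lemma next_strong: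
  assumes "strong S B" "modl W B" "M \<subset> S" "M \<subseteq> W" "M \<noteq> {}" "rel t (W - M) M"
  shows "W \<subseteq> S"
proof (rule ccontr)
  assume n: "\<not> W \<subseteq> S"
  obtain m where m: "m \<in> M" using assms by blast
  have SW: "S \<subseteq> W" using strong_cmp[OF assms(1,2), of m] m assms(3,4) n by blast
  have WB: "W \<subseteq> B" using modlD(1) assms by blast
  have r1: "rel t (W - S) S" unfolding rel_def
  proof (intro ballI)
    fix w s assume "w \<in> W - S" "s \<in> S"
    then show "e w s = t" using strongD(4)[OF assms(1), of w s m] relD[OF assms(6), of w m] m assms(3) WB by blast
  qed
  have r2: "rel t M (S - M)" using assms(6) SW unfolding rel_def using esym by blast
  have "modl (M \<union> (W - S)) B" using modl_disc_ext[OF assms(2) SW r1 _ assms(5) r2] assms(3) by blast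
  from strongD(5)[OF assms(1) this] show False
  proof (elim disjE)
    assume "M \<union> (W - S) \<subseteq> S" then show False using n by blast
  next
    assume "S \<subseteq> M \<union> (W - S)" then show False using assms(3) by blast
  next
    assume "(M \<union> (W - S)) \<inter> S = {}" then show False using assms(3) m by blast
  qed
qed

text \<open>A vertex of \<open>W - S\<close> is on the other side of the splitting from
  \<open>x\<close> or from \<open>y\<close>, so it sees \<open>S\<close> with value
  \<open>t\<close>; then \<open>S \<inter> V\<close> together with \<open>W - S\<close> would be a
  module overlapping \<open>S\<close>. This identifies the first strong member of a chain as the
  hull of two vertices.\<close>

lemma disc_hull:
  assumes "strong S B" "x \<in> S" "y \<in> S" "modl W B" "V \<subseteq> W" "x \<in> V" "y \<in> W - V" "rel t V (W - V)"
  shows "W \<subseteq> S"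
proof (rule ccontr)
  assume n: "\<not> W \<subseteq> S"
  have SW: "S \<subseteq> W" using strong_cmp[OF assms(1,4), of x] assms n by blast
  have WB: "W \<subseteq> B" using modlD(1) assms by blast
  have r1: "rel t (W - S) S" unfolding rel_def
  proof (intro ballI)
    fix w s assume w: "w \<in> W - S" "s \<in> S"
    have 1: "e w s = e w x" "e w s = e w y" using strongD(4)[OF assms(1), of w s] w assms WB by blast+
    show "e w s = t" 
    proof (cases "w \<in> V")
      case True then show ?thesis using 1 relD[OF assms(8), of w y] assms(7) by blast
    next
      case False then show ?thesis using 1 relD[OF assms(8), of x w] assms(6) w esym[of w x] by blast
    qed
  qed
  have r2: "rel t (S \<inter> V) (S - S \<inter> V)" using assms(8) SW unfolding rel_def by blast
  have "modl ((S \<inter> V) \<union> (W - S)) B" using modl_disc_ext[OF assms(4) SW r1 _ _ r2] assms(2,6) by blast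
  from strongD(5)[OF assms(1) this] show False
  proof (elim disjE)
    assume "S \<inter> V \<union> (W - S) \<subseteq> S" then show False using n by blast
  next
    assume "S \<subseteq> S \<inter> V \<union> (W - S)" then show False using assms by blast
  next
    assume "(S \<inter> V \<union> (W - S)) \<inter> S = {}" then show False using assms by blast
  qed
qed

text \<open>Increasing and decreasing chains of modules with alternating types. Such a chain is determined by two
  vertices (\<open>upch_unique\<close>, \<open>dnch_unique\<close>), so the patterns in \<open>Inv B\<close> form a countable isomorphism invariant.\<close>

definition upch :: "'a set \<Rightarrow> (nat \<Rightarrow> 'a set) \<Rightarrow> bool \<Rightarrow> bool" where
  "upch B V t \<longleftrightarrow> (\<forall>n. modl (V n) B \<and> V n \<subset> V (Suc n) \<and> rel (t = even n) (V n) (V (Suc n) - V n))"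

definition dnch :: "'a set \<Rightarrow> (nat \<Rightarrow> 'a set) \<Rightarrow> bool \<Rightarrow> bool" where
  "dnch B Q t \<longleftrightarrow> (\<forall>n. modl (Q n) B \<and> Q (Suc n) \<subset> Q n \<and> rel (t = even n) (Q n - Q (Suc n)) (Q (Suc n)) \<and>
     (\<forall>x\<in>Q n - Q (Suc n). \<forall>y\<in>Q n - Q (Suc n). x \<noteq> y \<longrightarrow> e x y = (t = even n)))"

definition Inv :: "'a set \<Rightarrow> (nat \<Rightarrow> bool) set" where
  "Inv B = {p. (\<exists>V t. upch B V t \<and> p = (\<lambda>n. card (V (Suc (Suc n)) - V (Suc n)) = 1)) \<or>
               (\<exists>Q t. dnch B Q t \<and> p = (\<lambda>n. card (Q (Suc n) - Q (Suc (Suc n))) = 1))}"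

lemma upch_strong:
  assumes "upch B V t" shows "strong (V (Suc n)) B" "disc (t = even n) (V (Suc n))"
proof -
  have a: "modl (V m) B" "V m \<subset> V (Suc m)" "rel (t = even m) (V m) (V (Suc m) - V m)" "V m \<noteq> {}" for m
    using assms modlD(2) unfolding upch_def by auto
  show d: "disc (t = even n) (V (Suc n))"
    by (rule disc_sub[of "V n"]) (use a[of n] in auto)
  have "rel (\<not> (t = even n)) (V (Suc (Suc n)) - V (Suc n)) (V (Suc n))"
    using a(3)[of "Suc n"] rel_sym by auto
  then show "strong (V (Suc n)) B" using strong_alt[OF a(1) d a(1) a(2)] by blast
qed

text \<open>\<open>V 0\<close> need not be strong and is not determined. But \<open>V 1\<close> is
  the least strong module containing \<open>x\<close> and \<open>y\<close>
  (\<open>disc_hull\<close>), and the rest follows with \<open>next_strong\<close>. For this reason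
  the patterns in \<open>Inv\<close> leave out the block \<open>V 1 - V 0\<close>.\<close>

lemma upch_unique:
  assumes "upch B V t" "upch B V' t'" "x \<in> V 0" "y \<in> V 1 - V 0" "x \<in> V' 0" "y \<in> V' 1 - V' 0"
  shows "V (Suc n) = V' (Suc n)"
proof (induction n)
  have a: "modl (V m) B" "V m \<subset> V (Suc m)" "rel (t = even m) (V m) (V (Suc m) - V m)" "V m \<noteq> {}" for m
    using assms(1) modlD(2) unfolding upch_def by auto
  have a': "modl (V' m) B" "V' m \<subset> V' (Suc m)" "rel (t' = even m) (V' m) (V' (Suc m) - V' m)" "V' m \<noteq> {}" for m
    using assms(2) modlD(2) unfolding upch_def by auto
  {
    case 0
    have "V (Suc 0) \<subseteq> V' (Suc 0)"
      by (rule disc_hull[OF upch_strong(1)[OF assms(2)] _ _ a(1) _ assms(3) _ a(3)])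
         (use assms a(2) a'(2) in auto)
    moreover have "V' (Suc 0) \<subseteq> V (Suc 0)"
      by (rule disc_hull[OF upch_strong(1)[OF assms(1)] _ _ a'(1) _ assms(5) _ a'(3)])
         (use assms a(2) a'(2) in auto)
    ultimately show ?case by blast
  next
    case (Suc n)
    have r: "rel (t = even (Suc n)) (V (Suc (Suc n)) - V (Suc n)) (V (Suc n))"
      and r': "rel (t' = even (Suc n)) (V' (Suc (Suc n)) - V' (Suc n)) (V' (Suc n))"
      using a(3)[of "Suc n"] a'(3)[of "Suc n"] rel_sym by blast+
    have "V (Suc (Suc n)) \<subseteq> V' (Suc (Suc n))"
      by (rule next_strong[OF upch_strong(1)[OF assms(2)] a(1) _ _ a(4)[of "Suc n"] r])
         (use Suc a(2)[of "Suc n"] a'(2)[of "Suc n"] in auto)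
    moreover have "V' (Suc (Suc n)) \<subseteq> V (Suc (Suc n))"
      by (rule next_strong[OF upch_strong(1)[OF assms(1)] a'(1) _ _ a'(4)[of "Suc n"] r'])
         (use Suc a(2)[of "Suc n"] a'(2)[of "Suc n"] in auto)
    ultimately show ?case by blast
  }
qed

lemma dnch_strong:
  assumes "dnch B Q t" shows "strong (Q (Suc n)) B" "disc (t = even n) (Q n)"
proof -
  have a: "modl (Q m) B" "Q (Suc m) \<subset> Q m" "rel (t = even m) (Q m - Q (Suc m)) (Q (Suc m))" "Q m \<noteq> {}" for m
    using assms modlD(2) unfolding dnch_def by auto
  have d: "disc (t = even m) (Q m)" for m
    by (rule disc_sub[of "Q (Suc m)"]) (use a[of m] a(4)[of "Suc m"] rel_sym in auto)
  then show "disc (t = even n) (Q n)" .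
  have "disc (t = even (Suc n)) (Q (Suc n))" by (rule d)
  then show "strong (Q (Suc n)) B"
    by (rule strong_alt[OF a(1) _ a(1)[of n] a(2)]) (use a(3)[of n] in auto)
qed

text \<open>Here the homogeneity of the blocks in \<open>dnch\<close> is used. A vertex
  \<open>z\<close> of \<open>Q' n - Q' (Suc n)\<close> has the same value at all other vertices of
  \<open>Q n\<close>; inside \<open>Q (Suc n)\<close> it would split this set in the type of
  \<open>Q n\<close>, whereas \<open>Q (Suc n)\<close> splits in the opposite type.\<close>

lemma dnch_step:
  assumes "dnch B Q t" "dnch B Q' t'" "Q n = Q' n" shows "Q (Suc n) \<subseteq> Q' (Suc n)"
proof
  fix z assume z: "z \<in> Q (Suc n)"
  show "z \<in> Q' (Suc n)"
  proof (rule ccontr)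
    assume nz: "z \<notin> Q' (Suc n)"
    have a: "Q (Suc m) \<subset> Q m" "Q m \<noteq> {}" for m
      using assms(1) modlD(2) unfolding dnch_def by auto
    have a': "rel (t' = even n) (Q' n - Q' (Suc n)) (Q' (Suc n))"
      "\<And>x y. \<lbrakk>x \<in> Q' n - Q' (Suc n); y \<in> Q' n - Q' (Suc n); x \<noteq> y\<rbrakk> \<Longrightarrow> e x y = (t' = even n)"
      using assms(2) unfolding dnch_def by auto
    have tt: "(t = even n) = (t' = even n)"
      using dnch_strong(2)[OF assms(1), of n] dnch_strong(2)[OF assms(2), of n] assms(3) disc_both[of "t = even n" "Q n"]
      by (cases "t = even n"; cases "t' = even n") auto
    have zn: "z \<in> Q' n - Q' (Suc n)" using z nz a assms(3) by blast
    have "e z y = (t = even n)" if "y \<in> Q n" "y \<noteq> z" for y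
    proof (cases "y \<in> Q' (Suc n)")
      case True then show ?thesis using relD[OF a'(1) zn] tt by blast
    next
      case False then show ?thesis using a'(2)[OF zn, of y] that assms(3) tt by blast
    qed
    then have "rel (t = even n) {z} (Q (Suc n) - {z})" using a(1)[of n] unfolding rel_def by blast
    moreover have "Q (Suc n) - {z} \<noteq> {}" using a(1)[of "Suc n"] a(2)[of "Suc (Suc n)"] by blast
    ultimately have "disc (t = even n) (Q (Suc n))" using disc_sub[of "{z}"] z by blast
    moreover have "disc (t = even (Suc n)) (Q (Suc n))" by (rule dnch_strong(2)[OF assms(1)])
    ultimately show False using disc_both[of "t = even n" "Q (Suc n)"] by auto
  qed
qed

text \<open>The first member known to be strong is \<open>V 1\<close>, so the two vertices are taken
  from the two sides of its splitting along \<open>V 2\<close>.\<close>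

lemma dnch_unique:
  assumes "dnch B V t" "dnch B V' t'" "x \<in> V 2" "y \<in> V 1 - V 2" "x \<in> V' 2" "y \<in> V' 1 - V' 2"
  shows "V (Suc n) = V' (Suc n)"
proof (induction n)
  case 0
  have a: "modl (V m) B" "V (Suc m) \<subset> V m" "rel (t = even m) (V m - V (Suc m)) (V (Suc m))" for m
    using assms(1) unfolding dnch_def by auto
  have a': "modl (V' m) B" "V' (Suc m) \<subset> V' m" "rel (t' = even m) (V' m - V' (Suc m)) (V' (Suc m))" for m
    using assms(2) unfolding dnch_def by auto
  have r: "rel (t = even (Suc 0)) (V 2) (V 1 - V 2)" and r': "rel (t' = even (Suc 0)) (V' 2) (V' 1 - V' 2)"
    using a(3)[of 1] a'(3)[of 1] rel_sym by (auto simp: numeral_2_eq_2)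
  have s: "V 2 \<subseteq> V 1" "V' 2 \<subseteq> V' 1" using a(2)[of 1] a'(2)[of 1] by (auto simp: numeral_2_eq_2)
  have "V 1 \<subseteq> V' 1"
    using disc_hull[OF dnch_strong(1)[OF assms(2), of 0] _ _ a(1)[of 1] s(1) assms(3,4) r] assms s by auto
  moreover have "V' 1 \<subseteq> V 1"
    using disc_hull[OF dnch_strong(1)[OF assms(1), of 0] _ _ a'(1)[of 1] s(2) assms(5,6) r'] assms s by auto
  ultimately have "V 1 = V' 1" by blast
  then show ?case by simp
next
  case (Suc n)
  then show ?case using dnch_step[OF assms(1,2), of "Suc n"] dnch_step[OF assms(2,1), of "Suc n"] by blast
qed

lemma Inv_countable:
  assumes "B \<subseteq> U" shows "countable (Inv B)"
proof -
  have cB: "countable B" using assms ctb countable_subset by blast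
  define Pu where "Pu p x y = (\<exists>V t. upch B V t \<and> p = (\<lambda>n. card (V (Suc (Suc n)) - V (Suc n)) = 1) \<and> x \<in> V 0 \<and> y \<in> V 1 - V 0)" for p x y
  define Pd where "Pd p x y = (\<exists>Q t. dnch B Q t \<and> p = (\<lambda>n. card (Q (Suc n) - Q (Suc (Suc n))) = 1) \<and> x \<in> Q 2 \<and> y \<in> Q 1 - Q 2)" for p x y
  have uu: "p = p'" if pp: "Pu p x y" "Pu p' x y" for p p' x y
  proof -
    obtain V t V' t' where "upch B V t" "p = (\<lambda>n. card (V (Suc (Suc n)) - V (Suc n)) = 1)" "x \<in> V 0" "y \<in> V 1 - V 0"
      "upch B V' t'" "p' = (\<lambda>n. card (V' (Suc (Suc n)) - V' (Suc n)) = 1)" "x \<in> V' 0" "y \<in> V' 1 - V' 0"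
      using pp unfolding Pu_def by (elim exE conjE)
    moreover from this have "V (Suc n) = V' (Suc n)" for n by (intro upch_unique)
    ultimately show "p = p'" by simp
  qed
  have ud: "p = p'" if pp: "Pd p x y" "Pd p' x y" for p p' x y
  proof -
    obtain V t V' t' where "dnch B V t" "p = (\<lambda>n. card (V (Suc n) - V (Suc (Suc n))) = 1)" "x \<in> V 2" "y \<in> V 1 - V 2"
      "dnch B V' t'" "p' = (\<lambda>n. card (V' (Suc n) - V' (Suc (Suc n))) = 1)" "x \<in> V' 2" "y \<in> V' 1 - V' 2"
      using pp unfolding Pd_def by (elim exE conjE)
    moreover from this have "V (Suc n) = V' (Suc n)" for n by (intro dnch_unique)
    ultimately show "p = p'" by simp
  qed
  have "Inv B \<subseteq> (\<lambda>(x, y). THE p. Pu p x y) ` (B \<times> B) \<union> (\<lambda>(x, y). THE p. Pd p x y) ` (B \<times> B)"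
  proof
    fix p assume "p \<in> Inv B"
    then consider (u) V t where "upch B V t" "p = (\<lambda>n. card (V (Suc (Suc n)) - V (Suc n)) = 1)"
      | (d) Q t where "dnch B Q t" "p = (\<lambda>n. card (Q (Suc n) - Q (Suc (Suc n))) = 1)"
      unfolding Inv_def by blast
    then show "p \<in> (\<lambda>(x, y). THE p. Pu p x y) ` (B \<times> B) \<union> (\<lambda>(x, y). THE p. Pd p x y) ` (B \<times> B)"
    proof cases
      case u
      have a: "modl (V m) B" "V m \<subset> V (Suc m)" for m using u(1) unfolding upch_def by auto
      obtain x y where xy: "x \<in> V 0" "y \<in> V 1 - V 0" using modlD(2)[OF a(1)[of 0]] a(2)[of 0] by auto
      then have P: "Pu p x y" using u unfolding Pu_def by blast
      then have "(THE p. Pu p x y) = p" using uu by blast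
      moreover have "x \<in> B" "y \<in> B" using xy modlD(1)[OF a(1)] by blast+
      ultimately show ?thesis by force
    next
      case d
      have a: "modl (Q m) B" "Q (Suc m) \<subset> Q m" for m using d(1) unfolding dnch_def by auto
      obtain x y where xy: "x \<in> Q 2" "y \<in> Q 1 - Q 2" using modlD(2)[OF a(1)[of 2]] a(2)[of 1] by (auto simp: numeral_2_eq_2)
      then have P: "Pd p x y" using d unfolding Pd_def by blast
      then have "(THE p. Pd p x y) = p" using ud by blast
      moreover have "x \<in> B" "y \<in> B" using xy modlD(1)[OF a(1)] by blast+
      ultimately show ?thesis by force
    qed
  qed
  moreover have "countable ((\<lambda>(x, y). THE p. Pu p x y) ` (B \<times> B) \<union> (\<lambda>(x, y). THE p. Pd p x y) ` (B \<times> B))"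
    using cB by simp
  ultimately show ?thesis using countable_subset by blast
qed

lemma rel_img:
  assumes "emb f X Y" "rel t A B" "A \<subseteq> X" "B \<subseteq> X" "A \<inter> B = {}" shows "rel t (f ` A) (f ` B)"
  unfolding rel_def
proof (intro ballI)
  fix a b assume "a \<in> f ` A" "b \<in> f ` B"
  then obtain x y where xy: "a = f x" "x \<in> A" "b = f y" "y \<in> B" by blast
  then have "x \<noteq> y" using assms by blast
  then show "e a b = t" using embD(3)[OF assms(1), of x y] relD[OF assms(2)] assms(3,4) xy by blast
qed

lemma Inv_ism:
  assumes "ism B B'" shows "Inv B \<subseteq> Inv B'"
proof
  obtain f where f: "emb f B B'" "f ` B = B'" using assms unfolding ism_def by blast
  note d = embD[OF f(1)]
  have dif: "f ` S - f ` T = f ` (S - T)" if "S \<subseteq> B" "T \<subseteq> B" for S T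
    using inj_on_image_set_diff[OF d(1), of S T] that by blast
  have crd: "card (f ` (S - T)) = card (S - T)" if "S \<subseteq> B" "T \<subseteq> B" for S T
    using card_image[of f "S - T"] inj_on_subset[OF d(1), of "S - T"] that by blast
  have psub: "f ` S \<subset> f ` T" if "S \<subset> T" "T \<subseteq> B" for S T
    using inj_on_image_eq_iff[OF d(1), of S T] that by blast
  fix p assume "p \<in> Inv B"
  then consider (u) V t where "upch B V t" "p = (\<lambda>n. card (V (Suc (Suc n)) - V (Suc n)) = 1)"
    | (d) Q t where "dnch B Q t" "p = (\<lambda>n. card (Q (Suc n) - Q (Suc (Suc n))) = 1)"
    unfolding Inv_def by blast
  then show "p \<in> Inv B'"
  proof cases
    case u
    have a: "modl (V m) B" "V m \<subset> V (Suc m)" "rel (t = even m) (V m) (V (Suc m) - V m)" "V m \<subseteq> B" for m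
      using u(1) modlD(1) unfolding upch_def by auto
    have "upch B' (\<lambda>n. f ` V n) t"
      unfolding upch_def
    proof (intro allI conjI)
      fix n
      show "modl (f ` V n) B'" using modl_img[OF f a(1)] .
      show "f ` V n \<subset> f ` V (Suc n)" by (rule psub[OF a(2) a(4)])
      have "rel (t = even n) (f ` V n) (f ` (V (Suc n) - V n))"
        by (rule rel_img[OF f(1) a(3)]) (use a(4) in auto)
      then show "rel (t = even n) (f ` V n) (f ` V (Suc n) - f ` V n)" by (simp only: dif[OF a(4) a(4)])
    qed
    moreover have "p = (\<lambda>n. card (f ` V (Suc (Suc n)) - f ` V (Suc n)) = 1)"
      by (simp only: u(2) dif[OF a(4) a(4)] crd[OF a(4) a(4)])
    ultimately show ?thesis unfolding Inv_def by blast
  next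
    case d
    have a: "modl (Q m) B" "Q (Suc m) \<subset> Q m" "rel (t = even m) (Q m - Q (Suc m)) (Q (Suc m))" "Q m \<subseteq> B"
      "\<And>x y. \<lbrakk>x \<in> Q m - Q (Suc m); y \<in> Q m - Q (Suc m); x \<noteq> y\<rbrakk> \<Longrightarrow> e x y = (t = even m)" for m
      using d(1) modlD(1) unfolding dnch_def by auto
    have "dnch B' (\<lambda>n. f ` Q n) t"
      unfolding dnch_def
    proof (intro allI conjI ballI impI)
      fix n
      show "modl (f ` Q n) B'" using modl_img[OF f a(1)] .
      show "f ` Q (Suc n) \<subset> f ` Q n" by (rule psub[OF a(2) a(4)])
      have "rel (t = even n) (f ` (Q n - Q (Suc n))) (f ` Q (Suc n))"
        by (rule rel_img[OF f(1) a(3)]) (use a(4) in auto)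
      then show "rel (t = even n) (f ` Q n - f ` Q (Suc n)) (f ` Q (Suc n))" by (simp only: dif[OF a(4) a(4)])
      fix x y assume xy: "x \<in> f ` Q n - f ` Q (Suc n)" "y \<in> f ` Q n - f ` Q (Suc n)" "x \<noteq> y"
      then obtain x' y' where *: "x = f x'" "x' \<in> Q n - Q (Suc n)" "y = f y'" "y' \<in> Q n - Q (Suc n)"
        unfolding dif[OF a(4) a(4)] by blast
      then have "x' \<noteq> y'" "x' \<in> B" "y' \<in> B" using xy a(4) by auto
      then show "e x y = (t = even n)" using a(5)[OF *(2,4)] embD(3)[OF f(1), of x' y'] * by simp
    qed
    moreover have "p = (\<lambda>n. card (f ` Q (Suc n) - f ` Q (Suc (Suc n))) = 1)"
      by (simp only: d(2) dif[OF a(4) a(4)] crd[OF a(4) a(4)])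
    ultimately show ?thesis unfolding Inv_def by blast
  qed
qed

text \<open>Diagonalization: finitely many siblings realize only countably many patterns. Only every
  fourth entry is prescribed, so that other blocks can serve auxiliary purposes.\<close>

lemma not_fin_pattern:
  assumes "X \<subseteq> U" and "\<And>b :: nat \<Rightarrow> bool. \<exists>B\<in>Sib X. \<exists>p\<in>Inv B. \<forall>i. p (4 * i) = b i"
  shows "\<not> fin X"
proof
  assume "fin X"
  then obtain F where F: "finite F" "\<forall>A\<in>Sib X. \<exists>B\<in>F. ism A B" unfolding fin_def by blast
  define F' where "F' = {B\<in>F. \<exists>A\<in>Sib X. ism A B}"
  have "countable (Inv B)" if BF: "B \<in> F'" for B
  proof -
    obtain A where A: "A \<in> Sib X" "ism A B" using BF F'_def by blast
    have "countable (Inv A)" using Inv_countable[of A] A assms(1) unfolding Sib_def by blast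
    moreover have "Inv B \<subseteq> Inv A" using Inv_ism ism_sym A by blast
    ultimately show ?thesis using countable_subset by blast
  qed
  moreover have "finite F'" using F F'_def by simp
  ultimately have c: "countable (\<Union>B\<in>F'. Inv B)" by (simp add: countable_finite)
  \<comment> \<open>The inserted constant pattern makes the set nonempty, so that
    \<open>from_nat_into\<close> enumerates exactly this set.\<close>
  define c where "c n = from_nat_into (insert (\<lambda>_. True) (\<Union>B\<in>F'. Inv B)) n" for n
  define b where "b n = (\<not> c n (4 * n))" for n
  obtain A p where A: "A \<in> Sib X" "p \<in> Inv A" "\<forall>i. p (4 * i) = b i" using assms(2)[of b] by blast
  then obtain B where B: "B \<in> F" "ism A B" using F by blast
  then have "p \<in> (\<Union>B\<in>F'. Inv B)" using Inv_ism A F'_def by blast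
  then obtain n where "p = c n"
    using from_nat_into_surj[of "insert (\<lambda>_. True) (\<Union>B\<in>F'. Inv B)" p] c unfolding c_def by auto
  then show False using A(3) b_def by metis
qed

section \<open>Shifting a strong module\<close>

text \<open>As \<open>T n\<close> is a module containing \<open>q\<close>, the value of
  \<open>y\<close> at \<open>q\<close> alone decides how \<open>y\<close> is related to all of
  \<open>T n\<close>; the type of a block can be read off at \<open>q\<close>.\<close>

lemma up_blocks:
  assumes T: "\<And>n. modl (T n) X" "\<And>n. q \<in> T n" "\<And>n. T n \<subseteq> T (Suc n)"
    and B: "B \<subseteq> X" "q \<in> B" "\<And>n. B \<inter> (T (Suc n) - T n) \<noteq> {}"
      "\<And>n y. y \<in> B \<inter> (T (Suc n) - T n) \<Longrightarrow> e y q = (t = even n)"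
  shows "(\<lambda>n. card (B \<inter> (T (Suc (Suc n)) - T (Suc n))) = 1) \<in> Inv B"
proof -
  have d: "B \<inter> T (Suc n) - B \<inter> T n = B \<inter> (T (Suc n) - T n)" for n by blast
  have "upch B (\<lambda>n. B \<inter> T n) t" unfolding upch_def
  proof (intro allI conjI)
    fix n
    show "modl (B \<inter> T n) B" using modl_restrict[OF T(1)[of n] B(1)] T(2) B(2) by (auto simp: Int_commute)
    show "B \<inter> T n \<subset> B \<inter> T (Suc n)" using T(3)[of n] B(3)[of n] by blast
    show "rel (t = even n) (B \<inter> T n) (B \<inter> T (Suc n) - B \<inter> T n)"
      unfolding rel_def
    proof (intro ballI)
      fix x y assume x: "x \<in> B \<inter> T n" and y: "y \<in> B \<inter> T (Suc n) - B \<inter> T n"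
      have "e y x = e y q" using modlD(3)[OF T(1)[of n], of y x q] x y T(2) B(1) by blast
      then show "e x y = (t = even n)" using B(4)[of y n] y esym[of x y] by blast
    qed
  qed
  then show ?thesis unfolding Inv_def d[symmetric] by blast
qed

lemma dn_blocks:
  assumes T: "\<And>n. modl (T n) X" "\<And>n. q \<in> T n" "\<And>n. T (Suc n) \<subseteq> T n"
    and B: "B \<subseteq> X" "q \<in> B" "\<And>n. B \<inter> (T n - T (Suc n)) \<noteq> {}"
      "\<And>n y. y \<in> B \<inter> (T n - T (Suc n)) \<Longrightarrow> e y q = (t = even n)"
      "\<And>n x y. \<lbrakk>x \<in> B \<inter> (T n - T (Suc n)); y \<in> B \<inter> (T n - T (Suc n)); x \<noteq> y\<rbrakk> \<Longrightarrow> e x y = (t = even n)"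
  shows "(\<lambda>n. card (B \<inter> (T (Suc n) - T (Suc (Suc n)))) = 1) \<in> Inv B"
proof -
  have d: "B \<inter> T n - B \<inter> T (Suc n) = B \<inter> (T n - T (Suc n))" for n by blast
  have "dnch B (\<lambda>n. B \<inter> T n) t" unfolding dnch_def d
  proof (intro allI conjI ballI impI)
    fix n
    show "modl (B \<inter> T n) B" using modl_restrict[OF T(1)[of n] B(1)] T(2) B(2) by (auto simp: Int_commute)
    show "B \<inter> T (Suc n) \<subset> B \<inter> T n" using T(3)[of n] B(3)[of n] by blast
    show "rel (t = even n) (B \<inter> (T n - T (Suc n))) (B \<inter> T (Suc n))"
      unfolding rel_def
    proof (intro ballI)
      fix x y assume x: "x \<in> B \<inter> T (Suc n)" and y: "y \<in> B \<inter> (T n - T (Suc n))"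
      have "e y x = e y q" using modlD(3)[OF T(1)[of "Suc n"], of y x q] x y T(2) B(1) by blast
      then show "e y x = (t = even n)" using B(4)[of y n] y by blast
    qed
  qed (use B(5) in blast)
  then show ?thesis unfolding Inv_def d[symmetric] by blast
qed

section \<open>Hulls around a module fixed pointwise by a self-embedding\<close>

context
  fixes X Q M :: "'a set" and g :: "'a \<Rightarrow> 'a" and q0 :: 'a
  assumes XU: "X \<subseteq> U" and Ms: "strong M X" and Qm: "modl Q X" and QM: "Q \<subset> M" and q0: "q0 \<in> Q"
    and g: "emb g X X" and gQ: "\<And>q. q \<in> Q \<Longrightarrow> g q = q" and gM: "\<And>v. \<lbrakk>v \<in> X; v \<notin> Q\<rbrakk> \<Longrightarrow> g v \<notin> M"
begin

text \<open>All \<open>h v\<close> contain \<open>q0\<close> and hence form a chain. For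
  \<open>v\<close> outside \<open>Q\<close>, \<open>ty v\<close> is also the type in which
  \<open>h v\<close> splits (\<open>h_disc\<close>), and \<open>g\<close> preserves it because
  \<open>g\<close> fixes \<open>q0\<close>.\<close>

private abbreviation (input) "h v \<equiv> hull X q0 v"
private abbreviation (input) "ty v \<equiv> e v q0"

lemma q0X: "q0 \<in> X" using q0 modlD(1)[OF Qm] by blast

lemma h_str: "v \<in> X \<Longrightarrow> strong (h v) X" using hull_strong q0X by blast

lemma h_sub: "v \<in> X \<Longrightarrow> h v \<subseteq> X" using strongD(2)[OF h_str] .

lemma Qh: "\<lbrakk>v \<in> X; v \<notin> Q\<rbrakk> \<Longrightarrow> Q \<subseteq> h v"
  using strong_cmp[OF h_str Qm, of v q0] hull_in[where X = X and x = q0 and y = v] q0 by blast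

lemma h_in: "\<lbrakk>v \<in> X; w \<in> h v\<rbrakk> \<Longrightarrow> h w \<subseteq> h v"
  using hull_least[OF h_str] hull_in(1)[of q0 X v] by blast

lemma h_cmp: "\<lbrakk>v \<in> X; w \<in> X\<rbrakk> \<Longrightarrow> h v \<subseteq> h w \<or> h w \<subseteq> h v"
  using strong_cmp[OF h_str strongD(1)[OF h_str], of v w q0] hull_in(1) by blast

lemma h_out: "\<lbrakk>v \<in> X; w \<in> X; w \<notin> h v\<rbrakk> \<Longrightarrow> e w v = ty w"
  using strongD(4)[OF h_str, of v w v q0] hull_in by blast

lemma h_notin: "\<lbrakk>v \<in> X; w \<in> X\<rbrakk> \<Longrightarrow> (w \<notin> h v) = (h v \<subset> h w)"
  using h_cmp[of v w] h_in[of v w] hull_in(2)[of w X q0] by blast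

lemma h_disc: assumes "v \<in> X" "v \<notin> Q" shows "disc (ty v) (h v)"
  using node(2)[OF XU q0X assms(1)] q0 assms(2) esym[of q0 v] by auto

lemma h_ty: assumes "v \<in> X" "v \<notin> Q" "w \<in> X" "w \<notin> Q" "h v = h w" shows "ty v = ty w"
  using h_disc[OF assms(1,2)] h_disc[OF assms(3,4)] assms(5) disc_both[of "ty v" "h v"]
  by (cases "ty v"; cases "ty w") auto

text \<open>The component \<open>Y\<close> of \<open>q0\<close> in \<open>h w\<close> is a strong
  module strictly between the two hulls. By \<open>strong_other_type\<close> it contains a vertex
  \<open>u\<close> related to \<open>h v\<close> by the opposite type.\<close>

lemma h_between:
  assumes "v \<in> X" "v \<notin> Q" "w \<in> X" "w \<notin> Q" "h v \<subset> h w" "ty v = ty w"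
  obtains u where "u \<in> X" "u \<notin> Q" "ty u = (\<not> ty v)" "h v \<subset> h u" "h u \<subset> h w"
proof -
  define t where "t = ty v"
  define Y where "Y = cpt t (h w) q0"
  have dw: "disc t (h w)" using h_disc[OF assms(3,4)] assms(6) t_def by simp
  have dv: "disc t (h v)" using h_disc[OF assms(1,2)] t_def by simp
  have Ys: "strong Y X" unfolding Y_def
    by (rule strong_cpt[OF strongD(1)[OF h_str[OF assms(3)]] dw hull_in(1)])
  have qY: "q0 \<in> Y" "Y \<subseteq> h w" unfolding Y_def by (rule cpt_self[OF hull_in(1)], rule cpt_sub[OF hull_in(1)])
  have Yne: "Y \<noteq> h w" unfolding Y_def using cpt_proper[OF dw hull_in(1)] .
  have ndY: "\<not> disc t Y" unfolding Y_def using cpt_ndisc[OF hull_in(1)] .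
  have relY: "rel t Y (h w - Y)" unfolding Y_def by (rule cpt_rel)
  have "h v \<subseteq> Y"
  proof (rule ccontr)
    assume n: "\<not> h v \<subseteq> Y"
    then have Yv: "Y \<subset> h v" using strong_cmp[OF Ys strongD(1)[OF h_str[OF assms(1)]], of q0] qY hull_in(1)[of q0 X v] by blast
    have "h w \<subseteq> h v"
    proof (rule next_strong[OF h_str[OF assms(1)] strongD(1)[OF h_str[OF assms(3)]] Yv qY(2)])
      show "Y \<noteq> {}" using qY by blast
      show "rel t (h w - Y) Y" using relY rel_sym by blast
    qed
    then show False using assms(5) by blast
  qed
  then have vY: "h v \<subset> Y" using ndY dv by blast
  obtain u where u: "u \<in> Y" "u \<notin> h v" "rel (\<not> t) {u} (h v)"
    using strong_other_type[OF h_str[OF assms(1)] dv strongD(1)[OF Ys] vY] by blast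
  have uX: "u \<in> X" using u strongD(2)[OF Ys] by blast
  have "ty u = (\<not> t)" using relD[OF u(3)] hull_in(1)[of q0 X v] by blast
  moreover have "h v \<subset> h u" using h_notin[OF assms(1) uX] u by blast
  moreover have "h u \<subset> h w" using hull_least[OF Ys qY(1) u(1)] qY Yne by blast
  moreover have "u \<notin> Q" using Qh[OF assms(1,2)] u by blast
  ultimately show ?thesis using that[of u] uX t_def by blast
qed

text \<open>Types need not alternate on a given chain, but if both inner vertices have the wrong
  type, \<open>h_between\<close> supplies the right one between them; hence four hulls.\<close>

lemma h_sel:
  assumes "\<And>i. i < 4 \<Longrightarrow> v i \<in> X \<and> v i \<notin> Q" "h (v 0) \<subset> h (v 1)" "h (v 1) \<subset> h (v 2)" "h (v 2) \<subset> h (v 3)"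
  obtains z where "z \<in> X" "z \<notin> Q" "ty z = t" "h (v 0) \<subset> h z" "h z \<subset> h (v (3::nat))"
proof -
  have a: "v 0 \<in> X" "v 0 \<notin> Q" "v 1 \<in> X" "v 1 \<notin> Q" "v 2 \<in> X" "v 2 \<notin> Q" "v 3 \<in> X" "v 3 \<notin> Q"
    using assms(1) by auto
  consider "ty (v 1) = t" | "ty (v 2) = t" | "ty (v 1) = (\<not> t)" "ty (v 2) = (\<not> t)" by blast
  then show ?thesis
  proof cases
    case 1 then show ?thesis using that[of "v 1"] a assms by blast
  next
    case 2 then show ?thesis using that[of "v 2"] a assms by blast
  next
    case 3
    then obtain u where "u \<in> X" "u \<notin> Q" "ty u = (\<not> ty (v 1))" "h (v 1) \<subset> h u" "h u \<subset> h (v 2)"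
      using h_between[OF a(3,4,5,6) assms(3)] by blast
    then show ?thesis using that[of u] assms 3 by blast
  qed
qed

lemma g_X: "v \<in> X \<Longrightarrow> g v \<in> X" using embD(2)[OF g] .

lemma g_nQ: "\<lbrakk>v \<in> X; v \<notin> Q\<rbrakk> \<Longrightarrow> g v \<notin> Q" using gM QM by blast

lemma g_ty: "\<lbrakk>v \<in> X; v \<notin> Q\<rbrakk> \<Longrightarrow> ty (g v) = ty v"
  using embD(3)[OF g, of v q0] q0 q0X gQ[OF q0] by metis

text \<open>The value of a pair is the type of the vertex with the larger hull. For vertices of
  opposite type it therefore reveals the order of the hulls, and \<open>g\<close> preserves values
  and types.\<close>

lemma h_mono1:
  assumes "v \<in> X" "v \<notin> Q" "w \<in> X" "w \<notin> Q" "h v \<subset> h w" "ty v \<noteq> ty w" shows "h (g v) \<subset> h (g w)"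
proof -
  have gv: "g v \<in> X" "g v \<notin> Q" "g w \<in> X" "g w \<notin> Q" using g_X g_nQ assms by auto
  have "w \<notin> h v" using assms h_notin by blast
  then have "e w v = ty w" using h_out assms by blast
  then have 1: "e (g v) (g w) = ty w" using embD(3)[OF g, of w v] assms esym[of "g v" "g w"] by auto
  have "g v \<in> h (g w)"
  proof (rule ccontr)
    assume "g v \<notin> h (g w)"
    then have "e (g v) (g w) = ty (g v)" using h_out gv by blast
    then show False using 1 g_ty assms by auto
  qed
  then have "h (g v) \<subseteq> h (g w)" using h_in gv by blast
  moreover have "h (g v) \<noteq> h (g w)" using h_ty[OF gv(1,2,3,4)] g_ty assms by auto
  ultimately show ?thesis by blast
qed

lemma h_mono:
  assumes "v \<in> X" "v \<notin> Q" "w \<in> X" "w \<notin> Q" "h v \<subset> h w" shows "h (g v) \<subset> h (g w)"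
proof (cases "ty v = ty w")
  case True
  then obtain u where u: "u \<in> X" "u \<notin> Q" "ty u = (\<not> ty v)" "h v \<subset> h u" "h u \<subset> h w"
    using h_between[OF assms] by blast
  have "h (g v) \<subset> h (g u)" "h (g u) \<subset> h (g w)"
    using h_mono1[OF assms(1,2) u(1,2,4)] h_mono1[OF u(1,2) assms(3,4) u(5)] u(3) True by auto
  then show ?thesis by blast
next
  case False then show ?thesis using h_mono1 assms by blast
qed

text \<open>The region around \<open>Q\<close> that the \<open>n\<close>-th iterate of
  \<open>g\<close> vacates: its image meets \<open>NN n\<close> in \<open>Q\<close> only
  (\<open>gpow_img_N\<close>). The regions increase with \<open>n\<close>, and \<open>g\<close>
  moves \<open>NN n - Q\<close> into the next one.\<close>

private definition NN :: "nat \<Rightarrow> 'a set" where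
  "NN n = {v\<in>X. v \<in> Q \<or> h v \<inter> (g ^^ n) ` (X - Q) = {}}"

lemma gpow: "v \<in> X \<Longrightarrow> v \<notin> Q \<Longrightarrow> (g ^^ n) v \<in> X \<and> (g ^^ n) v \<notin> Q \<and> ty ((g ^^ n) v) = ty v"
  by (induction n) (auto simp: g_X g_nQ g_ty)

lemma gpowQ: "v \<in> Q \<Longrightarrow> (g ^^ n) v = v"
  by (induction n) (auto simp: gQ)

lemma QN: "Q \<subseteq> NN n" using modlD(1)[OF Qm] by (auto simp: NN_def)

lemma NX: "NN n \<subseteq> X" by (auto simp: NN_def)

lemma hN: "\<lbrakk>v \<in> NN n; v \<notin> Q\<rbrakk> \<Longrightarrow> h v \<subseteq> NN n"
proof
  fix w assume v: "v \<in> NN n" "v \<notin> Q" and w: "w \<in> h v"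
  have "v \<in> X" "h v \<inter> (g ^^ n) ` (X - Q) = {}" using v by (auto simp: NN_def)
  then show "w \<in> NN n" using w h_in[of v w] h_sub[of v] unfolding NN_def by blast
qed

lemma NN_modl: "modl (NN n) X"
proof (rule modlI)
  show "NN n \<noteq> {}" using QN q0 by blast
  fix z a b assume z: "z \<in> X" "z \<notin> NN n" and ab: "a \<in> NN n" "b \<in> NN n"
  have "e z c = ty z" if "c \<in> NN n" for c
  proof (cases "c \<in> Q")
    case True
    then show ?thesis using modlD(3)[OF Qm z(1), of c q0] z q0 QN by blast
  next
    case False
    then show ?thesis using hN[OF that False] h_out[of c z] z that NX by blast
  qed
  then show "e z a = e z b" using ab by blast
qed (rule NX)

lemma NN_mono: "NN n \<subseteq> NN (Suc n)"
proof -
  have "(g ^^ Suc n) ` (X - Q) \<subseteq> (g ^^ n) ` (X - Q)"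
  proof
    fix z assume "z \<in> (g ^^ Suc n) ` (X - Q)"
    then obtain v where v: "v \<in> X - Q" "z = (g ^^ Suc n) v" by blast
    then have "z = (g ^^ n) (g v)" by (simp add: funpow_swap1)
    then show "z \<in> (g ^^ n) ` (X - Q)" using v g_X g_nQ by blast
  qed
  then show ?thesis unfolding NN_def by blast
qed

lemma NN_le: "m \<le> n \<Longrightarrow> NN m \<subseteq> NN n"
  using NN_mono by (rule lift_Suc_mono_le)

lemma gN: assumes "v \<in> NN n" "v \<notin> Q" shows "g v \<in> NN (Suc n)"
proof -
  have v: "v \<in> X" "h v \<inter> (g ^^ n) ` (X - Q) = {}" using assms by (auto simp: NN_def)
  have "h (g v) \<inter> (g ^^ Suc n) ` (X - Q) = {}"
  proof (rule ccontr)
    assume "\<not> ?thesis"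
    then obtain y where y: "y \<in> X" "y \<notin> Q" "(g ^^ Suc n) y \<in> h (g v)" by blast
    let ?w = "(g ^^ n) y"
    have w: "?w \<in> X" "?w \<notin> Q" using gpow y by auto
    have "?w \<notin> h v" using v y by blast
    then have "h v \<subset> h ?w" using h_notin v w by blast
    then have "h (g v) \<subset> h (g ?w)" using h_mono[OF v(1) assms(2) w] by blast
    then show False using y(3) h_notin[OF g_X g_X, OF v(1) w(1)] by simp
  qed
  then show ?thesis using g_X[OF v(1)] by (auto simp: NN_def)
qed

lemma gpowN: "\<lbrakk>v \<in> NN m; v \<notin> Q\<rbrakk> \<Longrightarrow> (g ^^ n) v \<in> NN (m + n)"
proof (induction n)
  case (Suc n)
  have "(g ^^ n) v \<notin> Q" using gpow[of v n] Suc NX by blast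
  then show ?case using gN[of "(g ^^ n) v" "m + n"] Suc by simp
qed simp

lemma gpow_out: "\<lbrakk>v \<in> X; v \<notin> Q\<rbrakk> \<Longrightarrow> (g ^^ n) v \<notin> NN n"
  using gpow[of v n] hull_in(2)[of "(g ^^ n) v" X q0] unfolding NN_def by blast

text \<open>Any \<open>r\<close> in \<open>M - Q\<close> lies in \<open>NN 1\<close>, and a vertex
  of the other type is found between \<open>h r\<close> and \<open>h (g r)\<close>, hence in
  \<open>NN 2\<close>. The iterates of \<open>g\<close> carry both of them outwards.\<close>

lemma filler: obtains z where "z \<in> X" "z \<notin> Q" "ty z = t" "z \<in> NN (n + 2)" "z \<notin> NN n"
proof -
  obtain r where r: "r \<in> M" "r \<notin> Q" using QM by blast
  have rX: "r \<in> X" using r strongD(2)[OF Ms] by blast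
  have hr: "h r \<subseteq> M" using hull_least[OF Ms] QM q0 r by blast
  have "h r \<inter> g ` (X - Q) = {}" using hr gM by blast
  then have r1: "r \<in> NN 1" using rX by (simp add: NN_def)
  then have gr2: "g r \<in> NN 2" using gN[of r 1] r by (simp add: numeral_2_eq_2)
  have "g r \<notin> h r" using hr gM[OF rX r(2)] by blast
  then have "h r \<subset> h (g r)" using h_notin rX g_X by blast
  then obtain u where u: "u \<in> X" "u \<notin> Q" "ty u = (\<not> ty r)" "h u \<subset> h (g r)"
    using h_between[OF rX r(2) g_X[OF rX] g_nQ[OF rX r(2)]] g_ty[OF rX r(2)] by metis
  have "u \<in> h (g r)" using u(4) hull_in(2)[of u X q0] by blast
  then have u2: "u \<in> NN 2" using hN[OF gr2 g_nQ[OF rX r(2)]] by blast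
  have r2: "r \<in> NN 2" using r1 NN_le[of 1 2] by auto
  define c where "c = (if ty r = t then r else u)"
  have c: "c \<in> X" "c \<notin> Q" "ty c = t" "c \<in> NN 2" using r2 u2 u rX r by (auto simp: c_def)
  show ?thesis using that[of "(g ^^ n) c"] gpow[OF c(1,2), of n] gpowN[OF c(4,2), of n] gpow_out[OF c(1,2), of n] c(3)
    by (simp add: add.commute)
qed

lemma gpow_img_Sib: assumes "C \<subseteq> NN n" shows "(g ^^ n) ` X \<union> C \<in> Sib X"
proof (rule SibI)
  show "(g ^^ n) ` X \<union> C \<subseteq> X" using embD(2)[OF emb_funpow[OF g, of n]] assms NX by blast
  show "emb (g ^^ n) X ((g ^^ n) ` X \<union> C)"
    using emb_mono[OF emb_image[OF emb_funpow[OF g, of n]], of X X] by auto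
qed

lemma gpow_img_N: "(g ^^ n) ` X \<inter> NN n = Q"
  using gpow_out[of _ n] gpowQ[of _ n] QN[of n] modlD(1)[OF Qm] by force

text \<open>One region \<open>NN n\<close> already contains an infinite chain of hulls, and the
  image of the \<open>n\<close>-th iterate leaves it free outside \<open>Q\<close>. Vertices of this
  chain can be added to the image at will, and every result is a sibling.\<close>

lemma shift_infinite:
  assumes inf: "infinite {h v |v. v \<in> NN n \<and> v \<notin> Q}"
  shows "\<not> fin X"
proof (rule not_fin_pattern[OF XU])
  fix b :: "nat \<Rightarrow> bool"
  let ?L = "{h v |v. v \<in> NN n \<and> v \<notin> Q}"
  have cmp: "A \<subseteq> B \<or> B \<subseteq> A" if "A \<in> ?L" "B \<in> ?L" for A B using that h_cmp NX by auto
  obtain s :: "nat \<Rightarrow> 'a set" where s: "\<And>i. s i \<in> ?L" and s2: "(\<forall>i j. i < j \<longrightarrow> s i \<subset> s j) \<or> (\<forall>i j. i < j \<longrightarrow> s j \<subset> s i)"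
    using infinite_chain_seq[OF inf cmp] by blast
  have "\<forall>i. \<exists>v. s i = h v \<and> v \<in> NN n \<and> v \<notin> Q" using s by blast
  then obtain v where v: "\<And>i. s i = h (v i)" "\<And>i. v i \<in> NN n" "\<And>i. v i \<notin> Q" by metis
  have vX: "v i \<in> X" for i using v NX by blast
  have hvN: "h (v i) \<subseteq> NN n" for i using hN v by blast
  have Qhv: "Q \<subseteq> h (v i)" for i using Qh vX v by blast
  \<comment> \<open>A block gets a second vertex iff its bit is \<open>False\<close>. Since
    \<open>Inv\<close> leaves out block 0, entry \<open>4 * i\<close> of the pattern is about block
    \<open>4 * i + 1\<close>, which is why the bit has index \<open>s div 4\<close>.\<close>
  define dbl where "dbl s = (\<not> b (s div 4))" for s :: nat
  show "\<exists>B\<in>Sib X. \<exists>p\<in>Inv B. \<forall>i. p (4 * i) = b i"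
    using s2
  proof
    assume up: "\<forall>i j. i < j \<longrightarrow> s i \<subset> s j"
    have up': "h (v i) \<subset> h (v j)" if "i < j" for i j using up v(1) that by metis
    have zex: "\<exists>z. z \<in> X \<and> z \<notin> Q \<and> ty z = t \<and> h (v (3 * i)) \<subset> h z \<and> h z \<subset> h (v (3 * i + 3))" for i t
      using h_sel[of "\<lambda>k. v (3 * i + k)" t] vX v(3) up'[of "3 * i" "3 * i + 1"] up'[of "3 * i + 1" "3 * i + 2"] up'[of "3 * i + 2" "3 * i + 3"]
      by auto
    define z where "z i t = (SOME z. z \<in> X \<and> z \<notin> Q \<and> ty z = t \<and> h (v (3 * i)) \<subset> h z \<and> h z \<subset> h (v (3 * i + 3)))" for i t
    have z: "z i t \<in> X" "z i t \<notin> Q" "ty (z i t) = t" "h (v (3 * i)) \<subset> h (z i t)" "h (z i t) \<subset> h (v (3 * i + 3))" for i t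
      using someI_ex[OF zex[of t i]] unfolding z_def by auto
    have zin: "z i t \<in> h (v (3 * i + 3))" "z i t \<notin> h (v (3 * i))" for i t
      using z(5)[of i t] hull_in(2)[of "z i t" X q0] h_notin[OF vX[of "3 * i"] z(1)[of i t]] z(4)[of i t] by blast+
    \<comment> \<open>A vertex of a given type needs three steps of the chain
      (\<open>h_sel\<close>), a block of two vertices needs six.\<close>
    define T where "T s = h (v (6 * s))" for s
    define C where "C s = {z (2 * s) (even s)} \<union> (if dbl s then {z (2 * s + 1) (even s)} else {})" for s
    define B where "B = (g ^^ n) ` X \<union> (\<Union>s. C s)"
    have hle: "h (v i) \<subseteq> h (v j)" if "i \<le> j" for i j using up'[of i j] that by (cases "i = j") auto
    have Cin: "C s \<subseteq> T (Suc s) - T s" for s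
    proof -
      have "z (2 * s) t \<in> T (Suc s) - T s" for t
        using zin[of "2 * s" t] hle[of "6 * s + 3" "6 * Suc s"] unfolding T_def by (auto simp: algebra_simps)
      moreover have "z (2 * s + 1) t \<in> T (Suc s) - T s" for t
        using zin[of "2 * s + 1" t] hle[of "6 * s" "6 * s + 3"] unfolding T_def by (auto simp: algebra_simps)
      ultimately show ?thesis unfolding C_def by auto
    qed
    have Tmono: "T i \<subseteq> T j" if "i \<le> j" for i j unfolding T_def using hle that by simp
    have TN: "T s \<subseteq> NN n" for s unfolding T_def by (rule hvN)
    have BT: "B \<inter> (T (Suc s) - T s) = C s" for s
    proof
      show "C s \<subseteq> B \<inter> (T (Suc s) - T s)" using Cin B_def by blast
      have "False" if "y \<in> C s'" "s' \<noteq> s" "y \<in> T (Suc s)" "y \<notin> T s" for y s'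
        using Cin[of s'] that Tmono[of "Suc s'" s] Tmono[of "Suc s" s'] by (cases "s' < s") auto
      moreover have "(g ^^ n) ` X \<inter> T (Suc s) \<subseteq> T s"
        using gpow_img_N[of n] TN[of "Suc s"] Qhv[of "6 * s"] unfolding T_def by blast
      ultimately show "B \<inter> (T (Suc s) - T s) \<subseteq> C s" unfolding B_def by blast
    qed
    have "B \<in> Sib X" unfolding B_def by (rule gpow_img_Sib) (use Cin TN in blast)
    then have BX: "B \<subseteq> X" by (simp add: Sib_def)
    have pI: "(\<lambda>n. card (B \<inter> (T (Suc (Suc n)) - T (Suc n))) = 1) \<in> Inv B"
    proof (rule up_blocks[where t = True and X = X and q = q0])
      show "modl (T i) X" for i unfolding T_def using strongD(1)[OF h_str[OF vX]] .
      show "q0 \<in> T i" for i unfolding T_def by (rule hull_in)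
      show "T i \<subseteq> T (Suc i)" for i using Tmono by simp
      show "q0 \<in> B" unfolding B_def using gpowQ[OF q0, of n] q0X by (metis UnI1 image_eqI)
      show "B \<inter> (T (Suc i) - T i) \<noteq> {}" for i unfolding BT C_def by simp
      show "ty y = (True = even i)" if "y \<in> B \<inter> (T (Suc i) - T i)" for i y
        using that z(3) unfolding BT C_def by (auto split: if_splits)
    qed (rule BX)
    have cI: "(card (B \<inter> (T (Suc (Suc (4 * i))) - T (Suc (4 * i)))) = 1) = b i" for i
    proof -
      let ?s = "Suc (4 * i)"
      have "z (2 * ?s) (even ?s) \<noteq> z (2 * ?s + 1) (even ?s)"
        using zin[of "2 * ?s" "even ?s"] zin[of "2 * ?s + 1" "even ?s"] by (auto simp: algebra_simps)
      moreover have "Suc (4 * i) div 4 = i" by simp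
      ultimately show ?thesis unfolding BT C_def dbl_def by (auto simp: card_insert_if)
    qed
    show ?thesis by (rule bexI[OF _ \<open>B \<in> Sib X\<close>], rule bexI[OF _ pI], rule allI, rule cI)
  next
    assume dn: "\<forall>i j. i < j \<longrightarrow> s j \<subset> s i"
    have dn': "h (v j) \<subset> h (v i)" if "i < j" for i j using dn v(1) that by metis
    have zex: "\<exists>z. z \<in> X \<and> z \<notin> Q \<and> ty z = t \<and> h (v (3 * i + 3)) \<subset> h z \<and> h z \<subset> h (v (3 * i))" for i t
      using h_sel[of "\<lambda>k. v (3 * i + 3 - k)" t] vX v(3) dn'[of "3 * i" "3 * i + 1"] dn'[of "3 * i + 1" "3 * i + 2"] dn'[of "3 * i + 2" "3 * i + 3"]
      by auto
    define z where "z i t = (SOME z. z \<in> X \<and> z \<notin> Q \<and> ty z = t \<and> h (v (3 * i + 3)) \<subset> h z \<and> h z \<subset> h (v (3 * i)))" for i t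
    have z: "z i t \<in> X" "z i t \<notin> Q" "ty (z i t) = t" "h (v (3 * i + 3)) \<subset> h (z i t)" "h (z i t) \<subset> h (v (3 * i))" for i t
      using someI_ex[OF zex[of t i]] unfolding z_def by auto
    have zin: "z i t \<in> h (v (3 * i))" "z i t \<notin> h (v (3 * i + 3))" for i t
      using z(5)[of i t] hull_in(2)[of "z i t" X q0] h_notin[OF vX[of "3 * i + 3"] z(1)[of i t]] z(4)[of i t] by blast+
    define T where "T s = h (v (6 * s))" for s
    define C where "C s = {z (2 * s) (even s)} \<union> (if dbl s then {z (2 * s + 1) (even s)} else {})" for s
    define B where "B = (g ^^ n) ` X \<union> (\<Union>s. C s)"
    have hle: "h (v j) \<subseteq> h (v i)" if "i \<le> j" for i j using dn'[of i j] that by (cases "i = j") auto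
    have Cin: "C s \<subseteq> T s - T (Suc s)" for s
    proof -
      have "z (2 * s) t \<in> T s - T (Suc s)" for t
        using zin[of "2 * s" t] hle[of "6 * s + 3" "6 * Suc s"] unfolding T_def by (auto simp: algebra_simps)
      moreover have "z (2 * s + 1) t \<in> T s - T (Suc s)" for t
        using zin[of "2 * s + 1" t] hle[of "6 * s" "6 * s + 3"] unfolding T_def by (auto simp: algebra_simps)
      ultimately show ?thesis unfolding C_def by auto
    qed
    have Tmono: "T j \<subseteq> T i" if "i \<le> j" for i j unfolding T_def using hle that by simp
    have TN: "T s \<subseteq> NN n" for s unfolding T_def by (rule hvN)
    have BT: "B \<inter> (T s - T (Suc s)) = C s" for s
    proof
      show "C s \<subseteq> B \<inter> (T s - T (Suc s))" using Cin B_def by blast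
      have "False" if "y \<in> C s'" "s' \<noteq> s" "y \<in> T s" "y \<notin> T (Suc s)" for y s'
        using Cin[of s'] that Tmono[of "Suc s'" s] Tmono[of "Suc s" s'] by (cases "s' < s") auto
      moreover have "(g ^^ n) ` X \<inter> T s \<subseteq> T (Suc s)"
        using gpow_img_N[of n] TN[of s] Qhv[of "6 * Suc s"] unfolding T_def by blast
      ultimately show "B \<inter> (T s - T (Suc s)) \<subseteq> C s" unfolding B_def by blast
    qed
    \<comment> \<open>Blocks of a decreasing chain have to be homogeneous; within a block, the
      vertex with the larger hull decides the value.\<close>
    have zz: "e (z (2 * s) t) (z (2 * s + 1) t) = t" for s t
    proof -
      have "h (z (2 * s + 1) t) \<subset> h (v (6 * s + 3))" "h (v (6 * s + 3)) \<subset> h (z (2 * s) t)"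
        using z(5)[of "2 * s + 1" t] z(4)[of "2 * s" t] by (auto simp: algebra_simps)
      then have "z (2 * s) t \<notin> h (z (2 * s + 1) t)" using h_notin z(1) by blast
      then show ?thesis using h_out z(1,3) by metis
    qed
    have "B \<in> Sib X" unfolding B_def by (rule gpow_img_Sib) (use Cin TN in blast)
    then have BX: "B \<subseteq> X" by (simp add: Sib_def)
    have pI: "(\<lambda>n. card (B \<inter> (T (Suc n) - T (Suc (Suc n)))) = 1) \<in> Inv B"
    proof (rule dn_blocks[where t = True and X = X and q = q0])
      show "modl (T i) X" for i unfolding T_def using strongD(1)[OF h_str[OF vX]] .
      show "q0 \<in> T i" for i unfolding T_def by (rule hull_in)
      show "T (Suc i) \<subseteq> T i" for i using Tmono by simp
      show "q0 \<in> B" unfolding B_def using gpowQ[OF q0, of n] q0X by (metis UnI1 image_eqI)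
      show "B \<inter> (T i - T (Suc i)) \<noteq> {}" for i unfolding BT C_def by simp
      show "ty y = (True = even i)" if "y \<in> B \<inter> (T i - T (Suc i))" for i y
        using that z(3) unfolding BT C_def by (auto split: if_splits)
      show "e x y = (True = even i)" if "x \<in> B \<inter> (T i - T (Suc i))" "y \<in> B \<inter> (T i - T (Suc i))" "x \<noteq> y" for i x y
        using that zz[of i "even i"] esym unfolding BT C_def by (auto split: if_splits)
    qed (rule BX)
    have cI: "(card (B \<inter> (T (Suc (4 * i)) - T (Suc (Suc (4 * i))))) = 1) = b i" for i
    proof -
      let ?s = "Suc (4 * i)"
      have "z (2 * ?s) (even ?s) \<noteq> z (2 * ?s + 1) (even ?s)"
        using zin[of "2 * ?s" "even ?s"] zin[of "2 * ?s + 1" "even ?s"] by (auto simp: algebra_simps)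
      moreover have "Suc (4 * i) div 4 = i" by simp
      ultimately show ?thesis unfolding BT C_def dbl_def by (auto simp: card_insert_if)
    qed
    show ?thesis by (rule bexI[OF _ \<open>B \<in> Sib X\<close>], rule bexI[OF _ pI], rule allI, rule cI)
  qed
qed

text \<open>Every hull in the vacated part \<open>V\<close> has a finite height \<open>ix\<close>,
  which divides \<open>V - Q\<close> into layers \<open>R i\<close>. No infinite chain is given in
  advance: the layers are moved outwards by different iterates of \<open>g\<close>, and the gaps
  between them are filled with blocks of prescribed sizes.\<close>

lemma shift_finite:
  assumes fn: "\<And>n. finite {h v |v. v \<in> NN n \<and> v \<notin> Q}"
  shows "\<not> fin X"
proof (rule not_fin_pattern[OF XU])
  fix b :: "nat \<Rightarrow> bool"
  define V where "V = (\<Union>n. NN n)"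
  define L where "L = {h v |v. v \<in> V \<and> v \<notin> Q}"
  define ix where "ix v = card {l\<in>L. l \<subset> h v}" for v
  define R where "R i = {v\<in>V. v \<notin> Q \<and> ix v = i}" for i
  have VX: "V \<subseteq> X" "Q \<subseteq> V" using NX QN[of 0] by (auto simp: V_def)
  have below: "{l\<in>L. l \<subset> h v} \<subseteq> {h v |v. v \<in> NN n \<and> v \<notin> Q}" if "v \<in> NN n" "v \<notin> Q" for v n
  proof
    fix l assume "l \<in> {l\<in>L. l \<subset> h v}"
    then obtain w where w: "l = h w" "w \<notin> Q" "h w \<subset> h v" by (auto simp: L_def)
    have "w \<in> h w" by (rule hull_in)
    then have "w \<in> NN n" using hN[OF that] w(3) by blast
    then show "l \<in> {h v |v. v \<in> NN n \<and> v \<notin> Q}" using w by blast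
  qed
  have fb: "finite {l\<in>L. l \<subset> h v}" if vV: "v \<in> V" "v \<notin> Q" for v
  proof -
    obtain n where "v \<in> NN n" using vV V_def by blast
    then show ?thesis using finite_subset[OF below fn] vV(2) by blast
  qed
  have ixlt: "ix v < ix w" if "v \<in> V" "v \<notin> Q" "w \<in> V" "w \<notin> Q" "h v \<subset> h w" for v w
    unfolding ix_def
  proof (rule psubset_card_mono[OF fb[OF that(3,4)]])
    have "h v \<in> L" using that by (auto simp: L_def)
    then show "{l\<in>L. l \<subset> h v} \<subset> {l\<in>L. l \<subset> h w}" using that(5) by blast
  qed
  have ixeq: "h v = h w" if "v \<in> R i" "w \<in> R i" for v w i
  proof -
    have a: "v \<in> V" "v \<notin> Q" "w \<in> V" "w \<notin> Q" "ix v = ix w" using that by (auto simp: R_def)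
    have "\<not> h v \<subset> h w" using ixlt[OF a(1-4)] a(5) by auto
    moreover have "\<not> h w \<subset> h v" using ixlt[OF a(3,4,1,2)] a(5) by auto
    moreover have "h v \<subseteq> h w \<or> h w \<subseteq> h v" using h_cmp[of v w] a VX(1) by blast
    ultimately show ?thesis by blast
  qed
  have "\<exists>m. R i \<subseteq> NN m" for i
  proof (cases "R i = {}")
    case False
    then obtain v where v: "v \<in> R i" by blast
    then obtain m where "v \<in> NN m" "v \<notin> Q" by (auto simp: R_def V_def)
    then have "h v \<subseteq> NN m" using hN by blast
    then have "R i \<subseteq> NN m" using ixeq[OF v] hull_in(2) by blast
    then show ?thesis by blast
  qed auto
  then obtain m where m: "\<And>i. R i \<subseteq> NN (m i)" by metis
  define tR where "tR i = (\<exists>v\<in>R i. ty v)" for i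
  have RX: "v \<in> X" "v \<notin> Q" if "v \<in> R i" for v i using that VX by (auto simp: R_def)
  have tyR: "ty v = tR i" if "v \<in> R i" for v i
  proof -
    have "ty v = ty w" if "w \<in> R i" for w
      using h_ty[OF RX[OF \<open>v \<in> R i\<close>] RX[OF that] ixeq[OF \<open>v \<in> R i\<close> that]] .
    then show ?thesis using that unfolding tR_def by blast
  qed
  define fl where "fl t n = (SOME z. z \<in> X \<and> z \<notin> Q \<and> ty z = t \<and> z \<in> NN (n + 2) \<and> z \<notin> NN n)" for t n
  have fl: "fl t n \<in> X" "fl t n \<notin> Q" "ty (fl t n) = t" "fl t n \<in> NN (n + 2)" "fl t n \<notin> NN n" for t n
  proof -
    have "\<exists>z. z \<in> X \<and> z \<notin> Q \<and> ty z = t \<and> z \<in> NN (n + 2) \<and> z \<notin> NN n" using filler[of t n] by blast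
    then have "fl t n \<in> X \<and> fl t n \<notin> Q \<and> ty (fl t n) = t \<and> fl t n \<in> NN (n + 2) \<and> fl t n \<notin> NN n"
      unfolding fl_def by (rule someI_ex)
    then show "fl t n \<in> X" "fl t n \<notin> Q" "ty (fl t n) = t" "fl t n \<in> NN (n + 2)" "fl t n \<notin> NN n" by auto
  qed
  \<comment> \<open>Block \<open>s\<close> will lie in \<open>NN (tt (Suc s)) - NN (tt s)\<close>.
    Two fillers of width 2 account for the constant 4; a layer inside \<open>NN (m i)\<close> needs
    the width \<open>m i\<close> after it has been moved by \<open>tt s\<close> iterations.\<close>
  define tt where "tt = rec_nat 0 (\<lambda>s x. x + m (s div 4) + 4)"
  have tt: "tt (Suc s) = tt s + m (s div 4) + 4" for s by (simp add: tt_def)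
  have ttm: "tt i \<le> tt j" if "i \<le> j" for i j
    by (rule lift_Suc_mono_le[OF _ that]) (simp add: tt)
  \<comment> \<open>Even blocks have type \<open>True\<close>, odd ones type \<open>False\<close>.
    Layer \<open>i\<close> owns the blocks \<open>4 * i\<close> to \<open>4 * i + 3\<close>: it goes
    to the first of them if its type is \<open>True\<close> and to the last if its type is
    \<open>False\<close>. So block \<open>4 * i + 1\<close>, which encodes \<open>b i\<close>,
    contains fillers only.\<close>
  define asg where "asg s = (if s mod 4 = 0 \<and> tR (s div 4) \<or> s mod 4 = 3 \<and> \<not> tR (s div 4) then (g ^^ tt s) ` R (s div 4) else {})" for s
  define dbl where "dbl s = (s mod 4 \<noteq> 1 \<or> \<not> b (s div 4))" for s :: nat
  define C where "C s = {fl (even s) (tt s)} \<union> (if dbl s then {fl (even s) (tt s + 2)} else {}) \<union> asg s" for s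
  define T where "T s = NN (tt s)" for s
  define B where "B = (X - V) \<union> Q \<union> (\<Union>s. C s)"
  have Tmono: "T i \<subseteq> T j" if "i \<le> j" for i j unfolding T_def using NN_le ttm that by blast
  have par: "even s = (s mod 4 = 0 \<or> s mod 4 = 2)" for s :: nat by presburger
  have asg1: "y \<in> T (Suc s) \<and> y \<notin> T s \<and> ty y = even s \<and> y \<in> X" if ya: "y \<in> asg s" for y s
  proof -
    obtain v where v: "v \<in> R (s div 4)" "y = (g ^^ tt s) v" "s mod 4 = 0 \<and> tR (s div 4) \<or> s mod 4 = 3 \<and> \<not> tR (s div 4)"
      using ya unfolding asg_def by (auto split: if_splits)
    note vX = RX[OF v(1)]
    have "v \<in> NN (m (s div 4))" using m v(1) by blast
    then have "y \<in> NN (m (s div 4) + tt s)" using gpowN vX(2) v(2) by blast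
    then have "y \<in> T (Suc s)" using NN_le[of "m (s div 4) + tt s" "tt (Suc s)"] unfolding T_def tt by auto
    moreover have "y \<notin> T s" using gpow_out[OF vX] v(2) T_def by blast
    moreover have "ty y = even s" using gpow[OF vX, of "tt s"] tyR[OF v(1)] v(2,3) par[of s] by auto
    ultimately show ?thesis using gpow[OF vX] v(2) by blast
  qed
  have fl1: "fl t (tt s) \<in> T (Suc s)" "fl t (tt s) \<notin> T s" "fl t (tt s + 2) \<in> T (Suc s)" "fl t (tt s + 2) \<notin> T s"
    "fl t (tt s) \<noteq> fl t (tt s + 2)" for t s
    using fl(4,5)[of t "tt s"] fl(4,5)[of t "tt s + 2"] NN_le[of "tt s + 2" "tt (Suc s)"] NN_le[of "tt s + 2 + 2" "tt (Suc s)"]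
      NN_le[of "tt s" "tt s + 2"] unfolding T_def tt by auto
  have Cin: "C s \<subseteq> T (Suc s) - T s" for s
    using fl1 asg1 unfolding C_def by (auto split: if_splits)
  have TV: "T s \<subseteq> V" for s unfolding T_def V_def by blast
  have CX: "C s \<subseteq> X" for s using Cin TV VX by blast
  have BT: "B \<inter> (T (Suc s) - T s) = C s" for s
  proof
    show "C s \<subseteq> B \<inter> (T (Suc s) - T s)" using Cin B_def by blast
    have "False" if "y \<in> C s'" "s' \<noteq> s" "y \<in> T (Suc s)" "y \<notin> T s" for y s'
      using Cin[of s'] that Tmono[of "Suc s'" s] Tmono[of "Suc s" s'] by (cases "s' < s") auto
    moreover have "Q \<subseteq> T s" unfolding T_def by (rule QN)
    ultimately show "B \<inter> (T (Suc s) - T s) \<subseteq> C s" unfolding B_def using TV by blast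
  qed
  define sl where "sl i = (if tR i then 4 * i else 4 * i + 3)" for i
  have sl: "(g ^^ tt (sl i)) ` R i \<subseteq> C (sl i)" for i
  proof -
    have "(4 * i + 3) div 4 = i" "(4 * i + 3) mod 4 = 3" by simp_all
    then have "asg (sl i) = (g ^^ tt (sl i)) ` R i" unfolding asg_def sl_def by auto
    then show ?thesis unfolding C_def by blast
  qed
  have slm: "Suc (sl i) \<le> sl j" if "i < j" for i j using that by (auto simp: sl_def)
  define k where "k v = (if v \<in> V \<and> v \<notin> Q then (g ^^ tt (sl (ix v))) v else v)" for v
  have kC: "k v \<in> C (sl (ix v))" if "v \<in> V" "v \<notin> Q" for v
    using sl[of "ix v"] that unfolding k_def R_def by auto
  have kty: "ty (k v) = ty v" "k v \<in> V" "k v \<notin> Q" if "v \<in> V" "v \<notin> Q" for v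
    using gpow[of v "tt (sl (ix v))"] that VX kC[OF that] Cin[of "sl (ix v)"] TV[of "Suc (sl (ix v))"] unfolding k_def by auto
  have Vm: "e z v = ty z" if z: "z \<in> X" "z \<notin> V" "v \<in> V" for z v
  proof -
    obtain n where "v \<in> NN n" using z V_def by blast
    moreover have "z \<notin> NN n" "q0 \<in> NN n" using z q0 QN[of n] unfolding V_def by blast+
    ultimately show ?thesis using modlD(3)[OF NN_modl[of n], of z v q0] z(1) by blast
  qed
  \<comment> \<open>The condition \<open>ord\<close> only fixes the order of the pair;
    \<open>kk2\<close> removes it by symmetry.\<close>
  have kk: "k v \<noteq> k w \<and> e (k v) (k w) = e v w" if vw: "v \<in> X" "w \<in> X" "v \<noteq> w"
    and ord: "w \<in> V \<and> w \<notin> Q \<longrightarrow> v \<in> V \<and> v \<notin> Q \<and> ix v \<le> ix w" for v w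
  proof -
    consider (a) "v \<in> V" "v \<notin> Q" "w \<in> V" "w \<notin> Q" "ix v < ix w" | (b) "v \<in> V" "v \<notin> Q" "w \<in> V" "w \<notin> Q" "ix v = ix w"
      | (c) "v \<in> V" "v \<notin> Q" "w \<in> Q" | (d) "v \<in> V" "v \<notin> Q" "w \<notin> V" | (f) "v \<notin> V \<or> v \<in> Q" "w \<notin> V \<or> w \<in> Q"
      using ord le_neq_implies_less by blast
    then show ?thesis
    proof cases
      case a
      have 1: "k v \<in> T (Suc (sl (ix v)))" "k w \<notin> T (sl (ix w))"
        using kC[OF a(1,2)] Cin[of "sl (ix v)"] kC[OF a(3,4)] Cin[of "sl (ix w)"] by blast+
      then have 2: "k w \<notin> T (Suc (sl (ix v)))" using Tmono[OF slm[OF a(5)]] by blast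
      have "e (k w) (k v) = ty (k w)"
        using modlD(3)[OF NN_modl[of "tt (Suc (sl (ix v)))"], of "k w" "k v" q0] 1 2 kty[OF a(3,4)] VX q0
          QN[of "tt (Suc (sl (ix v)))"] unfolding T_def by blast
      moreover have "h v \<subset> h w"
      proof (rule ccontr)
        assume "\<not> h v \<subset> h w"
        then have "h w \<subset> h v \<or> h v = h w" using h_cmp[of v w] a VX by blast
        then show False using ixlt[OF a(3,4,1,2)] a(5) by (auto simp: ix_def)
      qed
      then have "e w v = ty w" using h_notin h_out vw by blast
      ultimately show ?thesis using kty[OF a(3,4)] 1 2 esym[of "k v" "k w"] esym[of v w] by auto
    next
      case b
      have k2: "k v = (g ^^ tt (sl (ix v))) v" "k w = (g ^^ tt (sl (ix v))) w" using b by (auto simp: k_def)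
      note em = embD[OF emb_funpow[OF g, of "tt (sl (ix v))"]]
      show ?thesis unfolding k2 using em(3)[OF vw] em(4)[OF vw(1,2)] vw(3) by blast
    next
      case c
      have kw: "k w = w" using c by (simp add: k_def)
      have "e (k v) w = ty (k v)" "e v w = ty v"
        using modlD(3)[OF Qm, of "k v" w q0] modlD(3)[OF Qm, of v w q0] kty[OF c(1,2)] c q0 VX by blast+
      then show ?thesis using kty[OF c(1,2)] c kw by auto
    next
      case d
      have kw: "k w = w" using d by (simp add: k_def)
      have "e w (k v) = ty w" "e w v = ty w" using Vm vw d kty[OF d(1,2)] by auto
      then show ?thesis using kw kty[OF d(1,2)] d esym by metis
    next
      case f
      then have "k v = v" "k w = w" by (auto simp: k_def)
      then show ?thesis using vw by simp
    qed
  qed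
  have kk2: "k v \<noteq> k w \<and> e (k v) (k w) = e v w" if "v \<in> X" "w \<in> X" "v \<noteq> w" for v w
  proof -
    have "k v \<noteq> k w \<and> e (k v) (k w) = e v w \<or> k w \<noteq> k v \<and> e (k w) (k v) = e w v"
    proof (cases "w \<in> V \<and> w \<notin> Q \<longrightarrow> v \<in> V \<and> v \<notin> Q \<and> ix v \<le> ix w")
      case True then show ?thesis using kk[of v w] that by blast
    next
      case False
      then have "v \<in> V \<and> v \<notin> Q \<longrightarrow> w \<in> V \<and> w \<notin> Q \<and> ix w \<le> ix v" by auto
      then show ?thesis using kk[of w v] that by blast
    qed
    then show ?thesis using esym[of v w] esym[of "k v" "k w"] by auto
  qed
  have BX: "B \<subseteq> X" unfolding B_def using CX VX by blast
  have "emb k X B"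
  proof (rule embI)
    show "inj_on k X" unfolding inj_on_def using kk2 by blast
    show "k v \<in> B" if "v \<in> X" for v
      using kC[of v] that unfolding B_def by (cases "v \<in> V \<and> v \<notin> Q") (auto simp: k_def)
  qed (use kk2 in blast)
  then have BS: "B \<in> Sib X" using SibI BX by blast
  have pI: "(\<lambda>n. card (B \<inter> (T (Suc (Suc n)) - T (Suc n))) = 1) \<in> Inv B"
  proof (rule up_blocks[where t = True and X = X and q = q0])
    show "modl (T i) X" for i unfolding T_def by (rule NN_modl)
    show "q0 \<in> T i" for i unfolding T_def using QN q0 by blast
    show "T i \<subseteq> T (Suc i)" for i using Tmono by simp
    show "q0 \<in> B" unfolding B_def using q0 by blast
    show "B \<inter> (T (Suc i) - T i) \<noteq> {}" for i unfolding BT C_def by simp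
    show "ty y = (True = even i)" if "y \<in> B \<inter> (T (Suc i) - T i)" for i y
      using that fl(3) asg1[of y i] unfolding BT C_def by (auto split: if_splits)
  qed (rule BX)
  have cI: "(card (B \<inter> (T (Suc (Suc (4 * i))) - T (Suc (4 * i)))) = 1) = b i" for i
  proof -
    have "Suc (4 * i) mod 4 = 1" "Suc (4 * i) div 4 = i" by presburger+
    then have "asg (Suc (4 * i)) = {}" "dbl (Suc (4 * i)) = (\<not> b i)" unfolding asg_def dbl_def by auto
    then show ?thesis unfolding BT C_def using fl1(5)[of "even (Suc (4 * i))" "Suc (4 * i)"] by (simp add: card_insert_if)
  qed
  show "\<exists>B\<in>Sib X. \<exists>p\<in>Inv B. \<forall>i. p (4 * i) = b i"
    by (rule bexI[OF _ BS], rule bexI[OF _ pI], rule allI, rule cI)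
qed

lemma shift_aux: "\<not> fin X"
  using shift_infinite shift_finite by blast

end

text \<open>\<open>f\<close> may be changed to the identity on the preimage \<open>?Q\<close>: for
  \<open>v\<close> outside \<open>?Q\<close>, the vertex \<open>f v\<close> is outside the module
  \<open>M\<close> and does not distinguish \<open>q\<close> from \<open>f q\<close>.\<close>

lemma shift:
  assumes "X \<subseteq> U" "emb f X X" "strong M X" "{x\<in>X. f x \<in> M} \<subset> M" "{x\<in>X. f x \<in> M} \<noteq> {}"
  shows "\<not> fin X"
proof -
  let ?Q = "{x\<in>X. f x \<in> M}"
  define g where "g x = (if x \<in> ?Q then x else f x)" for x
  note d = embD[OF assms(2)]
  obtain q0 where q0: "q0 \<in> ?Q" using assms(5) by blast
  have m: "modl ?Q X" using modl_vimg[OF assms(2) strongD(1)[OF assms(3)] assms(5)] .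
  have MX: "M \<subseteq> X" using strongD(2) assms(3) by blast
  have mix: "e (f v) q = e v q" if "v \<in> X" "v \<notin> ?Q" "q \<in> ?Q" for v q
  proof -
    have "e (f v) q = e (f v) (f q)" using strongD(4)[OF assms(3), of "f v" q "f q"] that d(2)[of v] assms(4) by blast
    moreover have "v \<noteq> q" using that by blast
    ultimately show ?thesis using d(3)[of v q] that by blast
  qed
  have ge: "emb g X X"
  proof (rule embI)
    show "inj_on g X" using d(4) assms(4) unfolding inj_on_def g_def by auto
    show "g x \<in> X" if "x \<in> X" for x using d(2)[OF that] that by (simp add: g_def)
    fix x y assume xy: "x \<in> X" "y \<in> X" "x \<noteq> y"
    have gi: "g v = (if v \<in> ?Q then v else f v)" for v by (simp add: g_def)
    show "e (g x) (g y) = e x y"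
    proof (cases "x \<in> ?Q")
      case True
      then show ?thesis using mix[of y x] xy esym[of x "f y"] esym[of x y] gi[of x] gi[of y] by metis
    next
      case False
      then show ?thesis using mix[of x y] d(3)[OF xy] xy gi[of x] gi[of y] by metis
    qed
  qed
  show ?thesis
    by (rule shift_aux[OF assms(1,3) m assms(4) q0 ge]) (auto simp: g_def)
qed

section \<open>Replacing strong modules\<close>

context
  fixes X :: "'a set" and K :: "'a set set" and r :: "'a set \<Rightarrow> 'a set"
  assumes Ks: "\<And>M. M \<in> K \<Longrightarrow> strong M X"
    and Kd: "\<And>M N. \<lbrakk>M \<in> K; N \<in> K; M \<noteq> N\<rbrakk> \<Longrightarrow> M \<inter> N = {}"
    and rM: "\<And>M. M \<in> K \<Longrightarrow> r M \<subseteq> M" "\<And>M. M \<in> K \<Longrightarrow> r M \<noteq> {}"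
begin

definition Rp :: "'a set" where "Rp = (X - \<Union>K) \<union> \<Union>(r ` K)"

text \<open>The lift of a part of the new graph to \<open>X\<close>. It behaves well for the sets in
  \<open>sat\<close>, which cut none of the replacements.\<close>

definition up :: "'a set \<Rightarrow> 'a set" where "up T = T \<union> \<Union>{M\<in>K. r M \<subseteq> T}"

definition sat :: "'a set \<Rightarrow> bool" where "sat T \<longleftrightarrow> (\<forall>M\<in>K. r M \<subseteq> T \<or> T \<inter> r M = {})"

lemma KX: "M \<in> K \<Longrightarrow> M \<subseteq> X" using strongD(2)[OF Ks] .

lemma RpX: "Rp \<subseteq> X" using KX rM(1) unfolding Rp_def by blast

lemma Rp_int: "M \<in> K \<Longrightarrow> Rp \<inter> M = r M"
  using Kd rM(1) unfolding Rp_def by blast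

lemma Rp_in: "\<lbrakk>x \<in> X; \<And>M. \<lbrakk>M \<in> K; x \<in> M\<rbrakk> \<Longrightarrow> x \<in> r M\<rbrakk> \<Longrightarrow> x \<in> Rp"
  unfolding Rp_def by blast

lemma r_sub_Rp: "M \<in> K \<Longrightarrow> r M \<subseteq> Rp" unfolding Rp_def by blast

lemma r_modl: assumes "M \<in> K" shows "modl (r M) Rp"
proof -
  have "M \<inter> Rp = r M" using Rp_int[OF assms] by blast
  then show ?thesis using modl_restrict[OF strongD(1)[OF Ks[OF assms]] RpX] rM(2)[OF assms] by simp
qed

lemma up_int: assumes "T \<subseteq> Rp" shows "up T \<inter> Rp = T"
  using assms Rp_int r_sub_Rp unfolding up_def by blast

lemma up_in: "\<lbrakk>M \<in> K; r M \<subseteq> T; x \<in> M\<rbrakk> \<Longrightarrow> x \<in> up T"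
  unfolding up_def by blast

lemma up_cut: assumes "T \<subseteq> Rp" "sat T" "M \<in> K" shows "M \<subseteq> up T \<or> up T \<inter> M = {}"
proof (cases "r M \<subseteq> T")
  case True then show ?thesis using assms unfolding up_def by blast
next
  case False
  then have "T \<inter> r M = {}" using assms sat_def by blast
  then have "T \<inter> M = {}" using Rp_int[OF assms(3)] assms(1) by blast
  moreover have "N \<inter> M = {}" if "N \<in> K" "r N \<subseteq> T" for N
    using Kd[OF that(1) assms(3)] False that by blast
  ultimately show ?thesis unfolding up_def by blast
qed

lemma up_X: "T \<subseteq> Rp \<Longrightarrow> up T \<subseteq> X"
  using RpX KX unfolding up_def by blast

lemma up_modl: assumes "modl T Rp" "sat T" shows "modl (up T) X"
proof (rule modlI)
  have TR: "T \<subseteq> Rp" "T \<noteq> {}" using modlD assms by auto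
  show "up T \<subseteq> X" using up_X TR by blast
  show "up T \<noteq> {}" using TR unfolding up_def by blast
  fix z a b assume z: "z \<in> X" "z \<notin> up T" and ab: "a \<in> up T" "b \<in> up T"
  obtain z' where z': "z' \<in> Rp" "z' \<notin> up T" "\<And>c. c \<in> up T \<Longrightarrow> e z c = e z' c"
  proof (cases "\<exists>M\<in>K. z \<in> M")
    case True
    then obtain M where M: "M \<in> K" "z \<in> M" by blast
    obtain z' where z': "z' \<in> r M" using rM(2)[OF M(1)] by blast
    have uM: "up T \<inter> M = {}" using up_cut[OF TR(1) assms(2) M(1)] M z by blast
    have "e z c = e z' c" if "c \<in> up T" for c
      using strongD(4)[OF Ks[OF M(1)], of c z z'] M z' rM(1)[OF M(1)] that uM up_X[OF TR(1)] esym[of c] by blast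
    moreover have "z' \<in> Rp" "z' \<notin> up T" using z' uM r_sub_Rp[OF M(1)] rM(1)[OF M(1)] by blast+
    ultimately show ?thesis using that by blast
  next
    case False
    then have "z \<in> Rp" using z Rp_in by blast
    then show ?thesis using that z by blast
  qed
  have zT: "z' \<notin> T" using z' unfolding up_def by blast
  obtain t0 where t0: "t0 \<in> T" using TR by blast
  have "e z' c = e z' t0" if cu: "c \<in> up T" for c
  proof (cases "c \<in> T")
    case True show ?thesis by (rule modlD(3)[OF assms(1) z'(1) zT True t0])
  next
    case False
    then obtain M where M: "M \<in> K" "r M \<subseteq> T" "c \<in> M" using cu unfolding up_def by blast
    obtain d where d: "d \<in> r M" using rM(2)[OF M(1)] by blast
    have "M \<subseteq> up T" using M unfolding up_def by blast
    then have "e z' c = e z' d" using strongD(4)[OF Ks[OF M(1)], of z' c d] M d rM(1)[OF M(1)] z' RpX by blast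
    then show ?thesis using modlD(3)[OF assms(1) z'(1) zT, of d t0] d M(2) t0 by blast
  qed
  then show "e z a = e z b" using z'(3) ab by metis
qed

lemma low_modl: "\<lbrakk>modl S X; S \<inter> Rp \<noteq> {}\<rbrakk> \<Longrightarrow> modl (S \<inter> Rp) Rp"
  using modl_restrict RpX by blast

text \<open>A module \<open>N\<close> overlapping \<open>r M\<close>, saturated and lifted to
  \<open>X\<close>, becomes a module that properly contains \<open>M\<close> and is related to it by
  the type \<open>s\<close> only. Since \<open>M\<close> splits in the type \<open>s\<close> as
  well, this contradicts \<open>strong_other_type\<close>.\<close>

lemma r_strong:
  assumes "M \<in> K" "\<And>t. disc t (r M) \<Longrightarrow> disc t M" shows "strong (r M) Rp"
proof (rule strongI_ndisc[OF r_modl[OF assms(1)]])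
  fix s N assume s: "disc s (r M)" and N: "modl N Rp" "N \<inter> r M \<noteq> {}" "N - r M \<noteq> {}" "r M - N \<noteq> {}" "rel s (N - r M) (r M)"
  have NR: "N \<subseteq> Rp" using modlD N by blast
  define T where "T = N \<union> \<Union>{r M' |M'. M' \<in> K \<and> r M' \<inter> N \<noteq> {}}"
  have TR: "T \<subseteq> Rp" using NR r_sub_Rp unfolding T_def by blast
  have mT: "modl T Rp"
  proof (rule modlI[OF TR])
    show "T \<noteq> {}" using N unfolding T_def by blast
    fix z a b assume z: "z \<in> Rp" "z \<notin> T" "a \<in> T" "b \<in> T"
    obtain n0 where n0: "n0 \<in> N" using N by blast
    have "e z c = e z n0" if cT: "c \<in> T" for c
    proof (cases "c \<in> N")
      case True then show ?thesis using modlD(3)[OF N(1), of z c n0] z n0 unfolding T_def by blast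
    next
      case False
      then obtain M' d where M': "M' \<in> K" "c \<in> r M'" "d \<in> r M'" "d \<in> N" using cT unfolding T_def by blast
      then have "r M' \<subseteq> T" unfolding T_def by blast
      then have "e z c = e z d" using modlD(3)[OF r_modl[OF M'(1)], of z c d] M' z by blast
      then show ?thesis using modlD(3)[OF N(1), of z d n0] z n0 M' unfolding T_def by blast
    qed
    then show "e z a = e z b" using z by metis
  qed
  have rMT: "r M \<subseteq> T" using N(2) assms(1) unfolding T_def by blast
  have sT: "sat T" unfolding sat_def
  proof
    fix M' assume M': "M' \<in> K"
    show "r M' \<subseteq> T \<or> T \<inter> r M' = {}"
    proof (cases "r M' \<inter> N = {}")
      case False then show ?thesis using M' unfolding T_def by blast
    next
      case True
      have "r M' \<inter> r M'' = {}" if "M'' \<in> K" "r M'' \<inter> N \<noteq> {}" for M''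
        using Kd[OF M' that(1)] True that rM(1)[OF M'] rM(1)[OF that(1)] by blast
      then show ?thesis using True unfolding T_def by blast
    qed
  qed
  have mS: "modl (up T) X" by (rule up_modl[OF mT sT])
  have MS: "M \<subseteq> up T" using rMT assms(1) unfolding up_def by blast
  have relS: "rel s (up T - M) M" unfolding rel_def
  proof (intro ballI)
    fix y m assume y: "y \<in> up T - M" and m: "m \<in> M"
    obtain m0 where m0: "m0 \<in> r M" using N by blast
    have m0M: "m0 \<in> M" using m0 rM(1) assms by blast
    have key: "e y m0 = s"
    proof (cases "y \<in> N")
      case True
      then show ?thesis using relD[OF N(5)] m0 y rM(1)[OF assms(1)] by blast
    next
      case False
      have "\<exists>M'\<in>K. y \<in> M' \<and> (\<exists>d\<in>r M'. d \<in> N)"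
      proof (cases "y \<in> T")
        case True then show ?thesis using False rM(1) unfolding T_def by blast
      next
        case nT: False
        then obtain M' where M': "M' \<in> K" "r M' \<subseteq> T" "y \<in> M'" using y unfolding up_def by blast
        obtain d where d: "d \<in> r M'" using rM(2)[OF M'(1)] by blast
        then have "d \<in> T" using M' by blast
        then consider "d \<in> N" | M'' where "M'' \<in> K" "d \<in> r M''" "r M'' \<inter> N \<noteq> {}" unfolding T_def by blast
        then show ?thesis
        proof cases
          case 1 then show ?thesis using M' d by blast
        next
          case 2
          then have "M'' = M'" using Kd[OF 2(1) M'(1)] d rM(1)[OF 2(1)] rM(1)[OF M'(1)] by blast
          then show ?thesis using 2 M' by blast
        qed
      qed
      then obtain M' d where M': "M' \<in> K" "y \<in> M'" "d \<in> r M'" "d \<in> N" by blast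
      have ne: "M' \<inter> M = {}" using Kd[OF M'(1) assms(1)] y M' by blast
      have dM: "d \<in> M'" "d \<notin> r M" using M' rM(1)[OF M'(1)] rM(1)[OF assms(1)] ne by blast+
      have "e d m0 = s" using relD[OF N(5)] M' dM m0 by blast
      moreover have "e m0 y = e m0 d"
        using strongD(4)[OF Ks[OF M'(1)], of m0 y d] m0M ne KX[OF assms(1)] M' dM by blast
      ultimately show ?thesis using esym by metis
    qed
    have "y \<in> X" using y up_X[OF TR] by blast
    then have "e y m = e y m0" using strongD(4)[OF Ks[OF assms(1)], of y m m0] y m m0M by blast
    then show "e y m = s" using key by simp
  qed
  have MM: "M \<subset> up T"
  proof -
    obtain y where "y \<in> N" "y \<notin> r M" using N by blast
    then have "y \<in> up T" "y \<notin> M" using Rp_int[OF assms(1)] NR unfolding up_def T_def by blast+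
    then show ?thesis using MS by blast
  qed
  obtain u where "u \<in> up T" "u \<notin> M" "rel (\<not> s) {u} M"
    using strong_other_type[OF Ks[OF assms(1)] assms(2)[OF s] mS MM] by blast
  then show False using relS strongD(3)[OF Ks[OF assms(1)]] by (auto simp: rel_def)
qed

text \<open>A module of \<open>X\<close> that overlaps \<open>up T\<close> contains or misses each
  \<open>M\<close> in \<open>K\<close>, because \<open>up T\<close> does so. The witnesses of the
  overlap can then be moved into \<open>Rp\<close>, where they contradict the strength of
  \<open>T\<close>.\<close>

lemma strong_up:
  assumes "strong T Rp" "sat T" shows "strong (up T) X"
  unfolding strong_def
proof (intro conjI allI impI)
  have TR: "T \<subseteq> Rp" "T \<noteq> {}" using strongD assms by blast+
  show "modl (up T) X" using up_modl strongD(1) assms by blast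
  fix N assume N: "modl N X"
  show "N \<subseteq> up T \<or> up T \<subseteq> N \<or> N \<inter> up T = {}"
  proof (rule ccontr)
    assume c: "\<not> ?thesis"
    have cases: "M \<subseteq> N \<or> N \<inter> M = {}" if "M \<in> K" for M
      using strongD(5)[OF Ks[OF that] N] c up_cut[OF TR(1) assms(2) that] by blast
    have in1: "\<exists>y\<in>Rp. y \<in> N \<and> y \<in> up T"
    proof -
      obtain x where x: "x \<in> N" "x \<in> up T" using c by blast
      show ?thesis
      proof (cases "\<exists>M\<in>K. x \<in> M")
        case True
        then obtain M where M: "M \<in> K" "x \<in> M" by blast
        obtain y where "y \<in> r M" using rM(2)[OF M(1)] by blast
        then show ?thesis using M x cases[OF M(1)] up_cut[OF TR(1) assms(2) M(1)] r_sub_Rp[OF M(1)] rM(1)[OF M(1)] by blast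
      next
        case False then show ?thesis using x Rp_in modlD(1)[OF N] by blast
      qed
    qed
    have in2: "\<exists>y\<in>Rp. y \<in> N \<and> y \<notin> up T"
    proof -
      obtain x where x: "x \<in> N" "x \<notin> up T" using c by blast
      show ?thesis
      proof (cases "\<exists>M\<in>K. x \<in> M")
        case True
        then obtain M where M: "M \<in> K" "x \<in> M" by blast
        obtain y where "y \<in> r M" using rM(2)[OF M(1)] by blast
        then show ?thesis using M x cases[OF M(1)] up_cut[OF TR(1) assms(2) M(1)] r_sub_Rp[OF M(1)] rM(1)[OF M(1)] by blast
      next
        case False then show ?thesis using x Rp_in modlD(1)[OF N] by blast
      qed
    qed
    have in3: "\<exists>y\<in>Rp. y \<notin> N \<and> y \<in> up T"
    proof -
      obtain x where x: "x \<notin> N" "x \<in> up T" using c by blast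
      show ?thesis
      proof (cases "\<exists>M\<in>K. x \<in> M")
        case True
        then obtain M where M: "M \<in> K" "x \<in> M" by blast
        obtain y where "y \<in> r M" using rM(2)[OF M(1)] by blast
        then show ?thesis using M x cases[OF M(1)] up_cut[OF TR(1) assms(2) M(1)] r_sub_Rp[OF M(1)] rM(1)[OF M(1)] by blast
      next
        case False then show ?thesis using x Rp_in up_X[OF TR(1)] by blast
      qed
    qed
    have "modl (N \<inter> Rp) Rp" using low_modl[OF N] in1 by blast
    from strongD(5)[OF assms(1) this] show False using in1 in2 in3 up_int[OF TR(1)] by blast
  qed
qed

lemma sat_cases:
  assumes "strong T Rp" shows "sat T \<or> (\<exists>M\<in>K. T \<subset> r M)"
proof (cases "\<exists>M\<in>K. T \<subset> r M")
  case False
  have "r M \<subseteq> T \<or> T \<inter> r M = {}" if "M \<in> K" for M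
    using strongD(5)[OF assms r_modl[OF that]] False that by blast
  then show ?thesis unfolding sat_def by blast
qed blast

lemma strong_low:
  assumes "strong S X" "\<And>M. M \<in> K \<Longrightarrow> M \<subseteq> S \<or> S \<inter> M = {}" "\<And>M. M \<in> K \<Longrightarrow> strong (r M) Rp"
  shows "strong (S \<inter> Rp) Rp"
  unfolding strong_def
proof (intro conjI allI impI)
  have "\<exists>x\<in>S. x \<in> Rp"
  proof -
    obtain x where x: "x \<in> S" using strongD(3)[OF assms(1)] by blast
    show ?thesis
    proof (cases "\<exists>M\<in>K. x \<in> M")
      case True
      then obtain M where M: "M \<in> K" "x \<in> M" by blast
      then show ?thesis using assms(2)[OF M(1)] x rM[OF M(1)] r_sub_Rp[OF M(1)] by blast
    next
      case False then show ?thesis using x Rp_in strongD(2)[OF assms(1)] by blast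
    qed
  qed
  then show "modl (S \<inter> Rp) Rp" using low_modl[OF strongD(1)[OF assms(1)]] by blast
  fix N assume N: "modl N Rp"
  have NR: "N \<subseteq> Rp" using modlD N by blast
  show "N \<subseteq> S \<inter> Rp \<or> S \<inter> Rp \<subseteq> N \<or> N \<inter> (S \<inter> Rp) = {}"
  proof (cases "\<exists>M\<in>K. N \<subseteq> r M")
    case True
    then obtain M where "M \<in> K" "N \<subseteq> r M" by blast
    then show ?thesis using assms(2)[of M] rM(1)[of M] NR by blast
  next
    case False
    have "r M \<subseteq> N \<or> N \<inter> r M = {}" if "M \<in> K" for M
      using strongD(5)[OF assms(3)[OF that] N] False that by blast
    then have "sat N" unfolding sat_def by blast
    then have "modl (up N) X" using up_modl N by blast
    then show ?thesis using strongD(5)[OF assms(1), of "up N"] up_int[OF NR] NR by blast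
  qed
qed

text \<open>Disjoint modules are uniformly related, so the embeddings of the single modules and the
  identity elsewhere fit together.\<close>

lemma rep_le:
  assumes "S \<subseteq> X" "\<And>M. M \<in> K \<Longrightarrow> M \<subseteq> S \<or> S \<inter> M = {}" "\<And>M. M \<in> K \<Longrightarrow> le M (r M)"
  shows "le S (S \<inter> Rp)"
proof -
  have "\<forall>M. \<exists>j. M \<in> K \<longrightarrow> emb j M (r M)" using assms(3) le_def by blast
  then obtain j where j: "\<And>M. M \<in> K \<Longrightarrow> emb (j M) M (r M)" by metis
  define mm where "mm x = (THE M. M \<in> K \<and> x \<in> M)" for x
  have mm: "mm x = M" if "M \<in> K" "x \<in> M" for x M
    unfolding mm_def by (rule the_equality) (use that Kd[of _ M] in blast)+
  define F where "F x = (if \<exists>M\<in>K. x \<in> M then j (mm x) x else x)" for x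
  have F1: "F x = j M x" if "M \<in> K" "x \<in> M" for x M using that mm[OF that] unfolding F_def by auto
  have F2: "F x = x" if "\<not> (\<exists>M\<in>K. x \<in> M)" for x using that unfolding F_def by auto
  have F3: "F x \<in> r M" "F x \<in> M" if "M \<in> K" "x \<in> M" for x M
    using embD(2)[OF j[OF that(1)] that(2)] F1[OF that] rM(1)[OF that(1)] by auto
  have key: "F x \<noteq> F y \<and> e (F x) (F y) = e x y" if xy: "x \<in> X" "y \<in> X" "x \<noteq> y" for x y
  proof (cases "\<exists>M\<in>K. x \<in> M")
    case True
    then obtain M where M: "M \<in> K" "x \<in> M" by blast
    show ?thesis
    proof (cases "y \<in> M")
      case True
      then show ?thesis using embD(3,4)[OF j[OF M(1)]] F1[OF M] F1[OF M(1) True] xy M by metis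
    next
      case ny: False
      show ?thesis
      proof (cases "\<exists>M\<in>K. y \<in> M")
        case True
        then obtain N where N: "N \<in> K" "y \<in> N" by blast
        have d: "M \<inter> N = {}" using Kd[OF M(1) N(1)] N ny by blast
        have "rel (e x y) M N" using modl_rel[OF strongD(1)[OF Ks[OF M(1)]] strongD(1)[OF Ks[OF N(1)]] d M(2) N(2)] .
        then show ?thesis using F3[OF M] F3[OF N] d by (auto simp: rel_def)
      next
        case False
        have "e y (F x) = e y x" using strongD(4)[OF Ks[OF M(1)] xy(2) ny F3(2)[OF M] M(2)] .
        then show ?thesis using F2[OF False] F3(2)[OF M] ny esym by metis
      qed
    qed
  next
    case nx: False
    show ?thesis
    proof (cases "\<exists>M\<in>K. y \<in> M")
      case True
      then obtain N where N: "N \<in> K" "y \<in> N" by blast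
      have nx': "x \<notin> N" using nx N by blast
      have "e x (F y) = e x y" using strongD(4)[OF Ks[OF N(1)] xy(1) nx' F3(2)[OF N] N(2)] .
      then show ?thesis using F2[OF nx] F3(2)[OF N] nx' by metis
    next
      case False then show ?thesis using F2[OF nx] F2[OF False] xy by simp
    qed
  qed
  have "emb F S (S \<inter> Rp)"
  proof (rule embI)
    show "inj_on F S" unfolding inj_on_def using key assms(1) by blast
    show "F x \<in> S \<inter> Rp" if x: "x \<in> S" for x
    proof (cases "\<exists>M\<in>K. x \<in> M")
      case True
      then obtain M where M: "M \<in> K" "x \<in> M" by blast
      then show ?thesis using F3[OF M] assms(2)[OF M(1)] x r_sub_Rp[OF M(1)] by blast
    next
      case False then show ?thesis using F2[OF False] x Rp_in assms(1) by auto
    qed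
  qed (use key assms(1) in blast)
  then show ?thesis unfolding le_def by blast
qed

lemma Rp_Sib: assumes "\<And>M. M \<in> K \<Longrightarrow> le M (r M)" shows "Rp \<in> Sib X"
proof -
  have "le X (X \<inter> Rp)" by (rule rep_le) (use KX assms in auto)
  moreover have "X \<inter> Rp = Rp" using RpX by blast
  ultimately show ?thesis using RpX unfolding Sib_def by simp
qed

end

section \<open>Equimorphic strong modules\<close>

definition Eq :: "'a set \<Rightarrow> 'a set \<Rightarrow> 'a set set" where
  "Eq X M0 = {M. strong M X \<and> eqm M M0}"

definition hat :: "'a set \<Rightarrow> 'a set \<Rightarrow> 'a set \<Rightarrow> 'a set" where
  "hat X M0 M = \<Union>{M'\<in>Eq X M0. M \<subseteq> M'}"

text \<open>\<open>cxi A M B N\<close>: the graphs obtained from \<open>A\<close> and \<open>B\<close> by contracting the modules \<open>M\<close> and \<open>N\<close> to a point are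
  isomorphic as pointed graphs.\<close>

definition cxi :: "'a set \<Rightarrow> 'a set \<Rightarrow> 'a set \<Rightarrow> 'a set \<Rightarrow> bool" where
  "cxi A M B N \<longleftrightarrow> (\<exists>f. emb f (A - M) (B - N) \<and> f ` (A - M) = B - N \<and>
     (\<forall>v\<in>A - M. \<forall>m\<in>M. \<forall>n\<in>N. e (f v) n = e v m))"

text \<open>The copies of \<open>M0\<close> that will be replaced. Such an \<open>M\<close> is
  recognized by its hat with \<open>M\<close> contracted to a point, which is insensitive to a
  replacement of \<open>M\<close> itself. Two nested copies with the same contracted hat would
  contradict \<open>shift\<close> (\<open>cxi_shift\<close>).\<close>

definition KK :: "'a set \<Rightarrow> 'a set \<Rightarrow> 'a set \<Rightarrow> 'a set set" where
  "KK X M0 R0 = {M\<in>Eq X M0. (\<forall>t. disc t M = disc t M0) \<and> cxi (hat X M0 M) M R0 M0}"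

definition nobranch :: "'a set \<Rightarrow> 'a set \<Rightarrow> bool" where
  "nobranch X M0 \<longleftrightarrow> (\<forall>M1\<in>Eq X M0. \<forall>M2\<in>Eq X M0. \<forall>M\<in>Eq X M0. M1 \<subseteq> M \<and> M2 \<subseteq> M \<longrightarrow> M1 \<inter> M2 \<noteq> {})"

lemma EqD: assumes "M \<in> Eq X M0" shows "strong M X" "eqm M M0" "modl M X" "M \<subseteq> X" "M \<noteq> {}"
proof -
  show s: "strong M X" "eqm M M0" using assms unfolding Eq_def by auto
  show "modl M X" "M \<subseteq> X" "M \<noteq> {}" using strongD(1-3)[OF s(1)] by auto
qed

lemma Eq_cmp: assumes "M \<in> Eq X M0" "N \<in> Eq X M0" "M \<inter> N \<noteq> {}" shows "M \<subseteq> N \<or> N \<subseteq> M"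
  using strongD(5)[OF EqD(1)[OF assms(1)] EqD(3)[OF assms(2)]] assms(3) by blast

lemma cxiE:
  assumes "cxi A M B N"
  obtains f where "emb f (A - M) (B - N)" "f ` (A - M) = B - N"
    "\<And>v m n. \<lbrakk>v \<in> A - M; m \<in> M; n \<in> N\<rbrakk> \<Longrightarrow> e (f v) n = e v m"
proof -
  from assms obtain f where f: "emb f (A - M) (B - N)" "f ` (A - M) = B - N"
    "\<forall>v\<in>A - M. \<forall>m\<in>M. \<forall>n\<in>N. e (f v) n = e v m" unfolding cxi_def by (elim exE conjE)
  show ?thesis by (rule that[OF f(1,2)]) (use f(3) in blast)
qed

lemma cxiI:
  assumes "emb f (A - M) (B - N)" "f ` (A - M) = B - N"
    "\<And>v m n. \<lbrakk>v \<in> A - M; m \<in> M; n \<in> N\<rbrakk> \<Longrightarrow> e (f v) n = e v m"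
  shows "cxi A M B N"
  unfolding cxi_def by (rule exI[of _ f]) (use assms in blast)

lemma cxi_sym: assumes "cxi A M B N" shows "cxi B N A M"
proof -
  obtain f where f: "emb f (A - M) (B - N)" "f ` (A - M) = B - N"
    "\<And>v m n. \<lbrakk>v \<in> A - M; m \<in> M; n \<in> N\<rbrakk> \<Longrightarrow> e (f v) n = e v m"
    by (rule cxiE[OF assms(1)]) (rule that)
  let ?g = "the_inv_into (A - M) f"
  have i: "inj_on f (A - M)" using embD(1)[OF f(1)] .
  have g: "emb ?g (B - N) (A - M)" using emb_inv[OF f(1)] f(2) by simp
  have g2: "?g ` (B - N) = A - M" using the_inv_into_onto[OF i] f(2) by simp
  have "e (?g v) m = e v n" if "v \<in> B - N" "n \<in> N" "m \<in> M" for v n m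
  proof -
    have "?g v \<in> A - M" using embD(2)[OF g that(1)] .
    moreover have "f (?g v) = v" using f_the_inv_into_f[OF i] that f(2) by simp
    ultimately show ?thesis using f(3)[of "?g v" m n] that by simp
  qed
  then show ?thesis by (rule cxiI[OF g g2])
qed

lemma cxi_trans: assumes "cxi A M B N" "cxi B N C P" "N \<noteq> {}" shows "cxi A M C P"
proof -
  obtain f where f: "emb f (A - M) (B - N)" "f ` (A - M) = B - N"
    "\<And>v m n. \<lbrakk>v \<in> A - M; m \<in> M; n \<in> N\<rbrakk> \<Longrightarrow> e (f v) n = e v m"
    by (rule cxiE[OF assms(1)]) (rule that)
  obtain g where g: "emb g (B - N) (C - P)" "g ` (B - N) = C - P"
    "\<And>v m n. \<lbrakk>v \<in> B - N; m \<in> N; n \<in> P\<rbrakk> \<Longrightarrow> e (g v) n = e v m"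
    by (rule cxiE[OF assms(2)]) (rule that)
  obtain n0 where n0: "n0 \<in> N" using assms by blast
  have "e ((g \<circ> f) v) p = e v m" if "v \<in> A - M" "m \<in> M" "p \<in> P" for v m p
    using g(3)[of "f v" n0 p] f(3)[of v m n0] embD(2)[OF f(1) that(1)] that n0 by simp
  moreover have "emb (g \<circ> f) (A - M) (C - P)" using emb_comp f g by blast
  moreover have "(g \<circ> f) ` (A - M) = C - P" using f(2) g(2) by (metis image_comp)
  ultimately show ?thesis using cxiI[of "g \<circ> f" A M C P] by blast
qed

lemma cxi_refl: assumes "modl M A" shows "cxi A M A M"
proof (rule cxiI[of id])
  fix v m n assume "v \<in> A - M" "m \<in> M" "n \<in> M"
  then show "e (id v) n = e v m" using modlD(3)[OF assms, of v n m] by simp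
qed (auto intro: emb_id)

lemma cxi_base:
  assumes "cxi A M B N" "A' - M' = A - M" "\<And>v m m'. \<lbrakk>v \<in> A - M; m \<in> M; m' \<in> M'\<rbrakk> \<Longrightarrow> e v m = e v m'" "M \<noteq> {}"
  shows "cxi A' M' B N"
proof -
  obtain f where f: "emb f (A - M) (B - N)" "f ` (A - M) = B - N"
    "\<And>v m n. \<lbrakk>v \<in> A - M; m \<in> M; n \<in> N\<rbrakk> \<Longrightarrow> e (f v) n = e v m"
    by (rule cxiE[OF assms(1)]) (rule that)
  obtain m0 where "m0 \<in> M" using assms by blast
  then have "e (f v) n = e v m" if "v \<in> A - M" "m \<in> M'" "n \<in> N" for v m n
    using f(3)[of v m0 n] assms(3)[of v m0 m] that by simp
  then show ?thesis by (intro cxiI[of f]) (use f(1,2) assms(2) in simp_all)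
qed

text \<open>The isomorphism between the two complements in \<open>h\<close>, extended by the
  identity on \<open>M\<close> and outside \<open>h\<close>, is a self-embedding for which the
  preimage of \<open>M'\<close> is \<open>M\<close>.\<close>

lemma cxi_shift:
  assumes "X \<subseteq> U" "strong M X" "strong M' X" "M \<subset> M'" "modl h X" "M' \<subseteq> h" "cxi h M h M'"
  shows "\<not> fin X"
proof -
  obtain p where p: "emb p (h - M) (h - M')" "p ` (h - M) = h - M'"
    "\<And>v m n. \<lbrakk>v \<in> h - M; m \<in> M; n \<in> M'\<rbrakk> \<Longrightarrow> e (p v) n = e v m"
    by (rule cxiE[OF assms(7)]) (rule that)
  note d = embD[OF p(1)]
  define f where "f x = (if x \<in> h - M then p x else x)" for x
  have f1: "f x = p x" "f x \<in> h" "f x \<notin> M'" if "x \<in> h - M" for x using that d(2)[OF that] by (auto simp: f_def)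
  have f2: "f x = x" if "x \<notin> h - M" for x using that by (auto simp: f_def)
  have hX: "h \<subseteq> X" using modlD(1) assms(5) by blast
  have k1: "f x \<noteq> f y \<and> e (f x) (f y) = e x y" if "x \<in> h - M" "y \<in> X" "x \<noteq> y" for x y
  proof -
    consider "y \<in> h - M" | "y \<in> M" | "y \<notin> h" by blast
    then show ?thesis
    proof cases
      case 1 then show ?thesis using f1 that d(3,4) by metis
    next
      case 2
      then show ?thesis using f2[of y] f1[OF that(1)] p(3)[OF that(1) 2, of y] assms(4) by auto
    next
      case 3
      then have "e y (f x) = e y x" using modlD(3)[OF assms(5) that(2) 3, of "f x" x] f1[OF that(1)] that by blast
      then show ?thesis using f2[of y] 3 f1(2)[OF that(1)] esym by (metis DiffD1)
    qed
  qed
  have k2: "f x \<noteq> f y \<and> e (f x) (f y) = e x y" if "x \<in> X" "y \<in> X" "x \<noteq> y" for x y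
  proof (cases "x \<in> h - M")
    case True then show ?thesis using k1 that by blast
  next
    case nx: False
    show ?thesis
    proof (cases "y \<in> h - M")
      case True then show ?thesis using k1[of y x] that esym by metis
    next
      case False then show ?thesis using f2 nx that by simp
    qed
  qed
  have fe: "emb f X X"
  proof (rule embI)
    show "inj_on f X" unfolding inj_on_def using k2 by blast
    show "f x \<in> X" if "x \<in> X" for x using that f1(2) f2 hX by (cases "x \<in> h - M") auto
  qed (use k2 in blast)
  have "{x\<in>X. f x \<in> M'} = M"
  proof
    show "{x\<in>X. f x \<in> M'} \<subseteq> M" using f1(3) f2 assms(6) by force
    show "M \<subseteq> {x\<in>X. f x \<in> M'}" using f2 assms(4) strongD(2)[OF assms(2)] by auto
  qed
  then show ?thesis using shift[OF assms(1) fe assms(3)] assms(4) strongD(3)[OF assms(2)] by simp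
qed

lemma hat_in: "M \<in> Eq X M0 \<Longrightarrow> M \<subseteq> hat X M0 M"
  unfolding hat_def by blast

lemma hat_strong: assumes "M \<in> Eq X M0" shows "strong (hat X M0 M) X"
proof -
  obtain x where "x \<in> M" using EqD(5) assms by blast
  then show ?thesis unfolding hat_def
    using strong_Union_chain[of "{M'\<in>Eq X M0. M \<subseteq> M'}" X x] assms EqD(1) by blast
qed

lemma hat_eq: assumes "M \<in> Eq X M0" "M' \<in> Eq X M0" "M \<subseteq> M'" shows "hat X M0 M = hat X M0 M'"
proof
  show "hat X M0 M' \<subseteq> hat X M0 M" unfolding hat_def using assms(3) by blast
  show "hat X M0 M \<subseteq> hat X M0 M'"
  proof
    fix y assume "y \<in> hat X M0 M"
    then obtain N where N: "N \<in> Eq X M0" "M \<subseteq> N" "y \<in> N" unfolding hat_def by blast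
    then have "N \<inter> M' \<noteq> {}" using EqD(5)[OF assms(1)] assms(3) by blast
    then consider "N \<subseteq> M'" | "M' \<subseteq> N" using Eq_cmp[OF N(1) assms(2)] by blast
    then show "y \<in> hat X M0 M'"
    proof cases
      case 1 then show ?thesis using N hat_in[OF assms(2)] by blast
    next
      case 2 then show ?thesis using N unfolding hat_def by blast
    qed
  qed
qed

lemma KK_disjoint:
  assumes "X \<subseteq> U" "fin X" "M0 \<noteq> {}" "M \<in> KK X M0 R0" "N \<in> KK X M0 R0" "M \<noteq> N" shows "M \<inter> N = {}"
proof (rule ccontr)
  have gen: False if "M \<in> KK X M0 R0" "N \<in> KK X M0 R0" "M \<subset> N" for M N
  proof -
    have E: "M \<in> Eq X M0" "N \<in> Eq X M0" using that unfolding KK_def by auto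
    have h: "hat X M0 M = hat X M0 N" using hat_eq[OF E] that(3) by blast
    have "cxi (hat X M0 N) M R0 M0" "cxi (hat X M0 N) N R0 M0" using that h unfolding KK_def by auto
    then have "cxi (hat X M0 N) M (hat X M0 N) N" using cxi_trans cxi_sym assms(3) by blast
    then show False
      using cxi_shift[OF assms(1) EqD(1)[OF E(1)] EqD(1)[OF E(2)] that(3) strongD(1)[OF hat_strong[OF E(2)]] hat_in[OF E(2)]] assms(2)
      by blast
  qed
  assume "M \<inter> N \<noteq> {}"
  moreover have "M \<in> Eq X M0" "N \<in> Eq X M0" using assms unfolding KK_def by auto
  ultimately have "M \<subset> N \<or> N \<subset> M" using Eq_cmp[of M X M0 N] assms(6) by blast
  then show False using gen assms(4,5) by blast
qed

text \<open>Splitting depends only on \<open>S\<close> with \<open>M\<close> contracted: either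
  \<open>r1\<close> stays on one side and can be exchanged for \<open>r2\<close> there, or it is
  cut, and then all of \<open>S - M\<close> is related to \<open>M\<close> by
  \<open>t\<close>.\<close>

lemma disc_rep:
  assumes "modl M S" "M \<subset> S" "r1 \<subseteq> M" "r1 \<noteq> {}" "r2 \<subseteq> M" "r2 \<noteq> {}" "disc t ((S - M) \<union> r1)"
  shows "disc t ((S - M) \<union> r2)"
proof -
  obtain A B where AB: "A \<noteq> {}" "B \<noteq> {}" "A \<inter> B = {}" "A \<union> B = (S - M) \<union> r1" "rel t A B" "rel t B A"
    using assms(7) by (elim discE)
  have uni: "e z m = e z m'" if "z \<in> S - M" "m \<in> M" "m' \<in> M" for z m m' using modlD(3)[OF assms(1)] that by blast
  have one: "disc t ((S - M) \<union> r2)" if h: "r1 \<subseteq> A" "B \<noteq> {}" "A \<inter> B = {}" "A \<union> B = (S - M) \<union> r1" "rel t A B" for A B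
  proof (rule discI[of "(A - r1) \<union> r2" B])
    have BM: "B \<subseteq> S - M" using h assms(3) by blast
    show "rel t (A - r1 \<union> r2) B" unfolding rel_def
    proof (intro ballI)
      fix a b assume a: "a \<in> A - r1 \<union> r2" and b: "b \<in> B"
      obtain x where x: "x \<in> r1" using assms by blast
      show "e a b = t"
      proof (cases "a \<in> A")
        case True then show ?thesis using h(5) b by (auto simp: rel_def)
      next
        case False
        then have "e b a = e b x" using uni[of b a x] a x b BM assms(3,5) by blast
        moreover have "e x b = t" using h(1,5) x b by (auto simp: rel_def)
        ultimately show ?thesis using esym by metis
      qed
    qed
    show "(A - r1 \<union> r2) \<inter> B = {}" using h BM assms(5) by blast
    show "A - r1 \<union> r2 \<union> B = S - M \<union> r2" using h assms(3,5) by blast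
  qed (use h assms in auto)
  show ?thesis
  proof (cases "r1 \<subseteq> A \<or> r1 \<subseteq> B")
    case True
    then show ?thesis
    proof
      assume "r1 \<subseteq> A" then show ?thesis using one[of A B] AB by blast
    next
      assume "r1 \<subseteq> B" then show ?thesis using one[of B A] AB by (simp add: Int_commute Un_commute)
    qed
  next
    case False
    then obtain x y where xy: "x \<in> r1" "x \<in> A" "y \<in> r1" "y \<in> B" using AB(4) by blast
    have "e z m = t" if "z \<in> S - M" "m \<in> r2" for z m
    proof -
      have "z \<in> A \<or> z \<in> B" using that AB(4) by blast
      then have "e z x = t \<or> e z y = t" using AB(5,6) xy by (auto simp: rel_def)
      then show ?thesis using uni[of z m x] uni[of z m y] that xy assms(3,5) by blast
    qed
    then have "rel t (S - M) r2" by (auto simp: rel_def)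
    then show ?thesis by (intro discI[of "S - M" r2]) (use assms in auto)
  qed
qed

text \<open>Members of \<open>Eq\<close> that cut no copy in \<open>K\<close> correspond to the
  saturated members of \<open>Eq\<close> in the new graph, together with their contracted hats. It
  matters that the second part is an equality: no unwanted member of \<open>KK\<close> appears, so
  the replacements can be recovered from the new graph.\<close>

lemma repl:
  assumes XU: "X \<subseteq> U" and fX: "fin X" and nb: "nobranch X M0" and M0: "M0 \<noteq> {}"
    and K: "K = KK X M0 R0"
    and r: "\<And>M. M \<in> K \<Longrightarrow> r M \<subseteq> M" "\<And>M. M \<in> K \<Longrightarrow> eqm (r M) M0" "\<And>M t. M \<in> K \<Longrightarrow> disc t (r M) = disc t M0"
  shows "Rp X K r \<in> Sib X" "KK (Rp X K r) M0 R0 = r ` K"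
proof -
  let ?X = "Rp X K r"
  have KE: "M \<in> Eq X M0" if "M \<in> K" for M using that unfolding K KK_def by blast
  have Ks: "strong M X" if "M \<in> K" for M using EqD(1)[OF KE[OF that]] .
  have Kd: "M \<inter> N = {}" if "M \<in> K" "N \<in> K" "M \<noteq> N" for M N
    using KK_disjoint[OF XU fX M0] that unfolding K by blast
  have rne: "r M \<noteq> {}" if "M \<in> K" for M
    using r(2)[OF that] M0 unfolding eqm_def le_def emb_def by auto
  have disK: "disc t M = disc t M0" if "M \<in> K" for M t using that unfolding K KK_def by blast
  have leK: "le M (r M)" if "M \<in> K" for M
    using EqD(2)[OF KE[OF that]] r(2)[OF that] le_trans unfolding eqm_def by blast
  note fr = Ks Kd r(1) rne
  show XS: "?X \<in> Sib X" using Rp_Sib[of K X r, OF fr] leK by blast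
  have fX': "fin ?X" using fin_Sib fX XS by blast
  have XX: "?X \<subseteq> X" "?X \<subseteq> U" using XS XU unfolding Sib_def by auto
  have rs: "strong (r M) ?X" if "M \<in> K" for M
    using r_strong[of K X r, OF fr that] r(3)[OF that] disK[OF that] by simp
  have Xint: "M \<inter> ?X = r M" if "M \<in> K" for M
    using Rp_int[of K X r M, OF fr that] by blast
  define sa where "sa S = (\<forall>M\<in>K. M \<subseteq> S \<or> S \<inter> M = {})" for S
  have low: "S \<inter> ?X \<in> Eq ?X M0" if S: "S \<in> Eq X M0" "sa S" for S
  proof -
    have "strong (S \<inter> ?X) ?X" using strong_low[of K X r S, OF fr EqD(1)[OF S(1)] _ rs] S(2) sa_def by blast
    moreover have "le S (S \<inter> ?X)" using rep_le[of K X r S, OF fr EqD(4)[OF S(1)] _ leK] S(2) sa_def by blast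
    then have "eqm (S \<inter> ?X) S" using le_refl[of "S \<inter> ?X" S] unfolding eqm_def by blast
    ultimately show ?thesis using EqD(2)[OF S(1)] eqm_trans unfolding Eq_def by blast
  qed
  have upE: "up K r T \<in> Eq X M0 \<and> sa (up K r T) \<and> up K r T \<inter> ?X = T" if T: "T \<in> Eq ?X M0" "sat K r T" for T
  proof -
    have TX: "T \<subseteq> ?X" using EqD(4)[OF T(1)] .
    have 1: "strong (up K r T) X" using strong_up[of K X r T, OF fr EqD(1)[OF T(1)] T(2)] .
    have 2: "up K r T \<inter> ?X = T" using up_int[of K X r T, OF fr TX] .
    have 3: "sa (up K r T)" unfolding sa_def using up_cut[of K X r T, OF fr TX T(2)] by blast
    have "le (up K r T) T" using rep_le[of K X r "up K r T", OF fr strongD(2)[OF 1] _ leK] 2 3 unfolding sa_def by simp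
    then have "eqm (up K r T) T" using le_refl[of T "up K r T"] 2 unfolding eqm_def by blast
    then show ?thesis using 1 2 3 EqD(2)[OF T(1)] eqm_trans unfolding Eq_def by blast
  qed
  have sat_or: "sat K r T \<or> (\<exists>M\<in>K. T \<subset> r M)" if "T \<in> Eq ?X M0" for T
    using sat_cases[of K X r T, OF fr EqD(1)[OF that]] .
  have hatlow: "hat ?X M0 (S \<inter> ?X) = hat X M0 S \<inter> ?X" if S: "S \<in> Eq X M0" "sa S" for S
  proof
    show "hat X M0 S \<inter> ?X \<subseteq> hat ?X M0 (S \<inter> ?X)"
    proof
      fix y assume y: "y \<in> hat X M0 S \<inter> ?X"
      then obtain S' where S': "S' \<in> Eq X M0" "S \<subseteq> S'" "y \<in> S'" unfolding hat_def by blast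
      have "sa S'" unfolding sa_def
      proof
        fix M assume M: "M \<in> K"
        show "M \<subseteq> S' \<or> S' \<inter> M = {}"
        proof (rule ccontr)
          assume c: "\<not> ?thesis"
          then have "S' \<subseteq> M" using Eq_cmp[OF S'(1) KE[OF M]] by blast
          then have "M \<subseteq> S" using S(2) M S'(2) EqD(5)[OF S(1)] unfolding sa_def by blast
          then show False using c S'(2) by blast
        qed
      qed
      then have "S' \<inter> ?X \<in> Eq ?X M0" using low S' by blast
      then show "y \<in> hat ?X M0 (S \<inter> ?X)" using S' y unfolding hat_def by blast
    qed
    show "hat ?X M0 (S \<inter> ?X) \<subseteq> hat X M0 S \<inter> ?X"
    proof
      fix y assume "y \<in> hat ?X M0 (S \<inter> ?X)"
      then obtain T where T: "T \<in> Eq ?X M0" "S \<inter> ?X \<subseteq> T" "y \<in> T" unfolding hat_def by blast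
      have Sne: "S \<inter> ?X \<noteq> {}" using EqD(5)[OF low[OF S]] .
      have satT: "sat K r T"
      proof (rule ccontr)
        assume "\<not> sat K r T"
        then obtain M where M: "M \<in> K" "T \<subset> r M" using sat_or[OF T(1)] by blast
        then have "S \<inter> M \<noteq> {}" using T(2) Sne r(1)[OF M(1)] by blast
        then have "M \<subseteq> S" using S(2) M(1) unfolding sa_def by blast
        then show False using Xint[OF M(1)] T(2) M(2) by blast
      qed
      note u = upE[OF T(1) satT]
      have "S \<subseteq> up K r T"
      proof
        fix x assume x: "x \<in> S"
        show "x \<in> up K r T"
        proof (cases "\<exists>M\<in>K. x \<in> M")
          case True
          then obtain M where M: "M \<in> K" "x \<in> M" by blast
          then have "M \<subseteq> S" using S(2) x unfolding sa_def by blast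
          then have "r M \<subseteq> T" using Xint[OF M(1)] T(2) by blast
          then show ?thesis using up_in[of K X r M T x, OF fr M(1) _ M(2)] by blast
        next
          case False
          then have "x \<in> ?X" using Rp_in[of K X r x, OF fr] x EqD(4)[OF S(1)] by blast
          then show ?thesis using x T(2) u by blast
        qed
      qed
      then have "y \<in> hat X M0 S" using u T(3) unfolding hat_def by blast
      then show "y \<in> hat X M0 S \<inter> ?X" using T EqD(4)[OF T(1)] by blast
    qed
  qed
  \<comment> \<open>If a copy in \<open>K\<close> meets \<open>hat X M0 S - S\<close>, it is
    comparable with a member of \<open>Eq\<close> above \<open>S\<close>; by \<open>nobranch\<close>
    it meets \<open>S\<close> itself and so lies inside \<open>S\<close>. Hence nothing is replaced
    between \<open>S\<close> and its hat.\<close>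
  have hatout: "y \<in> ?X" if y: "y \<in> hat X M0 S" "y \<notin> S" and S: "S \<in> Eq X M0" "sa S" for y S
  proof (rule Rp_in[of K X r y, OF fr])
    show "y \<in> X" using y strongD(2)[OF hat_strong[OF S(1)]] by blast
    fix M assume M: "M \<in> K" "y \<in> M"
    obtain S' where S': "S' \<in> Eq X M0" "S \<subseteq> S'" "y \<in> S'" using y unfolding hat_def by blast
    have "M \<subseteq> S' \<or> S' \<subseteq> M" using Eq_cmp[OF KE[OF M(1)] S'(1)] S' M by blast
    then have "M \<inter> S \<noteq> {}"
    proof
      assume "M \<subseteq> S'" then show ?thesis using nb KE[OF M(1)] S S' unfolding nobranch_def by blast
    next
      assume "S' \<subseteq> M" then show ?thesis using S' EqD(5)[OF S(1)] by blast
    qed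
    then have "M \<subseteq> S" using S(2) M(1) unfolding sa_def by blast
    then show "y \<in> r M" using M y by blast
  qed
  have cxl: "cxi (hat ?X M0 (S \<inter> ?X)) (S \<inter> ?X) R0 M0 = cxi (hat X M0 S) S R0 M0" if S: "S \<in> Eq X M0" "sa S" for S
  proof -
    have d: "hat ?X M0 (S \<inter> ?X) - S \<inter> ?X = hat X M0 S - S"
      unfolding hatlow[OF S] using hatout[OF _ _ S] by blast
    have u: "e v m = e v m'" if "v \<in> hat X M0 S - S" "m \<in> S" "m' \<in> S" for v m m'
      using strongD(4)[OF EqD(1)[OF S(1)], of v m m'] that strongD(2)[OF hat_strong[OF S(1)]] by blast
    show ?thesis
    proof
      assume "cxi (hat X M0 S) S R0 M0"
      from cxi_base[OF this d] show "cxi (hat ?X M0 (S \<inter> ?X)) (S \<inter> ?X) R0 M0" using u EqD(5)[OF S(1)] by blast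
    next
      assume "cxi (hat ?X M0 (S \<inter> ?X)) (S \<inter> ?X) R0 M0"
      from cxi_base[OF this d[symmetric]] show "cxi (hat X M0 S) S R0 M0" using u d EqD(5)[OF low[OF S]] by blast
    qed
  qed
  have saM: "sa M" if "M \<in> K" for M using Kd[OF that] unfolding sa_def by blast
  have sup: "r M \<in> KK ?X M0 R0" if M: "M \<in> K" for M
  proof -
    have cK: "cxi (hat X M0 M) M R0 M0" using M unfolding K KK_def by blast
    have "r M \<in> Eq ?X M0" using rs[OF M] r(2)[OF M] unfolding Eq_def by blast
    moreover have "cxi (hat ?X M0 (r M)) (r M) R0 M0"
      using cxl[OF KE[OF M] saM[OF M]] cK Xint[OF M] by simp
    ultimately show ?thesis using r(3)[OF M] unfolding KK_def by blast
  qed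
  show "KK ?X M0 R0 = r ` K"
  proof
    show "r ` K \<subseteq> KK ?X M0 R0" using sup by blast
    show "KK ?X M0 R0 \<subseteq> r ` K"
    proof
      fix T assume TK: "T \<in> KK ?X M0 R0"
      then have T: "T \<in> Eq ?X M0" "\<And>t. disc t T = disc t M0" "cxi (hat ?X M0 T) T R0 M0" unfolding KK_def by auto
      have satT: "sat K r T"
      proof (rule ccontr)
        assume "\<not> sat K r T"
        then obtain M where M: "M \<in> K" "T \<subset> r M" using sat_or[OF T(1)] by blast
        have "T \<inter> r M = {}" using KK_disjoint[OF XX(2) fX' M0 TK sup[OF M(1)]] M(2) by blast
        then show False using M(2) EqD(5)[OF T(1)] by blast
      qed
      define S where "S = up K r T"
      have S: "S \<in> Eq X M0" "sa S" "S \<inter> ?X = T" using upE[OF T(1) satT] unfolding S_def by auto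
      have cS: "cxi (hat X M0 S) S R0 M0" using cxl[OF S(1,2)] T(3) S(3) by simp
      show "T \<in> r ` K"
      proof (cases "\<exists>M\<in>K. M \<subseteq> S")
        case True
        then obtain M where M: "M \<in> K" "M \<subseteq> S" by blast
        show ?thesis
        proof (cases "M = S")
          case True then show ?thesis using Xint[OF M(1)] S(3) M(1) by blast
        next
          case False
          then have MS: "M \<subset> S" using M by blast
          \<comment> \<open>By \<open>nobranch\<close>, \<open>M\<close> is the only copy in
            \<open>K\<close> contained in the larger \<open>S\<close>. The types of \<open>T\<close>
            and \<open>S\<close> agree by \<open>disc_rep\<close>, so \<open>S\<close> would belong
            to \<open>K\<close> as well, although it properly contains \<open>M\<close>.\<close>
          have "N = M" if N: "N \<in> K" "S \<inter> N \<noteq> {}" for N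
          proof -
            have "N \<subseteq> S" using S(2) N unfolding sa_def by blast
            then have "N \<inter> M \<noteq> {}" using nb KE[OF N(1)] KE[OF M(1)] S(1) M(2) unfolding nobranch_def by blast
            then show ?thesis using Kd[OF N(1) M(1)] by blast
          qed
          then have "S - M \<subseteq> ?X" using Rp_in[of K X r, OF fr] EqD(4)[OF S(1)] by blast
          then have TS: "T = (S - M) \<union> r M" using S(3) Xint[OF M(1)] M(2) by blast
          have mS: "modl M S" using modl_sub[OF EqD(3)[OF KE[OF M(1)]] M(2) EqD(4)[OF S(1)]] .
          have SS: "(S - M) \<union> M = S" using M(2) by blast
          have "disc t T = disc t S" for t
            using disc_rep[OF mS MS r(1)[OF M(1)] rne[OF M(1)] order_refl EqD(5)[OF KE[OF M(1)]], of t]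
              disc_rep[OF mS MS order_refl EqD(5)[OF KE[OF M(1)]] r(1)[OF M(1)] rne[OF M(1)], of t] unfolding TS SS by blast
          then have "S \<in> K" using S cS T(2) unfolding K KK_def by blast
          then show ?thesis using Kd[OF M(1), of S] MS EqD(5)[OF KE[OF M(1)]] by blast
        qed
      next
        case False
        then have "S \<inter> M = {}" if "M \<in> K" for M using S(2) that unfolding sa_def by blast
        then have "S \<subseteq> ?X" using Rp_in[of K X r, OF fr] EqD(4)[OF S(1)] by blast
        then have "T = S" using S(3) by blast
        then have "S \<in> K" using S cS T(2) unfolding K KK_def by blast
        then show ?thesis using False by blast
      qed
    qed
  qed
qed

lemma Eq_img:
  assumes "emb f X Y" "f ` X = Y" "M \<in> Eq X M0" shows "f ` M \<in> Eq Y M0"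
proof -
  have "ism M (f ` M)" using emb_ism[OF assms(1) EqD(4)[OF assms(3)]] .
  then have "eqm (f ` M) M0" using ism_eqm EqD(2)[OF assms(3)] eqm_sym eqm_trans by blast
  then show ?thesis using strong_img[OF assms(1,2) EqD(1)[OF assms(3)]] unfolding Eq_def by blast
qed

lemma hat_img:
  assumes "emb f X Y" "f ` X = Y" "M \<in> Eq X M0" shows "hat Y M0 (f ` M) = f ` hat X M0 M"
proof
  note d = embD[OF assms(1)]
  let ?g = "the_inv_into X f"
  have g: "emb ?g Y X" using emb_inv[OF assms(1)] assms(2) by simp
  have g2: "?g ` Y = X" using the_inv_into_onto[OF d(1)] assms(2) by simp
  show "f ` hat X M0 M \<subseteq> hat Y M0 (f ` M)" using Eq_img[OF assms(1,2)] unfolding hat_def by blast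
  show "hat Y M0 (f ` M) \<subseteq> f ` hat X M0 M"
  proof
    fix y assume "y \<in> hat Y M0 (f ` M)"
    then obtain T where T: "T \<in> Eq Y M0" "f ` M \<subseteq> T" "y \<in> T" unfolding hat_def by blast
    have TY: "T \<subseteq> f ` X" using EqD(4)[OF T(1)] assms(2) by blast
    have "?g ` T \<in> Eq X M0" using Eq_img[OF g g2 T(1)] .
    moreover have "M \<subseteq> ?g ` T"
    proof
      fix m assume m: "m \<in> M"
      then have "?g (f m) = m" using the_inv_into_f_f[OF d(1)] EqD(4)[OF assms(3)] by blast
      then show "m \<in> ?g ` T" using m T(2) by force
    qed
    moreover have "f (?g y) = y" using f_the_inv_into_f[OF d(1)] T(3) TY by blast
    ultimately show "y \<in> f ` hat X M0 M" using T(3) unfolding hat_def by force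
  qed
qed

lemma KK_img:
  assumes "emb f X Y" "f ` X = Y" "M \<in> KK X M0 R0" shows "f ` M \<in> KK Y M0 R0"
proof -
  note d = embD[OF assms(1)]
  have M: "M \<in> Eq X M0" "\<And>t. disc t M = disc t M0" "cxi (hat X M0 M) M R0 M0" using assms(3) unfolding KK_def by auto
  let ?h = "hat X M0 M"
  have hX: "?h \<subseteq> X" "M \<subseteq> ?h" using strongD(2)[OF hat_strong[OF M(1)]] hat_in[OF M(1)] by auto
  have dif: "f ` ?h - f ` M = f ` (?h - M)" using inj_on_image_set_diff[OF d(1), of ?h M] hX by blast
  have "cxi ?h M (f ` ?h) (f ` M)"
  proof (rule cxiI[of f])
    show "emb f (?h - M) (f ` ?h - f ` M)" unfolding dif using emb_image[OF assms(1)] hX by blast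
    show "f ` (?h - M) = f ` ?h - f ` M" using dif by simp
    fix v m n assume v: "v \<in> ?h - M" "m \<in> M" "n \<in> f ` M"
    then obtain n' where n': "n = f n'" "n' \<in> M" by blast
    have "e (f v) (f n') = e v n'" using d(3)[of v n'] v n' hX by blast
    moreover have "e v n' = e v m" using strongD(4)[OF EqD(1)[OF M(1)], of v n' m] v n' hX by blast
    ultimately show "e (f v) n = e v m" using n' by simp
  qed
  then have "cxi (f ` ?h) (f ` M) R0 M0" using cxi_sym cxi_trans M(3) EqD(5)[OF M(1)] by blast
  moreover have "disc t (f ` M) = disc t M0" for t
    using disc_emb_img[OF emb_image[OF assms(1) EqD(4)[OF M(1)]], of t] M(2) by simp
  ultimately show ?thesis using Eq_img[OF assms(1,2) M(1)] hat_img[OF assms(1,2) M(1)] unfolding KK_def by simp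
qed

section \<open>Softness\<close>

lemma rep_Sib:
  assumes M: "modl M X" and A: "A \<in> Sib M" shows "(X - M) \<union> A \<in> Sib X"
proof -
  obtain f where f: "emb f M A" and AM: "A \<subseteq> M" using A unfolding Sib_def le_def by blast
  define F where "F x = (if x \<in> M then f x else x)" for x
  have F1: "F x = f x" "F x \<in> A" "F x \<in> M" if "x \<in> M" for x using that embD(2)[OF f that] AM by (auto simp: F_def)
  have F2: "F x = x" if "x \<notin> M" for x using that by (auto simp: F_def)
  have k: "F x \<noteq> F y \<and> e (F x) (F y) = e x y" if xy: "x \<in> X" "y \<in> X" "x \<noteq> y" for x y
  proof (cases "x \<in> M")
    case x: True
    show ?thesis
    proof (cases "y \<in> M")
      case True then show ?thesis using F1 x embD(3,4)[OF f] xy by metis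
    next
      case False
      then have "e y (F x) = e y x" using modlD(3)[OF M xy(2) False F1(3)[OF x] x] by simp
      then show ?thesis using F2[OF False] F1(3)[OF x] False esym by metis
    qed
  next
    case x: False
    show ?thesis
    proof (cases "y \<in> M")
      case True
      then have "e x (F y) = e x y" using modlD(3)[OF M xy(1) x F1(3)[OF True] True] by simp
      then show ?thesis using F2[OF x] F1(3)[OF True] x by auto
    next
      case False then show ?thesis using F2 x xy by simp
    qed
  qed
  have "emb F X ((X - M) \<union> A)"
  proof (rule embI)
    show "inj_on F X" unfolding inj_on_def using k by blast
    show "F x \<in> (X - M) \<union> A" if "x \<in> X" for x using that F1(2) F2 by (cases "x \<in> M") auto
  qed (use k in blast)
  moreover have "(X - M) \<union> A \<subseteq> X" using AM modlD(1)[OF M] by blast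
  ultimately show ?thesis using SibI by blast
qed

text \<open>For the value \<open>\<not> t\<close>, \<open>u\<close> is a common neighbour of
  \<open>v\<close> and \<open>k v\<close> (\<open>dist2\<close>). The image of \<open>k\<close>
  avoids all these common neighbours and does not split, so it lies in one component of the rest,
  and \<open>u\<close> is adjacent to this whole component (\<open>common_complete\<close>).\<close>

lemma soft_dominator:
  assumes "N \<subseteq> U" "\<not> disc t N" "emb k N N" "v \<in> N" "v \<notin> k ` N" "rel t {v} (k ` N)"
  obtains u where "u \<in> N" "u \<noteq> v" "u \<notin> k ` N" "e u v = (\<not> t)" "rel (\<not> t) {u} (k ` N)"
proof -
  let ?A = "k ` N"
  define x where "x = k v"
  have x: "x \<in> ?A" "x \<in> N" "x \<noteq> v" using assms(4,5) embD(2)[OF assms(3,4)] imageI[OF assms(4), of k] unfolding x_def by metis+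
  have xv: "e x v = t" using assms(6) x esym[of x v] by (auto simp: rel_def)
  define D where "D = {d\<in>N. d \<noteq> x \<and> d \<noteq> v \<and> e d x = (\<not> t) \<and> e d v = (\<not> t)}"
  obtain u where u: "u \<in> D" using dist2[OF assms(1,2) x(2) assms(4) x(3) xv] D_def by blast
  have AD: "?A \<subseteq> N - D"
  proof
    fix a assume a: "a \<in> ?A"
    then have "e a v = t" using assms(6) esym[of a v] by (auto simp: rel_def)
    then show "a \<in> N - D" using a embD(2)[OF assms(3)] unfolding D_def by auto
  qed
  have "\<not> disc t ?A" using disc_emb_img[OF assms(3)] assms(2) by simp
  then have Ac: "?A \<subseteq> cpt t (N - D) x" using cpt_max[of x "N - D" ?A t] AD x(1) by blast
  have "e u a = (\<not> t)" if "a \<in> ?A" for a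
    using common_complete(2)[OF assms(1) x(2) assms(4) x(3) xv D_def u, of x a] AD Ac x(1) that u unfolding D_def by blast
  then have "rel (\<not> t) {u} ?A" by (auto simp: rel_def)
  then show ?thesis using that[of u] u AD unfolding D_def by blast
qed

text \<open>The orbits of \<open>u\<close> and \<open>v\<close> under \<open>k\<close> are
  interleaved. Everything after the \<open>m\<close>-th pair lies in the image of \<open>N\<close>
  under the iterate of order \<open>m + 1\<close>, to which the two members of that pair are related
  by \<open>\<not> t\<close> and by \<open>t\<close>.\<close>

lemma thin_seq:
  assumes "N \<subseteq> U" "\<not> disc t N" "emb k N N" "v \<in> N" "v \<notin> k ` N" "rel t {v} (k ` N)"
  obtains c :: "nat \<Rightarrow> 'a" where "\<And>n. c n \<in> N" "\<And>i j. i < j \<Longrightarrow> c i \<noteq> c j \<and> e (c i) (c j) = (t = odd i)"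
proof -
  obtain u where u: "u \<in> N" "u \<noteq> v" "u \<notin> k ` N" "e u v = (\<not> t)" "rel (\<not> t) {u} (k ` N)"
    using soft_dominator[OF assms] by blast
  define w where "w n = (if even n then u else v)" for n :: nat
  define c where "c n = (k ^^ (n div 2)) (w n)" for n
  have wN: "w n \<in> N" for n using u assms by (simp add: w_def)
  note kp = emb_funpow[OF assms(3)]
  have cN: "c n \<in> N" for n unfolding c_def using embD(2)[OF kp] wN by blast
  have "c i \<noteq> c j \<and> e (c i) (c j) = (t = odd i)" if ij: "i < j" for i j
  proof -
    define a where "a = i div 2"
    define y where "y = (k ^^ (j div 2 - a)) (w j)"
    have le: "a \<le> j div 2" using ij unfolding a_def by (simp add: div_le_mono)
    have "(k ^^ (j div 2)) (w j) = (k ^^ a) y" unfolding y_def using le by (metis funpow_add le_add_diff_inverse o_apply)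
    then have cj: "c j = (k ^^ a) y" by (simp add: c_def)
    have ci: "c i = (k ^^ a) (w i)" by (simp add: c_def a_def)
    have yN: "y \<in> N" unfolding y_def using embD(2)[OF kp] wN by blast
    have key: "w i \<noteq> y \<and> e (w i) y = (t = odd i)"
    proof (cases "j div 2 = a")
      case True
      then have "i mod 2 = 0" "j mod 2 = 1"
        using ij div_mult_mod_eq[of i 2] div_mult_mod_eq[of j 2] mod_less_divisor[of 2 i] mod_less_divisor[of 2 j]
        unfolding a_def by linarith+
      then have "even i" "odd j" by (auto simp: even_iff_mod_2_eq_zero)
      then show ?thesis using True u(2,4) unfolding y_def w_def by simp
    next
      case False
      then obtain m where m: "j div 2 - a = Suc m" using le by (metis Suc_pred diff_is_0_eq le_antisym not_gr_zero)
      have "y = k ((k ^^ m) (w j))" unfolding y_def m by simp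
      then have yk: "y \<in> k ` N" using embD(2)[OF kp] wN by blast
      then show ?thesis using u assms(5,6) unfolding w_def by (auto simp: rel_def)
    qed
    then show ?thesis using embD(3,4)[OF kp[of a] wN[of i] yN] ci cj by metis
  qed
  then show ?thesis using that cN by blast
qed

text \<open>A copy of \<open>N\<close> with two disjoint copies inside embeds back into
  \<open>N\<close>, so \<open>N\<close> contains two uniformly related copies, the images of
  \<open>f1\<close> and \<open>f\<close>. The first makes \<open>B\<close> a sibling; the second
  provides room for arbitrary blocks of the sequence \<open>c\<close>.\<close>

lemma branch_not_fin:
  assumes XU: "X \<subseteq> U" and N: "strong N X" and soft: "\<not> disc t N" "emb k N N" "v \<in> N" "v \<notin> k ` N" "rel t {v} (k ` N)"
    and br: "\<not> nobranch X N"
  shows "\<not> fin X"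
proof (rule not_fin_pattern[OF XU])
  fix b :: "nat \<Rightarrow> bool"
  have NX: "N \<subseteq> X" using strongD(2)[OF N] .
  obtain c :: "nat \<Rightarrow> 'a" where c: "\<And>n. c n \<in> N" "\<And>i j. i < j \<Longrightarrow> c i \<noteq> c j \<and> e (c i) (c j) = (t = odd i)"
    by (rule thin_seq[OF subset_trans[OF NX XU] soft]) (rule that)
  obtain M1 M2 M where M: "M1 \<in> Eq X N" "M2 \<in> Eq X N" "M \<in> Eq X N" "M1 \<subseteq> M" "M2 \<subseteq> M" "M1 \<inter> M2 = {}"
    using br unfolding nobranch_def by blast
  obtain s where s: "rel s M1 M2"
    using modl_rel[OF EqD(3)[OF M(1)] EqD(3)[OF M(2)] M(6)] EqD(5)[OF M(1)] EqD(5)[OF M(2)] by blast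
  obtain i j1 j2 where ij: "emb i M N" "emb j1 N M1" "emb j2 N M2"
    using EqD(2)[OF M(1)] EqD(2)[OF M(2)] EqD(2)[OF M(3)] unfolding eqm_def le_def by blast
  have j1M: "emb j1 N M" "emb j2 N M" using emb_mono ij M(4,5) by blast+
  define f where "f = i \<circ> j2"
  define f1 where "f1 = i \<circ> j1"
  have f: "emb f N N" "emb f1 N N" unfolding f_def f1_def using emb_comp ij j1M by blast+
  have cross: "e (f1 x) (f y) = s \<and> f1 x \<noteq> f y" if "x \<in> N" "y \<in> N" for x y
  proof -
    have 1: "j1 x \<in> M1" "j2 y \<in> M2" using embD(2)[OF ij(2) that(1)] embD(2)[OF ij(3) that(2)] .
    then have 2: "j1 x \<in> M" "j2 y \<in> M" using M(4,5) by blast+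
    have 3: "j1 x \<noteq> j2 y" using 1 M(6) by (metis disjoint_iff)
    show ?thesis using embD(3,4)[OF ij(1) 2] 3 relD[OF s 1] unfolding f_def f1_def by auto
  qed
  have cneq: "c i \<noteq> c j" if "i \<noteq> j" for i j using c(2)[of i j] c(2)[of j i] that by (metis nat_neq_iff)
  \<comment> \<open>Block \<open>s\<close> may use the indices from \<open>4 * s\<close> to
    \<open>4 * s + 3\<close> with the parity of \<open>s\<close>. There are two of them, and the
    second one is taken iff the bit is \<open>False\<close>.\<close>
  define D where "D s = {c (4 * s + s mod 2)} \<union> (if \<not> b (s div 4) then {c (4 * s + 2 + s mod 2)} else {})" for s
  have DN: "D s \<subseteq> N" for s using c(1) unfolding D_def by auto
  have Dc: "\<exists>m. x = c m \<and> 4 * s \<le> m \<and> m < 4 * s + 4 \<and> (odd m = odd s)" if "x \<in> D s" for x s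
  proof -
    have "s mod 2 \<le> 1" "odd (s mod 2) = odd s" by auto
    then have "4 * s + s mod 2 < 4 * s + 4" "4 * s + 2 + s mod 2 < 4 * s + 4" by linarith+
    moreover have "odd (4 * s + s mod 2) = odd s" "odd (4 * s + 2 + s mod 2) = odd s" by auto
    moreover have "x = c (4 * s + s mod 2) \<or> x = c (4 * s + 2 + s mod 2)" using that unfolding D_def by (auto split: if_splits)
    ultimately show ?thesis by (metis add.assoc le_add1)
  qed
  have Drel: "x \<noteq> y \<and> e x y = (t = odd s)" if xy: "x \<in> D s" "y \<in> D s'" "s < s'" for x y s s'
  proof -
    obtain m where m: "x = c m" "m < 4 * s + 4" "odd m = odd s" using Dc[OF xy(1)] by blast
    obtain m' where m': "y = c m'" "4 * s' \<le> m'" using Dc[OF xy(2)] by blast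
    have "m < m'" using m m' xy(3) by linarith
    then show ?thesis using c(2)[of m m'] m m' by simp
  qed
  have Dhom: "e x y = (t = odd s)" if xy: "x \<in> D s" "y \<in> D s" "x \<noteq> y" for x y s
  proof -
    obtain m where m: "x = c m" "odd m = odd s" using Dc[OF xy(1)] by blast
    obtain m' where m': "y = c m'" "odd m' = odd s" using Dc[OF xy(2)] by blast
    have "m \<noteq> m'" using m m' xy(3) by blast
    then consider "m < m'" | "m' < m" by linarith
    then show ?thesis
    proof cases
      case 1 then show ?thesis using c(2)[of m m'] m m' by simp
    next
      case 2 then show ?thesis using c(2)[of m' m] m m' esym[of x y] by simp
    qed
  qed
  define T where "T n = (\<Union>s\<in>{n..}. D s)" for n
  define Q where "Q n = f ` T n" for n
  define B where "B = (X - N) \<union> f1 ` N \<union> Q 0"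
  have TN: "T n \<subseteq> N" for n using DN unfolding T_def by blast
  have T0: "T n \<subseteq> T 0" for n unfolding T_def by auto
  have Dne: "D s \<noteq> {}" for s unfolding D_def by simp
  have Tdif: "T n - T (Suc n) = D n" for n
  proof -
    have "{n..} = insert n {Suc n..}" by auto
    then have "T n = D n \<union> T (Suc n)" unfolding T_def by simp
    moreover have "D n \<inter> T (Suc n) = {}"
    proof -
      have "x \<noteq> y" if "x \<in> D n" "y \<in> T (Suc n)" for x y
        using that Drel[of x n y] unfolding T_def by (auto simp: Suc_le_eq)
      then show ?thesis by blast
    qed
    ultimately show ?thesis by blast
  qed
  have Tsub: "T (Suc n) \<subseteq> T n" for n unfolding T_def by (rule UN_mono) auto
  have finj: "inj_on f N" using embD(1)[OF f(1)] .
  have Qdif: "Q n - Q (Suc n) = f ` D n" for n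
    using inj_on_image_set_diff[OF finj, of "T n" "T (Suc n)"] TN[of n] TN[of "Suc n"] Tdif[of n] unfolding Q_def by auto
  have BX: "B \<subseteq> X" using embD(2)[OF f(1)] embD(2)[OF f(2)] NX TN[of 0] unfolding B_def Q_def by auto
  have BS: "B \<in> Sib X"
  proof (rule Sib_between[OF rep_Sib[OF strongD(1)[OF N]] _ BX])
    show "f1 ` N \<in> Sib N" using SibI[OF _ emb_image[OF f(2)]] embD(2)[OF f(2)] by blast
  qed (auto simp: B_def)
  have eF: "e (f x) (f y) = e x y" if "x \<in> N" "y \<in> N" "x \<noteq> y" for x y using embD(3)[OF f(1)] that by blast
  have "dnch B Q (\<not> t)" unfolding dnch_def
  proof (intro allI conjI)
    fix n
    have "Q (Suc n) \<subseteq> Q n" unfolding Q_def by (rule image_mono[OF Tsub])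
    moreover have "Q n - Q (Suc n) \<noteq> {}" using Qdif[of n] Dne[of n] by simp
    ultimately show "Q (Suc n) \<subset> Q n" by blast
    show "modl (Q n) B"
    proof (rule modlI)
      show "Q n \<subseteq> B" using T0[of n] unfolding B_def Q_def by blast
      have "D n \<subseteq> T n" unfolding T_def by auto
      then show "Q n \<noteq> {}" using Dne[of n] unfolding Q_def by blast
      fix z x y assume z: "z \<in> B" "z \<notin> Q n" and xy: "x \<in> Q n" "y \<in> Q n"
      have QN: "Q n \<subseteq> N" using TN embD(2)[OF f(1)] unfolding Q_def by blast
      consider "z \<in> X - N" | "z \<in> f1 ` N" | "z \<in> Q 0" using z B_def by blast
      then show "e z x = e z y"
      proof cases
        case 1 then show ?thesis using strongD(4)[OF N, of z x y] xy QN by blast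
      next
        case 2
        have "e z w = s" if "w \<in> Q n" for w using 2 that cross TN unfolding Q_def by blast
        then show ?thesis using xy by simp
      next
        case 3
        then obtain z' m where z': "z = f z'" "z' \<in> D m" unfolding Q_def T_def by blast
        have mn: "m < n" using z z' unfolding Q_def T_def by (meson UN_I atLeast_iff imageI not_less)
        have "e z w = (t = odd m)" if w: "w \<in> Q n" for w
        proof -
          obtain w' m' where w': "w = f w'" "w' \<in> D m'" "n \<le> m'" using w unfolding Q_def T_def by auto
          have "m < m'" using mn w'(3) by simp
          then show ?thesis using Drel[OF z'(2) w'(2)] eF[of z' w'] DN z' w' by auto
        qed
        then show ?thesis using xy by simp
      qed
    qed
    have par: "((\<not> t) = even n) = (t = odd n)" by auto
    show "rel ((\<not> t) = even n) (Q n - Q (Suc n)) (Q (Suc n))" unfolding rel_def Qdif par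
    proof (intro ballI)
      fix x y assume "x \<in> f ` D n" "y \<in> Q (Suc n)"
      then obtain x' y' m where *: "x = f x'" "x' \<in> D n" "y = f y'" "y' \<in> D m" "Suc n \<le> m" unfolding Q_def T_def by auto
      then have "n < m" by simp
      then show "e x y = (t = odd n)" using Drel[OF *(2,4)] eF[of x' y'] DN * by auto
    qed
    show "\<forall>x\<in>Q n - Q (Suc n). \<forall>y\<in>Q n - Q (Suc n). x \<noteq> y \<longrightarrow> e x y = ((\<not> t) = even n)" unfolding Qdif par
    proof (intro ballI impI)
      fix x y assume "x \<in> f ` D n" "y \<in> f ` D n" "x \<noteq> y"
      then obtain x' y' where *: "x = f x'" "x' \<in> D n" "y = f y'" "y' \<in> D n" "x' \<noteq> y'" by auto
      then show "e x y = (t = odd n)" using Dhom[OF *(2,4,5)] eF[of x' y'] DN by auto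
    qed
  qed
  then have pI: "(\<lambda>n. card (Q (Suc n) - Q (Suc (Suc n))) = 1) \<in> Inv B" unfolding Inv_def by blast
  have cI: "(card (Q (Suc (4 * i)) - Q (Suc (Suc (4 * i)))) = 1) = b i" for i
  proof -
    let ?s = "Suc (4 * i)"
    have "card (f ` D ?s) = card (D ?s)" using card_image[OF inj_on_subset[OF finj DN]] .
    moreover have "?s div 4 = i" by simp
    moreover have "c (4 * ?s + ?s mod 2) \<noteq> c (4 * ?s + 2 + ?s mod 2)" by (rule cneq) simp
    ultimately show ?thesis unfolding Qdif by (auto simp: D_def card_insert_if)
  qed
  show "\<exists>B\<in>Sib X. \<exists>p\<in>Inv B. \<forall>i. p (4 * i) = b i"
    by (rule bexI[OF _ BS], rule bexI[OF _ pI], rule allI, rule cI)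
qed

lemma isolated_card:
  assumes "ism A B"
  shows "card {z\<in>A. \<forall>y\<in>A. y \<noteq> z \<longrightarrow> e z y = t} = card {z\<in>B. \<forall>y\<in>B. y \<noteq> z \<longrightarrow> e z y = t}"
proof -
  obtain f where f: "emb f A B" "f ` A = B" using assms unfolding ism_def by blast
  note d = embD[OF f(1)]
  have "f ` {z\<in>A. \<forall>y\<in>A. y \<noteq> z \<longrightarrow> e z y = t} = {z\<in>B. \<forall>y\<in>B. y \<noteq> z \<longrightarrow> e z y = t}"
  proof
    show "f ` {z\<in>A. \<forall>y\<in>A. y \<noteq> z \<longrightarrow> e z y = t} \<subseteq> {z\<in>B. \<forall>y\<in>B. y \<noteq> z \<longrightarrow> e z y = t}"
    proof
      fix z assume "z \<in> f ` {z\<in>A. \<forall>y\<in>A. y \<noteq> z \<longrightarrow> e z y = t}"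
      then obtain x where x: "x \<in> A" "z = f x" "\<And>y. y \<in> A \<Longrightarrow> y \<noteq> x \<Longrightarrow> e x y = t" by blast
      have "e z y = t" if yB: "y \<in> B" "y \<noteq> z" for y
      proof -
        obtain y' where y': "y' \<in> A" "y = f y'" using yB(1) f(2) by blast
        then have "y' \<noteq> x" using yB(2) x(2) by blast
        then show ?thesis using d(3)[OF x(1) y'(1)] x y' by metis
      qed
      then show "z \<in> {z\<in>B. \<forall>y\<in>B. y \<noteq> z \<longrightarrow> e z y = t}" using x f(2) by blast
    qed
    show "{z\<in>B. \<forall>y\<in>B. y \<noteq> z \<longrightarrow> e z y = t} \<subseteq> f ` {z\<in>A. \<forall>y\<in>A. y \<noteq> z \<longrightarrow> e z y = t}"
    proof
      fix z assume z: "z \<in> {z\<in>B. \<forall>y\<in>B. y \<noteq> z \<longrightarrow> e z y = t}"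
      then obtain x where x: "x \<in> A" "z = f x" using f(2) by blast
      have "e x y = t" if "y \<in> A" "y \<noteq> x" for y
        using z x d(2)[OF that(1)] d(3)[of x y] d(4)[OF that(1) x(1)] that by auto
      then show "z \<in> f ` {z\<in>A. \<forall>y\<in>A. y \<noteq> z \<longrightarrow> e z y = t}" using x by blast
    qed
  qed
  then show ?thesis using card_image[OF inj_on_subset[OF d(1)]] by (metis (mono_tags, lifting) mem_Collect_eq subsetI)
qed

text \<open>The hull \<open>W\<close> of \<open>v\<close> and \<open>k v\<close> contains the image
  of \<open>k\<close>, as this image does not split. So \<open>W\<close> is equimorphic to
  \<open>N\<close> but splits in the type \<open>t\<close>. The sets \<open>P p\<close>, with
  exactly \<open>p\<close> vertices that have value \<open>t\<close> at all others, are equimorphic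
  to \<open>W\<close> too and can be put in place of its copies.\<close>

lemma soft:
  assumes XU: "X \<subseteq> U" and fX: "fin X" and N: "strong N X" "\<not> disc t N" "emb k N N" "v \<in> N" "v \<notin> k ` N" "rel t {v} (k ` N)"
  shows False
proof -
  have nbN: "nobranch X N" using branch_not_fin[OF XU N] fX by blast
  have NX: "N \<subseteq> X" using strongD(2)[OF N(1)] .
  let ?A = "k ` N"
  have AN: "?A \<subseteq> N" using embD(2)[OF N(3)] by blast
  define a where "a = k v"
  have a: "a \<in> ?A" "a \<in> N" "a \<noteq> v" using N(5) AN imageI[OF N(4), of k] unfolding a_def by (blast, blast, metis)
  have va: "e v a = t" using N(6) a by (auto simp: rel_def)
  define W where "W = hull X v a"
  have Ws: "strong W X" unfolding W_def using hull_strong N(4) a NX by blast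
  have Wva: "v \<in> W" "a \<in> W" unfolding W_def by (rule hull_in)+
  have WN: "W \<subseteq> N" unfolding W_def using hull_least[OF N(1)] N(4) a by blast
  have dW: "disc t W" unfolding W_def using node(2)[OF XU, of v a] N(4) a NX va by blast
  have nA: "\<not> disc t ?A" using disc_emb_img[OF N(3)] N(2) by simp
  have "?A \<subseteq> W"
  proof (rule ccontr)
    assume "\<not> ?A \<subseteq> W"
    moreover have "rel t (?A \<inter> W) (?A - ?A \<inter> W)" unfolding rel_def
    proof (intro ballI)
      fix x y assume "x \<in> ?A \<inter> W" "y \<in> ?A - ?A \<inter> W"
      then have "e y x = e y v" using strongD(4)[OF Ws, of y x v] Wva AN NX by blast
      moreover have "e v y = t" using N(6) \<open>y \<in> ?A - ?A \<inter> W\<close> by (auto simp: rel_def)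
      ultimately show "e x y = t" using esym by metis
    qed
    ultimately have "disc t ?A" using disc_sub[of "?A \<inter> W" ?A t] a Wva by blast
    then show False using nA by blast
  qed
  then have leNW: "le N W" using emb_mono[OF emb_image[OF N(3)], of N N W] unfolding le_def by blast
  then have eqWN: "eqm W N" using le_refl[OF WN] unfolding eqm_def by blast
  have EqWN: "Eq Y W = Eq Y N" for Y unfolding Eq_def using eqWN eqm_sym eqm_trans by blast
  have nbW: "nobranch X W" using nbN unfolding nobranch_def EqWN .
  define R0 where "R0 = hat X W W"
  define K where "K = KK X W R0"
  have WE: "W \<in> Eq X W" using Ws eqm_refl unfolding Eq_def by blast
  have WK: "W \<in> K"
  proof -
    have "cxi R0 W R0 W"
      by (rule cxi_refl, rule modl_sub[OF strongD(1)[OF Ws]])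
        (use hat_in[OF WE] strongD(2)[OF hat_strong[OF WE]] in \<open>auto simp: R0_def\<close>)
    then show ?thesis using WE unfolding K_def KK_def R0_def by blast
  qed
  note kp = emb_funpow[OF N(3)]
  define P where "P p = (k ^^ p) ` N \<union> {(k ^^ i) v |i. i < p}" for p :: nat
  have kvN: "(k ^^ i) v \<in> N" for i using embD(2)[OF kp N(4)] .
  have PN: "P p \<subseteq> N" for p using embD(2)[OF kp] kvN unfolding P_def by blast
  have vrel: "(k ^^ i) v \<noteq> (k ^^ i) y \<and> e ((k ^^ i) v) ((k ^^ i) y) = t" if "y \<in> ?A" for i y
    using embD(3,4)[OF kp[of i] N(4), of y] that AN N(5,6) by (auto simp: rel_def)
  have powA: "(k ^^ Suc m) x \<in> ?A" if "x \<in> N" for m x using embD(2)[OF kp that, of m] by simp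
  have vrel2: "(k ^^ i) v \<noteq> (k ^^ j) x \<and> e ((k ^^ i) v) ((k ^^ j) x) = t" if ij: "i < j" "x \<in> N" for i j x
  proof -
    obtain m where m: "j = i + Suc m" using less_imp_Suc_add[OF ij(1)] by auto
    have "(k ^^ j) x = (k ^^ i) ((k ^^ Suc m) x)" unfolding m funpow_add o_apply ..
    then show ?thesis using vrel[OF powA[OF ij(2)], of i m] by metis
  qed
  have vdist: "(k ^^ i) v \<noteq> (k ^^ j) v" if "i \<noteq> j" for i j
    using vrel2[of i j v] vrel2[of j i v] that N(4) by (metis nat_neq_iff)
  have big: "disc t (P p)" if "0 < p" for p
  proof (rule disc_sub[of "{(k ^^ i) v |i. i < p}"])
    show "P p - {(k ^^ i) v |i. i < p} \<noteq> {}"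
    proof -
      have "(k ^^ p) v \<in> P p" using N(4) unfolding P_def by blast
      moreover have "(k ^^ p) v \<notin> {(k ^^ i) v |i. i < p}"
      proof
        assume "(k ^^ p) v \<in> {(k ^^ i) v |i. i < p}"
        then obtain i where i: "i < p" "(k ^^ p) v = (k ^^ i) v" by blast
        then show False using vdist[of p i] by auto
      qed
      ultimately show ?thesis by blast
    qed
    show "rel t {(k ^^ i) v |i. i < p} (P p - {(k ^^ i) v |i. i < p})" unfolding rel_def
    proof (intro ballI)
      fix x y assume "x \<in> {(k ^^ i) v |i. i < p}" "y \<in> P p - {(k ^^ i) v |i. i < p}"
      then obtain i y' where "x = (k ^^ i) v" "i < p" "y = (k ^^ p) y'" "y' \<in> N" unfolding P_def by blast
      then show "e x y = t" using vrel2 by blast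
    qed
  qed (use that in \<open>auto simp: P_def\<close>)
  have isoP: "card {z\<in>P p. \<forall>y\<in>P p. y \<noteq> z \<longrightarrow> e z y = t} = p" for p
  proof -
    have "{z\<in>P p. \<forall>y\<in>P p. y \<noteq> z \<longrightarrow> e z y = t} = (\<lambda>i. (k ^^ i) v) ` {..<p}"
    proof
      show "(\<lambda>i. (k ^^ i) v) ` {..<p} \<subseteq> {z\<in>P p. \<forall>y\<in>P p. y \<noteq> z \<longrightarrow> e z y = t}"
      proof
        fix z assume "z \<in> (\<lambda>i. (k ^^ i) v) ` {..<p}"
        then obtain i where i: "z = (k ^^ i) v" "i < p" by blast
        have "e z y = t" if y: "y \<in> P p" "y \<noteq> z" for y
        proof -
          consider y' where "y = (k ^^ p) y'" "y' \<in> N" | j where "y = (k ^^ j) v" "j < p" using y unfolding P_def by blast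
          then show ?thesis
          proof cases
            case 1 then show ?thesis using vrel2 i by blast
          next
            case 2
            then have "i \<noteq> j" using y i by blast
            then consider "i < j" | "j < i" by linarith
            then show ?thesis
            proof cases
              case 1 then show ?thesis using vrel2[of i j v] i 2 N(4) by blast
            next
              case 2
              then show ?thesis using vrel2[of j i v] i \<open>y = (k ^^ j) v\<close> N(4) esym[of z y] by blast
            qed
          qed
        qed
        then show "z \<in> {z\<in>P p. \<forall>y\<in>P p. y \<noteq> z \<longrightarrow> e z y = t}" using i unfolding P_def by blast
      qed
      show "{z\<in>P p. \<forall>y\<in>P p. y \<noteq> z \<longrightarrow> e z y = t} \<subseteq> (\<lambda>i. (k ^^ i) v) ` {..<p}"
      proof
        fix z assume z: "z \<in> {z\<in>P p. \<forall>y\<in>P p. y \<noteq> z \<longrightarrow> e z y = t}"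
        show "z \<in> (\<lambda>i. (k ^^ i) v) ` {..<p}"
        proof (rule ccontr)
          assume "z \<notin> (\<lambda>i. (k ^^ i) v) ` {..<p}"
          then have zk: "z \<in> (k ^^ p) ` N" using z unfolding P_def by blast
          have "rel t {z} ((k ^^ p) ` N - {z})" using z unfolding P_def rel_def by blast
          moreover have "(k ^^ p) ` N - {z} \<noteq> {}"
          proof -
            have "(k ^^ p) v \<noteq> (k ^^ p) a" using vrel[of a p] a by blast
            moreover have "(k ^^ p) v \<in> (k ^^ p) ` N" "(k ^^ p) a \<in> (k ^^ p) ` N" using N(4) a by blast+
            ultimately show ?thesis by blast
          qed
          ultimately have "disc t ((k ^^ p) ` N)" using disc_sub[of "{z}"] zk by blast
          then show False using disc_emb_img[OF kp] N(2) by simp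
        qed
      qed
    qed
    moreover have "inj_on (\<lambda>i. (k ^^ i) v) {..<p}" unfolding inj_on_def using vdist by blast
    ultimately show ?thesis by (simp add: card_image)
  qed
  have KE: "M \<in> Eq X W" if "M \<in> K" for M using that unfolding K_def KK_def by blast
  have "\<forall>M. \<exists>j. M \<in> K \<longrightarrow> emb j N M"
  proof
    fix M
    have "le N M" if "M \<in> K" using EqD(2)[OF KE[OF that]] le_trans[OF leNW] unfolding eqm_def by blast
    then show "\<exists>j. M \<in> K \<longrightarrow> emb j N M" unfolding le_def by blast
  qed
  then obtain j where j: "\<And>M. M \<in> K \<Longrightarrow> emb (j M) N M" by metis
  \<comment> \<open>The index is \<open>Suc p\<close> because the replacement has to split in the
    type \<open>t\<close>, as \<open>W\<close> does; this needs at least one isolated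
    vertex.\<close>
  define r where "r p M = j M ` P (Suc p)" for p M
  have r1: "r p M \<subseteq> M" if "M \<in> K" for p M using embD(2)[OF j[OF that]] PN unfolding r_def by blast
  have rP: "ism (P (Suc p)) (r p M)" if "M \<in> K" for p M unfolding r_def by (rule emb_ism[OF j[OF that] PN])
  have PW: "eqm (P p) W" for p
  proof -
    have "le N (P p)" using emb_mono[OF emb_image[OF kp[of p], of N], of N "P p"] unfolding le_def P_def by blast
    then have "le W (P p)" using le_trans le_refl[OF WN] by blast
    moreover have "le (P p) W" using le_trans[OF le_refl[OF PN] leNW] .
    ultimately show ?thesis unfolding eqm_def by blast
  qed
  have r2: "eqm (r p M) W" if "M \<in> K" for p M
    using ism_eqm[OF rP[OF that]] PW eqm_sym eqm_trans by blast
  have r3: "disc s (r p M) = disc s W" if "M \<in> K" for p M s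
  proof -
    have "disc t (r p M)" using disc_ism[OF rP[OF that]] big[of "Suc p"] by simp
    then show ?thesis using dW disc_both[of t "r p M"] disc_both[of t W] by (cases s; cases t) auto
  qed
  have Wne: "W \<noteq> {}" using Wva by blast
  note rp = repl[OF XU fX nbW Wne K_def, of "r p" for p, OF r1 r2 r3]
  have "\<not> fin X"
  proof (rule not_fin_seq[of "\<lambda>p. Rp X K (r p)"])
    show "Rp X K (r p) \<in> Sib X" for p by (rule rp(1))
    fix p q assume "ism (Rp X K (r p)) (Rp X K (r q))"
    then obtain f where f: "emb f (Rp X K (r p)) (Rp X K (r q))" "f ` Rp X K (r p) = Rp X K (r q)" unfolding ism_def by blast
    have 1: "r p W \<in> KK (Rp X K (r p)) W R0" using rp(2)[of p] WK by blast
    then have "f ` r p W \<in> KK (Rp X K (r q)) W R0" using KK_img[OF f] by blast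
    then obtain M where M: "M \<in> K" "f ` r p W = r q M" using rp(2)[of q] by blast
    have "r p W \<subseteq> Rp X K (r p)" using 1 EqD(4) unfolding KK_def by blast
    then have "ism (r p W) (r q M)" using emb_ism[OF f(1)] M(2) by metis
    then have "ism (P (Suc p)) (P (Suc q))" using rP[OF WK, of p] rP[OF M(1), of q] ism_trans ism_sym by blast
    from isolated_card[OF this, of t] show "p = q" using isoP by simp
  qed
  then show False using fX by blast
qed

section \<open>Strong modules of graphs with finitely many siblings\<close>

text \<open>A vertex \<open>w\<close> of \<open>M' - M\<close> is carried by \<open>k\<close> into
  \<open>M\<close> but outside the image of \<open>M\<close>, so by \<open>soft\<close>
  \<open>M\<close> splits in the type of \<open>w\<close>. By \<open>strong_other_type\<close> both
  types occur among such vertices, while \<open>M\<close> cannot split in both.\<close>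

lemma nested_strong:
  assumes "X \<subseteq> U" "fin X" "strong M X" "strong M' X" "M \<subset> M'" "eqm M M'"
  shows False
proof -
  obtain k where k: "emb k M' M" using assms(6) unfolding eqm_def le_def by blast
  have sub: "M \<subseteq> M'" using assms(5) by blast
  have kM: "emb k M M" using emb_mono[OF k sub subset_refl] .
  have key: "disc t M" if w: "w \<in> M'" "w \<notin> M" "rel t {w} M" for t w
  proof (rule ccontr)
    assume nd: "\<not> disc t M"
    have 1: "k w \<in> M" using embD(2)[OF k w(1)] .
    have 2: "k w \<notin> k ` M"
    proof
      assume "k w \<in> k ` M"
      then obtain m where m: "m \<in> M" "k w = k m" by blast
      then have "w = m" using embD(4)[OF k w(1), of m] sub by blast
      then show False using m w(2) by blast
    qed
    have "rel t (k ` {w}) (k ` M)" by (rule rel_img[OF k w(3)]) (use w sub in auto)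
    then show False using soft[OF assms(1-3) nd kM 1 2] by simp
  qed
  obtain w where w: "w \<in> M'" "w \<notin> M" using assms(5) by blast
  obtain m where m: "m \<in> M" using strongD(3)[OF assms(3)] by blast
  have "rel (e w m) {w} M"
    using strongD(4)[OF assms(3) _ w(2) _ m] w(1) strongD(2)[OF assms(4)] unfolding rel_def by blast
  then have d: "disc (e w m) M" using key w by blast
  obtain u where "u \<in> M'" "u \<notin> M" "rel (\<not> e w m) {u} M"
    using strong_other_type[OF assms(3) d strongD(1)[OF assms(4)] assms(5)] by blast
  then have "disc (\<not> e w m) M" using key by blast
  then show False using disc_both[OF d] by blast
qed

text \<open>If \<open>M\<close> does not split, its image lies on one side of the splitting of
  \<open>M'\<close>, and any vertex of the other side contradicts \<open>soft\<close>.\<close>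

lemma disc_Sib_imp:
  assumes "X \<subseteq> U" "fin X" "strong M X" "M' \<in> Sib M" "disc t M'"
  shows "disc t M"
proof (rule ccontr)
  assume nd: "\<not> disc t M"
  obtain f where f: "emb f M M'" and M': "M' \<subseteq> M" using assms(4) unfolding Sib_def le_def by blast
  have fM: "emb f M M" using emb_mono[OF f subset_refl M'] .
  obtain A B where AB: "A \<noteq> {}" "B \<noteq> {}" "A \<inter> B = {}" "A \<union> B = M'" "rel t A B" "rel t B A" using discE[OF assms(5)] .
  have n: "\<not> disc t (f ` M)" using disc_emb_img[OF f] nd by simp
  have "f ` M \<subseteq> A \<union> B" using embD(2)[OF f] AB(4) by blast
  then have "f ` M \<subseteq> A \<or> f ` M \<subseteq> B" using ndisc_split[OF n _ AB(5,3)] by blast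
  then obtain v where v: "v \<in> M'" "v \<notin> f ` M" "rel t {v} (f ` M)"
  proof
    assume 1: "f ` M \<subseteq> A"
    obtain b where "b \<in> B" using AB(2) by blast
    then show thesis using that[of b] AB(3,4,6) 1 unfolding rel_def by blast
  next
    assume 1: "f ` M \<subseteq> B"
    obtain b where "b \<in> A" using AB(1) by blast
    then show thesis using that[of b] AB(3,4,5) 1 unfolding rel_def by blast
  qed
  then show False using soft[OF assms(1-3) nd fM _ v(2,3)] M' by blast
qed

text \<open>If \<open>M'\<close> does not split in the type of \<open>M\<close>, it does not split
  at all and is therefore strong in the sibling \<open>Y\<close> of \<open>X\<close>. It lies on one
  side of the splitting of \<open>M\<close>, and the image of a vertex of the other side contradicts
  \<open>soft\<close> for \<open>M'\<close> in \<open>Y\<close>.\<close>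

lemma disc_Sib:
  assumes "X \<subseteq> U" "fin X" "strong M X" "M' \<in> Sib M"
  shows "disc t M' = disc t M"
proof
  assume d: "disc t M"
  show "disc t M'"
  proof (rule ccontr)
    assume n1: "\<not> disc t M'"
    have n2: "\<not> disc (\<not> t) M'" using disc_Sib_imp[OF assms] disc_both[OF d] by blast
    obtain f where f: "emb f M M'" and M': "M' \<subseteq> M" using assms(4) unfolding Sib_def le_def by blast
    define Y where "Y = (X - M) \<union> M'"
    have YS: "Y \<in> Sib X" unfolding Y_def by (rule rep_Sib[OF strongD(1)[OF assms(3)] assms(4)])
    have YX: "Y \<subseteq> X" using YS unfolding Sib_def by blast
    have ne: "M' \<noteq> {}" using embD(2)[OF f] strongD(3)[OF assms(3)] by blast
    have "M \<inter> Y = M'" using M' unfolding Y_def by blast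
    then have "modl M' Y" using modl_restrict[OF strongD(1)[OF assms(3)] YX] ne by simp
    then have st: "strong M' Y" using strong_ndisc[of M' Y] n1 n2 by (cases t) auto
    obtain A B where AB: "A \<noteq> {}" "B \<noteq> {}" "A \<inter> B = {}" "A \<union> B = M" "rel t A B" "rel t B A" using discE[OF d] .
    have main: False if "M' \<subseteq> C" "b \<in> M" "b \<notin> C" "rel t {b} C" "C \<subseteq> M" for C b
    proof -
      have "f b \<notin> f ` C" using embD(4)[OF f that(2)] that(3,5) by blast
      then have "f b \<notin> f ` M'" using that(1) by blast
      moreover have "rel t (f ` {b}) (f ` C)" by (rule rel_img[OF f that(4)]) (use that in auto)
      then have "rel t {f b} (f ` M')" using that(1) unfolding rel_def by blast
      moreover have "emb f M' M'" using emb_mono[OF f M' subset_refl] .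
      ultimately show False
        using soft[OF subset_trans[OF YX assms(1)] fin_Sib[OF assms(2) YS] st n1] embD(2)[OF f that(2)] by blast
    qed
    have "M' \<subseteq> A \<union> B" using M' AB(4) by simp
    then have "M' \<subseteq> A \<or> M' \<subseteq> B" using ndisc_split[OF n1 _ AB(5,3)] by blast
    then show False
    proof
      assume 1: "M' \<subseteq> A"
      obtain b where b: "b \<in> B" using AB(2) by blast
      have "rel t {b} A" using b AB(6) unfolding rel_def by blast
      then show False using main[OF 1, of b] b AB(3,4) by blast
    next
      assume 1: "M' \<subseteq> B"
      obtain b where b: "b \<in> A" using AB(1) by blast
      have "rel t {b} B" using b AB(5) unfolding rel_def by blast
      then show False using main[OF 1, of b] b AB(3,4) by blast
    qed
  qed
qed (rule disc_Sib_imp[OF assms])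

lemma disc_eqm:
  assumes "X \<subseteq> U" "fin X" "strong M X" "eqm M' M"
  shows "disc t M' = disc t M"
proof -
  obtain Z where Z: "Z \<subseteq> M" "ism M' Z" using le_ism[of M' M] assms(4) unfolding eqm_def by blast
  have "le M Z" using assms(4) ism_le[OF Z(2)] le_trans unfolding eqm_def by blast
  then have "Z \<in> Sib M" using Z(1) unfolding Sib_def by blast
  then show ?thesis using disc_Sib[OF assms(1-3), of Z] disc_ism[OF Z(2)] by simp
qed

lemma Eq_antichain:
  assumes "X \<subseteq> U" "fin X" "M \<in> Eq X M0" "N \<in> Eq X M0" "M \<noteq> N"
  shows "M \<inter> N = {}"
proof (rule ccontr)
  assume "M \<inter> N \<noteq> {}"
  then have c: "M \<subset> N \<or> N \<subset> M" using Eq_cmp[OF assms(3,4)] assms(5) by blast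
  have "eqm M N" "eqm N M" using EqD(2)[OF assms(3)] EqD(2)[OF assms(4)] eqm_sym eqm_trans by blast+
  then show False using c nested_strong[OF assms(1,2)] EqD(1)[OF assms(3)] EqD(1)[OF assms(4)] by blast
qed

text \<open>Without nested copies every hat is the copy itself, and the contracted hats are single
  points.\<close>

lemma KK_Eq:
  assumes "X \<subseteq> U" "fin X"
  shows "KK X M0 M0 = Eq X M0"
proof -
  have "M \<in> KK X M0 M0" if M: "M \<in> Eq X M0" for M
  proof -
    have "M' = M" if "M' \<in> Eq X M0" "M \<subseteq> M'" for M'
      using Eq_antichain[OF assms M that(1)] that(2) EqD(5)[OF M] by blast
    then have h: "hat X M0 M = M" unfolding hat_def using M by blast
    have "cxi M M M0 M0" by (rule cxiI[of id]) (auto simp: emb_def)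
    moreover have "disc t M = disc t M0" for t
      using disc_eqm[OF assms EqD(1)[OF M] eqm_sym[OF EqD(2)[OF M]]] by simp
    ultimately show ?thesis using M h unfolding KK_def by simp
  qed
  then show ?thesis unfolding KK_def by blast
qed

lemma replace_Eq:
  assumes "X \<subseteq> U" "fin X" "M0 \<noteq> {}"
    and r: "\<And>M. M \<in> Eq X M0 \<Longrightarrow> r M \<subseteq> M" "\<And>M. M \<in> Eq X M0 \<Longrightarrow> eqm (r M) M0"
  shows "Rp X (Eq X M0) r \<in> Sib X" "Eq (Rp X (Eq X M0) r) M0 = r ` Eq X M0"
proof -
  have nb: "nobranch X M0" unfolding nobranch_def
  proof (intro ballI impI notI)
    fix M1 M2 M assume M: "M1 \<in> Eq X M0" "M2 \<in> Eq X M0" "M \<in> Eq X M0" "M1 \<subseteq> M \<and> M2 \<subseteq> M" "M1 \<inter> M2 = {}"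
    have "M1 = M" "M2 = M"
      using Eq_antichain[OF assms(1,2) M(1,3)] Eq_antichain[OF assms(1,2) M(2,3)] M(4) EqD(5)[OF M(1)] EqD(5)[OF M(2)] by blast+
    then show False using M(5) EqD(5)[OF M(1)] by blast
  qed
  have r3: "disc t (r M) = disc t M0" if M: "M \<in> Eq X M0" for M t
    using disc_eqm[OF assms(1,2) EqD(1)[OF M] eqm_trans[OF r(2)[OF M] eqm_sym[OF EqD(2)[OF M]]]]
      disc_eqm[OF assms(1,2) EqD(1)[OF M] eqm_sym[OF EqD(2)[OF M]]] by simp
  note R = repl[OF assms(1,2) nb assms(3) KK_Eq[OF assms(1,2), symmetric] r r3]
  show S: "Rp X (Eq X M0) r \<in> Sib X" by (rule R(1))
  then have "Rp X (Eq X M0) r \<subseteq> U" using assms(1) unfolding Sib_def by blast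
  from KK_Eq[OF this fin_Sib[OF assms(2) S]] show "Eq (Rp X (Eq X M0) r) M0 = r ` Eq X M0" using R(2) by simp
qed

section \<open>Counting isomorphism classes of siblings\<close>

definition cls :: "'a set \<Rightarrow> 'a set set set" where
  "cls X = (\<lambda>A. {B. ism A B}) ` Sib X"

lemma cls_eq: "({C. ism A C} = {C. ism B C}) = ism A B"
proof
  assume "{C. ism A C} = {C. ism B C}"
  then have "ism B A" using ism_refl[of A] by blast
  then show "ism A B" by (rule ism_sym)
next
  assume *: "ism A B"
  show "{C. ism A C} = {C. ism B C}" using ism_trans[OF *] ism_trans[OF ism_sym[OF *]] by blast
qed

lemma fin_cls: "fin X = finite (cls X)"
proof
  assume "fin X"
  then obtain F where F: "finite F" "\<And>A. A \<in> Sib X \<Longrightarrow> \<exists>B\<in>F. ism A B" unfolding fin_def by blast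
  have "cls X \<subseteq> (\<lambda>B. {C. ism B C}) ` F"
  proof
    fix c assume "c \<in> cls X"
    then obtain A where A: "A \<in> Sib X" "c = {C. ism A C}" unfolding cls_def by blast
    obtain B where B: "B \<in> F" "ism A B" using F(2)[OF A(1)] by blast
    then show "c \<in> (\<lambda>B. {C. ism B C}) ` F" using A(2) cls_eq[of A B] by blast
  qed
  then show "finite (cls X)" using F(1) finite_surj by blast
next
  assume f: "finite (cls X)"
  define s where "s c = (SOME A. A \<in> Sib X \<and> {B. ism A B} = c)" for c
  have "\<exists>B\<in>s ` cls X. ism A B" if A: "A \<in> Sib X" for A
  proof -
    let ?c = "{B. ism A B}"
    have "s ?c \<in> Sib X \<and> {B. ism (s ?c) B} = ?c" unfolding s_def by (rule someI[of _ A]) (use A in simp)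
    then have "ism A (s ?c)" using cls_eq by blast
    moreover have "?c \<in> cls X" using A unfolding cls_def by blast
    ultimately show ?thesis by blast
  qed
  then show "fin X" unfolding fin_def using f by (intro exI[of _ "s ` cls X"]) blast
qed

text \<open>\<open>\<Phi>\<close> has to reflect isomorphism, not to preserve it; this is why
  representatives \<open>s\<close> are chosen. The third part says that an injection between finite
  sets of equal size is onto; minimality will be exploited through it.\<close>

lemma cls_inj:
  assumes "fin X" and S: "\<And>A. A \<in> Sib M \<Longrightarrow> \<Phi> A \<in> Sib X"
    and i: "\<And>A B. \<lbrakk>A \<in> Sib M; B \<in> Sib M; ism (\<Phi> A) (\<Phi> B)\<rbrakk> \<Longrightarrow> ism A B"
  shows "fin M" "card (cls M) \<le> card (cls X)"
    "\<lbrakk>card (cls M) = card (cls X); B \<in> Sib X\<rbrakk> \<Longrightarrow> \<exists>A\<in>Sib M. ism B (\<Phi> A)"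
proof -
  define s where "s c = (SOME A. A \<in> Sib M \<and> {B. ism A B} = c)" for c
  have s: "s c \<in> Sib M \<and> {B. ism (s c) B} = c" if "c \<in> cls M" for c
    unfolding s_def by (rule someI_ex) (use that in \<open>auto simp: cls_def\<close>)
  define \<psi> where "\<psi> c = {B. ism (\<Phi> (s c)) B}" for c
  have im: "\<psi> ` cls M \<subseteq> cls X" using S s unfolding \<psi>_def cls_def by blast
  have inj: "inj_on \<psi> (cls M)"
  proof (rule inj_onI)
    fix c d assume cd: "c \<in> cls M" "d \<in> cls M" "\<psi> c = \<psi> d"
    then have "ism (\<Phi> (s c)) (\<Phi> (s d))" unfolding \<psi>_def using cls_eq by blast
    then have "ism (s c) (s d)" using i s cd by blast
    then show "c = d" using s[OF cd(1)] s[OF cd(2)] cls_eq by metis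
  qed
  have fX: "finite (cls X)" using assms(1) fin_cls by blast
  show "fin M" using inj_on_finite[OF inj im fX] fin_cls by blast
  show "card (cls M) \<le> card (cls X)" by (rule card_inj_on_le[OF inj im fX])
  assume c: "card (cls M) = card (cls X)" and B: "B \<in> Sib X"
  have "\<psi> ` cls M = cls X" using card_subset_eq[OF fX im] card_image[OF inj] c by simp
  moreover have "{C. ism B C} \<in> cls X" using B unfolding cls_def by blast
  ultimately obtain c where "c \<in> cls M" "{C. ism B C} = \<psi> c" by blast
  then show "\<exists>A\<in>Sib M. ism B (\<Phi> A)" using s cls_eq unfolding \<psi>_def by blast
qed

lemma Eq_ism:
  assumes "ism X Y" "M \<in> Eq X M0"
  shows "\<exists>N\<in>Eq Y M0. ism M N"
proof -
  obtain f where f: "emb f X Y" "f ` X = Y" using assms(1) unfolding ism_def by blast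
  show ?thesis using Eq_img[OF f assms(2)] emb_ism[OF f(1) EqD(4)[OF assms(2)]] by blast
qed

text \<open>All strong copies of \<open>M\<close> in \<open>X\<close> are replaced by copies of the
  same sibling \<open>A\<close>, so \<open>A\<close> can be recovered from any copy of
  \<open>M\<close> in \<open>\<Phi> A\<close>.\<close>

lemma transfer:
  assumes "X \<subseteq> U" "fin X" "strong M X"
  obtains \<Phi> where "\<And>A. A \<in> Sib M \<Longrightarrow> \<Phi> A \<in> Sib X" "\<And>A. A \<in> Sib M \<Longrightarrow> Eq (\<Phi> A) M \<noteq> {}"
    "\<And>A N. \<lbrakk>A \<in> Sib M; N \<in> Eq (\<Phi> A) M\<rbrakk> \<Longrightarrow> ism N A"
    "\<And>A B. \<lbrakk>A \<in> Sib M; B \<in> Sib M; ism (\<Phi> A) (\<Phi> B)\<rbrakk> \<Longrightarrow> ism A B"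
proof -
  define j where "j N = (SOME f. emb f M N)" for N
  have j: "emb (j N) M N" if "N \<in> Eq X M" for N
    unfolding j_def by (rule someI_ex[of "\<lambda>f. emb f M N"]) (use EqD(2)[OF that] in \<open>auto simp: eqm_def le_def\<close>)
  define \<Phi> where "\<Phi> A = Rp X (Eq X M) (\<lambda>N. j N ` A)" for A
  have jA: "ism A (j N ` A)" "j N ` A \<subseteq> N" if "A \<in> Sib M" "N \<in> Eq X M" for A N
    using emb_ism[OF j[OF that(2)], of A] embD(2)[OF j[OF that(2)]] that(1) unfolding Sib_def by blast+
  have R: "\<Phi> A \<in> Sib X" "Eq (\<Phi> A) M = (\<lambda>N. j N ` A) ` Eq X M" if A: "A \<in> Sib M" for A
  proof -
    have r: "eqm (j N ` A) M" if "N \<in> Eq X M" for N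
      using eqm_trans[OF eqm_sym[OF ism_eqm[OF jA(1)[OF A that]]] Sib_eqm[OF A]] .
    show "\<Phi> A \<in> Sib X" "Eq (\<Phi> A) M = (\<lambda>N. j N ` A) ` Eq X M" unfolding \<Phi>_def
      using replace_Eq[OF assms(1,2) strongD(3)[OF assms(3)], of "\<lambda>N. j N ` A", OF jA(2)[OF A] r] by blast+
  qed
  have MM: "M \<in> Eq X M" using assms(3) eqm_refl unfolding Eq_def by blast
  have 2: "Eq (\<Phi> A) M \<noteq> {}" if "A \<in> Sib M" for A using R(2)[OF that] MM by blast
  have 3: "ism N A" if A: "A \<in> Sib M" and N: "N \<in> Eq (\<Phi> A) M" for A N
  proof -
    obtain N' where "N' \<in> Eq X M" "N = j N' ` A" using R(2)[OF A] N by blast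
    then show ?thesis using ism_sym[OF jA(1)[OF A]] by blast
  qed
  have 4: "ism A B" if AB: "A \<in> Sib M" "B \<in> Sib M" "ism (\<Phi> A) (\<Phi> B)" for A B
  proof -
    obtain N where N: "N \<in> Eq (\<Phi> A) M" using 2[OF AB(1)] by blast
    obtain N' where N': "N' \<in> Eq (\<Phi> B) M" "ism N N'" using Eq_ism[OF AB(3) N] by blast
    show ?thesis using ism_trans[OF ism_sym[OF 3[OF AB(1) N]] ism_trans[OF N'(2) 3[OF AB(2) N'(1)]]] .
  qed
  show thesis by (rule that[OF R(1) 2 3 4])
qed

lemma strong_fin:
  assumes "X \<subseteq> U" "fin X" "strong M X"
  shows "fin M" "card (cls M) \<le> card (cls X)"
proof -
  obtain \<Phi> where \<Phi>: "\<And>A. A \<in> Sib M \<Longrightarrow> \<Phi> A \<in> Sib X" "\<And>A B. \<lbrakk>A \<in> Sib M; B \<in> Sib M; ism (\<Phi> A) (\<Phi> B)\<rbrakk> \<Longrightarrow> ism A B"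
    by (rule transfer[OF assms]) (rule that)
  show "fin M" "card (cls M) \<le> card (cls X)" by (rule cls_inj[OF assms(2)], fact \<Phi>, fact \<Phi>)+
qed

text \<open>Let a module overlapping \<open>B \<inter> M\<close> contain \<open>m\<close> inside and
  \<open>q\<close> outside \<open>M\<close>. Their hull \<open>V\<close> contains a vertex
  \<open>u\<close> related to \<open>M\<close> by the opposite type. \<open>f u\<close> is outside
  \<open>M\<close> by \<open>soft\<close>, and its values at \<open>m\<close> and \<open>q\<close>
  put it outside \<open>V\<close>. So the preimage of \<open>V\<close> is a nonempty proper part of
  \<open>V\<close>, against \<open>shift\<close>.\<close>

lemma restrict_strong:
  assumes XU: "X \<subseteq> U" and fX: "fin X" and M: "strong M X" and f: "emb f X B" and BX: "B \<subseteq> X" and fM: "f ` M \<subseteq> M"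
  shows "strong (B \<inter> M) B"
proof (rule strongI_ndisc)
  have fB: "f ` M \<subseteq> B" using embD(2)[OF f] strongD(2)[OF M] by blast
  have ne: "M \<inter> B \<noteq> {}" using fM fB strongD(3)[OF M] by blast
  show "modl (B \<inter> M) B" using modl_restrict[OF strongD(1)[OF M] BX ne] by (simp add: Int_commute)
  fix s T
  assume ds: "disc s (B \<inter> M)" and T: "modl T B" "T \<inter> (B \<inter> M) \<noteq> {}" "T - B \<inter> M \<noteq> {}" "rel s (T - B \<inter> M) (B \<inter> M)"
  have fXX: "emb f X X" using emb_mono[OF f subset_refl BX] .
  have fMM: "emb f M M" using emb_mono[OF emb_image[OF fXX strongD(2)[OF M]] subset_refl fM] .
  have "emb f M (B \<inter> M)" by (rule emb_mono[OF emb_image[OF f strongD(2)[OF M]] subset_refl]) (use fM fB in blast)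
  then have "B \<inter> M \<in> Sib M" using SibI by blast
  then have dM: "disc s M" using disc_Sib[OF XU fX M] ds by blast
  obtain q where q: "q \<in> T" "q \<notin> M" "q \<in> B" using T(3) modlD(1)[OF T(1)] by blast
  obtain m where m: "m \<in> T" "m \<in> B" "m \<in> M" using T(2) by blast
  have qm: "e q m = s" using relD[OF T(4), of q m] q m by blast
  define V where "V = hull X m q"
  have X: "m \<in> X" "q \<in> X" "m \<noteq> q" using m q BX by blast+
  have V: "strong V X" "m \<in> V" "q \<in> V" unfolding V_def using hull_strong[OF X(1,2)] hull_in by blast+
  have MV: "M \<subset> V" using strong_cmp[OF M strongD(1)[OF V(1)] m(3) V(2)] V(3) q(2) by blast
  have mq: "e m q = s" using qm esym[of m q] by simp
  have nd: "q \<notin> cpt s V m" "disc s V" using node[OF XU X] mq unfolding V_def by simp_all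
  obtain u where u: "u \<in> V" "u \<notin> M" "rel (\<not> s) {u} M" using strong_other_type[OF M dM strongD(1)[OF V(1)] MV] .
  have uX: "u \<in> X" using u(1) strongD(2)[OF V(1)] by blast
  have fu1: "f u \<notin> f ` M" using embD(4)[OF f uX] u(2) strongD(2)[OF M] by blast
  have "rel (\<not> s) (f ` {u}) (f ` M)" by (rule rel_img[OF f u(3)]) (use u uX strongD(2)[OF M] in auto)
  then have fu2: "rel (\<not> s) {f u} (f ` M)" by simp
  have fuM: "f u \<notin> M" using soft[OF XU fX M disc_both[OF dM] fMM _ fu1 fu2] by blast
  have fuB: "f u \<in> B" using embD(2)[OF f uX] .
  obtain m1 where m1: "m1 \<in> f ` M" "m1 \<in> B" "m1 \<in> M" using fM fB strongD(3)[OF M] by blast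
  have "e (f u) m1 = (\<not> s)" using relD[OF fu2, of "f u" m1] m1 by blast
  then have fum: "e (f u) m' = (\<not> s)" if "m' \<in> M" for m'
    using strongD(4)[OF M _ fuM that m1(3)] fuB BX by blast
  have "f u \<notin> T" using relD[OF T(4), of "f u" m1] fuM m1 fum[OF m1(3)] by blast
  then have fuq: "e (f u) q = (\<not> s)" using modlD(3)[OF T(1) fuB _ q(1) m(1)] fum[OF m(3)] by blast
  \<comment> \<open>\<open>V\<close> splits in the type \<open>s\<close> with \<open>m\<close> and
    \<open>q\<close> on different sides, so no vertex of \<open>V\<close> can have value
    \<open>\<not> s\<close> at both.\<close>
  have "f u \<notin> V"
  proof
    assume fV: "f u \<in> V"
    have rl: "rel s (cpt s V m) (V - cpt s V m)" by (rule cpt_rel)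
    have mm: "m \<in> cpt s V m" by (rule cpt_self[OF V(2)])
    show False
    proof (cases "f u \<in> cpt s V m")
      case True then show False using relD[OF rl True, of q] nd(1) V(3) fuq by blast
    next
      case False then show False using relD[OF rl mm, of "f u"] fV fum[OF m(3)] esym[of m "f u"] by blast
    qed
  qed
  let ?W = "{x\<in>X. f x \<in> V}"
  have mW: "m \<in> ?W" using m(3) X(1) fM MV by blast
  have "modl ?W X" using modl_vimg[OF fXX strongD(1)[OF V(1)]] mW by blast
  then have "?W \<subset> V" using strong_cmp[OF V(1) _ V(2) mW] u(1) \<open>f u \<notin> V\<close> by blast
  then show False using shift[OF XU fXX V(1)] mW fX by blast
qed

section \<open>Sums\<close>

lemma pieces:
  assumes d: "\<And>i j. \<lbrakk>i \<in> I; j \<in> I; i \<noteq> j\<rbrakk> \<Longrightarrow> P i \<inter> P j = {}"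
    and m: "\<And>i. i \<in> I \<Longrightarrow> emb (\<phi> i) (P i) (P' i)"
    and c: "\<And>i j x y. \<lbrakk>i \<in> I; j \<in> I; i \<noteq> j; x \<in> P i; y \<in> P j\<rbrakk> \<Longrightarrow> \<phi> i x \<noteq> \<phi> j y \<and> e (\<phi> i x) (\<phi> j y) = e x y"
  obtains F where "emb F (\<Union>i\<in>I. P i) (\<Union>i\<in>I. P' i)" "F ` (\<Union>i\<in>I. P i) = (\<Union>i\<in>I. \<phi> i ` P i)"
proof -
  define F where "F x = \<phi> (THE i. i \<in> I \<and> x \<in> P i) x" for x
  have F: "F x = \<phi> i x" if ix: "i \<in> I" "x \<in> P i" for i x
  proof -
    have "(THE i. i \<in> I \<and> x \<in> P i) = i"
    proof (rule the_equality)
      fix j assume "j \<in> I \<and> x \<in> P j"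
      then show "j = i" using d[of i j] ix by blast
    qed (use ix in blast)
    then show ?thesis unfolding F_def by simp
  qed
  have k: "F x \<noteq> F y \<and> e (F x) (F y) = e x y" if xy: "x \<in> (\<Union>i\<in>I. P i)" "y \<in> (\<Union>i\<in>I. P i)" "x \<noteq> y" for x y
  proof -
    obtain i j where ij: "i \<in> I" "x \<in> P i" "j \<in> I" "y \<in> P j" using xy by blast
    show ?thesis
    proof (cases "i = j")
      case True
      then show ?thesis using embD(3,4)[OF m[OF ij(1)] ij(2), of y] ij xy(3) F by metis
    next
      case False
      then show ?thesis using c[OF ij(1,3) False ij(2,4)] F[OF ij(1,2)] F[OF ij(3,4)] by simp
    qed
  qed
  have "emb F (\<Union>i\<in>I. P i) (\<Union>i\<in>I. P' i)"
  proof (rule embI)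
    show "inj_on F (\<Union>i\<in>I. P i)" unfolding inj_on_def using k by blast
    fix x assume "x \<in> (\<Union>i\<in>I. P i)"
    then obtain i where i: "i \<in> I" "x \<in> P i" by blast
    then show "F x \<in> (\<Union>i\<in>I. P' i)" using F[OF i] embD(2)[OF m[OF i(1)] i(2)] by auto
  qed (use k in blast)
  moreover have "F ` (\<Union>i\<in>I. P i) = (\<Union>i\<in>I. \<phi> i ` P i)"
    unfolding image_UN using F by (intro SUP_cong refl image_cong) auto
  ultimately show thesis using that by blast
qed

definition comps :: "bool \<Rightarrow> 'a set \<Rightarrow> 'a set set" where
  "comps t X = cpt t X ` X"

lemma compsD:
  assumes "Z \<in> comps t X"
  shows "Z \<subseteq> X" "Z \<noteq> {}" "\<not> disc t Z" "\<And>x. x \<in> Z \<Longrightarrow> cpt t X x = Z"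
proof -
  obtain z where z: "z \<in> X" "Z = cpt t X z" using assms unfolding comps_def by blast
  show "Z \<subseteq> X" using cpt_sub[OF z(1)] z(2) by simp
  show "Z \<noteq> {}" using cpt_self[OF z(1)] z(2) by blast
  show "\<not> disc t Z" using cpt_ndisc[OF z(1)] z(2) by simp
  show "cpt t X x = Z" if "x \<in> Z" for x using cpt_eq[OF z(1)] that z(2) by blast
qed

lemma comps_cpt: "x \<in> X \<Longrightarrow> cpt t X x \<in> comps t X"
  unfolding comps_def by blast

lemma comps_cross:
  assumes "Z \<in> comps t X" "Z' \<in> comps t X" "Z \<noteq> Z'" "x \<in> Z" "y \<in> Z'"
  shows "x \<noteq> y \<and> e x y = t"
proof -
  have "y \<notin> Z" using compsD(4)[OF assms(1), of y] compsD(4)[OF assms(2,5)] assms(3) by blast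
  moreover have "rel t Z (X - Z)" using cpt_rel[of t X x] compsD(4)[OF assms(1,4)] by simp
  ultimately show ?thesis using assms(4,5) compsD(1)[OF assms(2)] relD[of t Z "X - Z" x y] by blast
qed

lemma comps_disjoint: "\<lbrakk>Z \<in> comps t X; Z' \<in> comps t X; Z \<noteq> Z'\<rbrakk> \<Longrightarrow> Z \<inter> Z' = {}"
  using comps_cross by blast

lemma comps_Un: "(\<Union>Z\<in>comps t X. Z) = X"
proof
  show "(\<Union>Z\<in>comps t X. Z) \<subseteq> X" using compsD(1) by blast
  show "X \<subseteq> (\<Union>Z\<in>comps t X. Z)" using comps_cpt[of _ X t] cpt_self[of _ X t] by blast
qed

lemma comps_in:
  assumes "C \<subseteq> X" "\<not> disc t C" "C \<noteq> {}"
  shows "\<exists>Z\<in>comps t X. C \<subseteq> Z"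
proof -
  obtain x where x: "x \<in> C" using assms(3) by blast
  have "x \<in> X" using x assms(1) by blast
  then show ?thesis using cpt_max[OF _ assms(1,2) x] comps_cpt by blast
qed

lemma comps_cut:
  assumes "B \<subseteq> X" "Z \<in> comps t X" "B \<inter> Z \<noteq> {}" "\<not> disc t (B \<inter> Z)"
  shows "B \<inter> Z \<in> comps t B"
proof -
  obtain x where x: "x \<in> B" "x \<in> Z" using assms(3) by blast
  have "B \<inter> Z \<subseteq> cpt t B x" by (rule cpt_max[OF x(1) _ assms(4)]) (use x in blast)+
  moreover have "cpt t B x \<subseteq> B \<inter> Z"
  proof (rule cpt_least)
    have "rel t Z (X - Z)" using cpt_rel[of t X x] compsD(4)[OF assms(2) x(2)] by simp
    then show "rel t (B \<inter> Z) (B - B \<inter> Z)" using assms(1) unfolding rel_def by blast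
  qed (use x in blast)+
  ultimately have "B \<inter> Z = cpt t B x" by blast
  then show ?thesis using comps_cpt[OF x(1)] by simp
qed

lemma comps_strong: "\<lbrakk>disc t X; Z \<in> comps t X\<rbrakk> \<Longrightarrow> strong Z X"
  unfolding comps_def using strong_cpt[OF modl_self] by blast

lemma comps_img:
  assumes "emb f X Y" "f ` X = Y" "Z \<in> comps t X"
  shows "f ` Z \<in> comps t Y"
proof -
  obtain x where x: "x \<in> Z" using compsD(2)[OF assms(3)] by blast
  have ZX: "Z \<subseteq> X" using compsD(1)[OF assms(3)] .
  have xX: "f x \<in> Y" using x ZX assms(2) by blast
  have n: "\<not> disc t (f ` Z)" using disc_emb_img[OF emb_mono[OF assms(1) ZX subset_refl]] compsD(3)[OF assms(3)] by simp
  have "f ` Z \<subseteq> cpt t Y (f x)" by (rule cpt_max[OF xX _ n]) (use x ZX assms(2) in blast)+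
  moreover have "cpt t Y (f x) \<subseteq> f ` Z"
  proof (rule cpt_least)
    have r: "rel t Z (X - Z)" using cpt_rel[of t X x] compsD(4)[OF assms(3) x] by simp
    have "rel t (f ` Z) (f ` (X - Z))" by (rule rel_img[OF assms(1) r ZX]) auto
    moreover have "f ` (X - Z) = Y - f ` Z" using inj_on_image_set_diff[OF embD(1)[OF assms(1)], of X Z] ZX assms(2) by simp
    ultimately show "rel t (f ` Z) (Y - f ` Z)" by simp
  qed (use x ZX assms(2) in blast)+
  ultimately have "f ` Z = cpt t Y (f x)" by blast
  then show ?thesis using comps_cpt[OF xX] by simp
qed

lemma comps_card_le:
  assumes "ism X Y" "finite {Z\<in>comps t Y. eqm Z K}"
  shows "card {Z\<in>comps t X. eqm Z K} \<le> card {Z\<in>comps t Y. eqm Z K}"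
proof -
  obtain f where f: "emb f X Y" "f ` X = Y" using assms(1) unfolding ism_def by blast
  let ?S = "{Z\<in>comps t X. eqm Z K}"
  have "inj_on ((`) f) ?S"
  proof (rule inj_onI)
    fix Z Z' assume "Z \<in> ?S" "Z' \<in> ?S" "f ` Z = f ` Z'"
    then show "Z = Z'" using inj_on_image_eq_iff[OF embD(1)[OF f(1)], of Z Z'] compsD(1) by blast
  qed
  moreover have "(`) f ` ?S \<subseteq> {Z\<in>comps t Y. eqm Z K}"
  proof (rule image_subsetI)
    fix Z assume "Z \<in> ?S"
    then have Z: "Z \<in> comps t X" "eqm Z K" by blast+
    have "eqm (f ` Z) K" using eqm_trans[OF eqm_sym[OF ism_eqm[OF emb_ism[OF f(1) compsD(1)[OF Z(1)]]]] Z(2)] .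
    then show "f ` Z \<in> {Z\<in>comps t Y. eqm Z K}" using comps_img[OF f Z(1)] by blast
  qed
  ultimately show ?thesis using card_inj_on_le assms(2) by blast
qed

text \<open>The components \<open>Z n\<close> can absorb each other and all components equimorphic to \<open>K\<close>, leaving room for
  exactly \<open>p\<close> components equimorphic to \<open>K\<close>, for every \<open>p\<close>.\<close>

lemma mult:
  fixes Z :: "nat \<Rightarrow> 'a set"
  assumes XU: "X \<subseteq> U"
    and Z: "\<And>n. Z n \<in> comps t X" "inj Z" "\<And>n m. n \<le> m \<Longrightarrow> le (Z n) (Z m)"
    and K: "K \<noteq> {}" "\<not> disc t K" "\<And>n. le K (Z n)" "\<And>n. \<not> le (Z n) K"
  shows "\<not> fin X"
proof -
  define C where "C = {W\<in>comps t X. eqm W K}"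
  have "countable X" using XU ctb countable_subset by blast
  then have "countable C" unfolding C_def comps_def by auto
  then have ci: "inj_on (to_nat_on C) C" by (rule inj_on_to_nat_on)
  have ZC: "Z n \<notin> C" for n using K(4)[of n] unfolding C_def eqm_def by blast
  \<comment> \<open>The \<open>Z n\<close> get even numbers and the components equimorphic to
    \<open>K\<close> odd ones. \<open>W\<close> will be moved into \<open>Z (p + \<nu> W)\<close>,
    which has room for \<open>Z n\<close> because \<open>n \<le> p + 2 * n\<close>.\<close>
  define \<nu> where "\<nu> W = (if W \<in> C then 2 * to_nat_on C W + 1 else 2 * inv Z W)" for W
  define D where "D = C \<union> range Z"
  have \<nu>Z: "\<nu> (Z n) = 2 * n" for n unfolding \<nu>_def using ZC Z(2) by simp
  have \<nu>C: "\<nu> W = 2 * to_nat_on C W + 1" if "W \<in> C" for W unfolding \<nu>_def using that by simp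
  have \<nu>i: "W = W'" if "W \<in> D" "W' \<in> D" "\<nu> W = \<nu> W'" for W W'
  proof -
    consider n m where "W = Z n" "W' = Z m" | n where "W = Z n" "W' \<in> C" | n where "W \<in> C" "W' = Z n" | "W \<in> C" "W' \<in> C"
      using \<open>W \<in> D\<close> \<open>W' \<in> D\<close> unfolding D_def by blast
    then show ?thesis
    proof cases
      case 1 then show ?thesis using that(3) \<nu>Z by simp
    next
      case 2 then have "2 * n = 2 * to_nat_on C W' + 1" using that(3) \<nu>Z \<nu>C by metis
      then show ?thesis by presburger
    next
      case 3 then have "2 * n = 2 * to_nat_on C W + 1" using that(3) \<nu>Z \<nu>C by metis
      then show ?thesis by presburger
    next
      case 4 then have "to_nat_on C W = to_nat_on C W'" using that(3) \<nu>C by simp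
      then show ?thesis using ci 4 unfolding inj_on_def by blast
    qed
  qed
  have DX: "D \<subseteq> comps t X" unfolding D_def C_def using Z(1) by blast
  define k where "k n = (SOME f. emb f K (Z n))" for n
  have k: "emb (k n) K (Z n)" for n unfolding k_def
    by (rule someI_ex[of "\<lambda>f. emb f K (Z n)"]) (use K(3)[of n] in \<open>simp add: le_def\<close>)
  define \<kappa> where "\<kappa> n = k n ` K" for n
  have \<kappa>: "\<kappa> n \<subseteq> Z n" "\<kappa> n \<noteq> {}" "\<not> disc t (\<kappa> n)" "eqm (\<kappa> n) K" for n
    using embD(2)[OF k] K(1,2) disc_emb_img[OF k] eqm_sym[OF ism_eqm[OF emb_ism[OF k subset_refl]]] unfolding \<kappa>_def by blast+
  \<comment> \<open>The first \<open>p\<close> of the \<open>Z n\<close> are cut down to copies of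
    \<open>K\<close>, and all original components equimorphic to \<open>K\<close> are
    dropped.\<close>
  define B where "B p = (X - \<Union>D) \<union> (\<Union>n\<in>{p..}. Z n) \<union> (\<Union>n\<in>{..<p}. \<kappa> n)" for p
  have ZX: "Z n \<subseteq> X" for n using compsD(1)[OF Z(1)] .
  have BX: "B p \<subseteq> X" for p unfolding B_def using ZX \<kappa>(1) by blast
  have dj: "V \<inter> W = {}" if "V \<in> comps t X" "W \<in> comps t X" "V \<noteq> W" for V W using comps_disjoint that by blast
  have Zd: "Z n \<inter> Z m = {}" if "n \<noteq> m" for n m using dj[OF Z(1) Z(1)] that Z(2) unfolding inj_def by blast
  have b1: "B p \<inter> V = V" if "V \<in> comps t X" "V \<notin> D" for p V
  proof -
    have "V \<inter> \<Union>D = {}" using dj[OF that(1)] that(2) DX by blast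
    then show ?thesis using compsD(1)[OF that(1)] unfolding B_def by blast
  qed
  have b2: "B p \<inter> Z n = Z n" if "p \<le> n" for p n using that unfolding B_def by auto
  have b3: "B p \<inter> Z n = \<kappa> n" if np: "n < p" for p n
  proof
    show "\<kappa> n \<subseteq> B p \<inter> Z n" using np \<kappa>(1) unfolding B_def by blast
    show "B p \<inter> Z n \<subseteq> \<kappa> n"
    proof
      fix x assume x: "x \<in> B p \<inter> Z n"
      have "x \<notin> X - \<Union>D" using x unfolding D_def by blast
      moreover have "x \<notin> Z m" if "p \<le> m" for m using Zd[of n m] x np that by auto
      ultimately obtain m where "x \<in> \<kappa> m" using x unfolding B_def by auto
      then have "m = n" using Zd[of n m] x \<kappa>(1) by blast
      then show "x \<in> \<kappa> n" using \<open>x \<in> \<kappa> m\<close> by simp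
    qed
  qed
  have b4: "B p \<inter> V = {}" if V: "V \<in> C" for p V
  proof -
    have "V \<inter> Z n = {}" for n using dj[OF _ Z(1)[of n], of V] V ZC[of n] unfolding C_def by blast
    then show ?thesis using V \<kappa>(1) unfolding B_def D_def by blast
  qed
  have BS: "B p \<in> Sib X" for p
  proof -
    define \<tau> where "\<tau> W = (if W \<in> D then Z (p + \<nu> W) else W)" for W
    have \<tau>c: "\<tau> W \<in> comps t X" if "W \<in> comps t X" for W using that Z(1) unfolding \<tau>_def by simp
    have \<tau>i: "\<tau> W \<noteq> \<tau> W'" if "W \<noteq> W'" for W W'
    proof
      assume a: "\<tau> W = \<tau> W'"
      consider "W \<in> D" "W' \<in> D" | "W \<in> D" "W' \<notin> D" | "W \<notin> D" "W' \<in> D" | "W \<notin> D" "W' \<notin> D" by blast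
      then show False
      proof cases
        case 1
        then have "p + \<nu> W = p + \<nu> W'" using a Z(2) unfolding \<tau>_def by (simp add: inj_eq)
        then show ?thesis using \<nu>i[OF 1] that by simp
      next
        case 2 then show ?thesis using a unfolding \<tau>_def D_def by auto
      next
        case 3 then show ?thesis using a unfolding \<tau>_def D_def by auto
      next
        case 4 then show ?thesis using a that unfolding \<tau>_def by simp
      qed
    qed
    have ex: "\<exists>h. emb h W (B p \<inter> \<tau> W)" if W: "W \<in> comps t X" for W
    proof (cases "W \<in> D")
      case True
      have "le W (Z (p + \<nu> W))"
      proof (cases "W \<in> C")
        case True
        then have "le W K" unfolding C_def eqm_def by blast
        then show ?thesis using K(3) le_trans by blast
      next
        case False
        then obtain n where n: "W = Z n" using \<open>W \<in> D\<close> unfolding D_def by blast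
        show ?thesis unfolding n \<nu>Z by (rule Z(3)) simp
      qed
      moreover have "B p \<inter> \<tau> W = Z (p + \<nu> W)" using True b2[of p "p + \<nu> W"] unfolding \<tau>_def by simp
      ultimately show ?thesis unfolding le_def by simp
    next
      case False
      then show ?thesis using b1[OF W False] emb_id[of W W] unfolding \<tau>_def by auto
    qed
    define h where "h W = (SOME h. emb h W (B p \<inter> \<tau> W))" for W
    have h: "emb (h W) W (B p \<inter> \<tau> W)" if "W \<in> comps t X" for W
      unfolding h_def by (rule someI_ex[of "\<lambda>h. emb h W (B p \<inter> \<tau> W)"]) (rule ex[OF that])
    obtain F where F: "emb F (\<Union>W\<in>comps t X. W) (\<Union>W\<in>comps t X. B p \<inter> \<tau> W)"
    proof (rule pieces[of "comps t X" "\<lambda>W. W" h "\<lambda>W. B p \<inter> \<tau> W"])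
      show "V \<inter> W = {}" if "V \<in> comps t X" "W \<in> comps t X" "V \<noteq> W" for V W using dj that .
      show "emb (h W) W (B p \<inter> \<tau> W)" if "W \<in> comps t X" for W using h that .
      fix V W x y assume a: "V \<in> comps t X" "W \<in> comps t X" "V \<noteq> W" "x \<in> V" "y \<in> W"
      have "h V x \<in> \<tau> V" "h W y \<in> \<tau> W" using embD(2)[OF h[OF a(1)] a(4)] embD(2)[OF h[OF a(2)] a(5)] by blast+
      then show "h V x \<noteq> h W y \<and> e (h V x) (h W y) = e x y"
        using comps_cross[OF a] comps_cross[OF \<tau>c[OF a(1)] \<tau>c[OF a(2)] \<tau>i[OF a(3)]] by metis
    qed (rule that)
    have "emb F X (B p)" by (rule emb_mono[OF F]) (use comps_Un in blast)+
    then show ?thesis using SibI[OF BX] by blast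
  qed
  have count: "{W\<in>comps t (B p). eqm W K} = \<kappa> ` {..<p}" for p
  proof
    show "\<kappa> ` {..<p} \<subseteq> {W\<in>comps t (B p). eqm W K}"
    proof (rule image_subsetI)
      fix n assume "n \<in> {..<p}"
      then have n: "B p \<inter> Z n = \<kappa> n" using b3 by blast
      have "B p \<inter> Z n \<in> comps t (B p)" by (rule comps_cut[OF BX Z(1)]) (use n \<kappa> in simp_all)
      then show "\<kappa> n \<in> {W\<in>comps t (B p). eqm W K}" using n \<kappa>(4) by simp
    qed
    show "{W\<in>comps t (B p). eqm W K} \<subseteq> \<kappa> ` {..<p}"
    proof
      fix W assume "W \<in> {W\<in>comps t (B p). eqm W K}"
      then have W: "W \<in> comps t (B p)" "eqm W K" by blast+
      obtain x where x: "x \<in> W" using compsD(2)[OF W(1)] by blast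
      have xB: "x \<in> B p" using x compsD(1)[OF W(1)] by blast
      then have xX: "x \<in> X" using BX by blast
      define V where "V = cpt t X x"
      have V: "V \<in> comps t X" "x \<in> V" unfolding V_def using comps_cpt[OF xX] cpt_self[OF xX] by blast+
      have WV: "W = B p \<inter> V" if "\<not> disc t (B p \<inter> V)"
      proof -
        have "B p \<inter> V \<in> comps t (B p)" using comps_cut[OF BX V(1) _ that] V(2) xB by blast
        then show ?thesis using compsD(4)[OF W(1) x] compsD(4)[of "B p \<inter> V" t "B p" x] V(2) xB by blast
      qed
      consider "V \<notin> D" | "V \<in> C" | n where "V = Z n" "n < p" | n where "V = Z n" "p \<le> n"
        unfolding D_def using not_less by blast
      then show "W \<in> \<kappa> ` {..<p}"
      proof cases
        case 1
        then have "W = V" using WV b1[OF V(1) 1] compsD(3)[OF V(1)] by simp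
        then have "V \<in> C" using V(1) W(2) unfolding C_def by simp
        then show ?thesis using 1 unfolding D_def by blast
      next
        case 2 then show ?thesis using b4[OF 2, of p] xB V(2) by blast
      next
        case 3
        then have "W = \<kappa> n" using WV b3[OF 3(2)] \<kappa>(3) by simp
        then show ?thesis using 3 by blast
      next
        case 4
        then have "W = Z n" using WV b2[OF 4(2)] compsD(3)[OF Z(1)] by simp
        then show ?thesis using W(2) K(4)[of n] unfolding eqm_def by blast
      qed
    qed
  qed
  have card: "card {W\<in>comps t (B p). eqm W K} = p" "finite {W\<in>comps t (B p). eqm W K}" for p
  proof -
    have "inj_on \<kappa> {..<p}"
    proof (rule inj_onI)
      fix i j assume "\<kappa> i = \<kappa> j"
      then show "i = j" using Zd[of i j] \<kappa>(1)[of i] \<kappa>(1)[of j] \<kappa>(2)[of i] by blast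
    qed
    then show "card {W\<in>comps t (B p). eqm W K} = p" "finite {W\<in>comps t (B p). eqm W K}" unfolding count by (simp_all add: card_image)
  qed
  show ?thesis
  proof (rule not_fin_seq[OF BS])
    fix p q assume i: "ism (B p) (B q)"
    show "p = q" using comps_card_le[OF i card(2)] comps_card_le[OF ism_sym[OF i] card(2)] unfolding card(1) by simp
  qed
qed

text \<open>\<open>Z\<close> embeds into itself via \<open>Z1\<close>, and the image under
  \<open>f\<close> of a vertex of \<open>Z2\<close> is left over and related by \<open>t\<close> to
  everything reached; this is excluded by \<open>soft\<close>.\<close>

lemma comps_soft:
  assumes "X \<subseteq> U" "fin X" "disc t X" "emb f X X" "Z1 \<in> comps t X" "Z2 \<in> comps t X" "Z1 \<noteq> Z2" "Z \<in> comps t X"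
    "f ` Z1 \<subseteq> Z" "f ` Z2 \<subseteq> Z" "le Z Z1"
  shows False
proof -
  obtain k where k: "emb k Z Z1" using assms(11) unfolding le_def by blast
  have f1: "emb f Z1 Z" using emb_mono[OF emb_image[OF assms(4) compsD(1)[OF assms(5)]] subset_refl assms(9)] .
  have fk: "emb (f \<circ> k) Z Z" using emb_comp[OF k f1] .
  obtain z where z: "z \<in> Z2" using compsD(2)[OF assms(6)] by blast
  have zX: "z \<in> X" using z compsD(1)[OF assms(6)] by blast
  have *: "f z \<noteq> f y \<and> e (f z) (f y) = t" if "y \<in> Z1" for y
    using comps_cross[OF assms(6,5) assms(7)[symmetric] z that] embD(3,4)[OF assms(4) zX, of y] that compsD(1)[OF assms(5)] by blast
  have "f z \<notin> (f \<circ> k) ` Z" using * embD(2)[OF k] by auto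
  moreover have "rel t {f z} ((f \<circ> k) ` Z)" using * embD(2)[OF k] unfolding rel_def by auto
  ultimately show False
    using soft[OF assms(1,2) comps_strong[OF assms(3,8)] compsD(3)[OF assms(8)] fk] assms(10) z by blast
qed

lemma orbit_le:
  assumes "emb f X X" "\<And>n. Y n \<subseteq> X" "\<And>n. f ` Y n \<subseteq> Y (Suc n)" "n \<le> m"
  shows "le (Y n) (Y m)"
  using assms(4)
proof (induction m rule: dec_induct)
  case base show ?case by (rule le_refl) simp
next
  case (step m)
  have "le (Y m) (Y (Suc m))" unfolding le_def
    using emb_mono[OF emb_image[OF assms(1,2)] subset_refl assms(3)] by blast
  then show ?case using step le_trans by blast
qed

text \<open>At a first coincidence two different components are mapped into the same one, which
  embeds into the later of the two; \<open>comps_soft\<close> excludes this.\<close>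

lemma orbit_inj:
  assumes "X \<subseteq> U" "fin X" "disc t X" "emb f X X" and Y: "\<And>n. Y n \<in> comps t X" "\<And>n. f ` Y n \<subseteq> Y (Suc n)" "\<And>n. 0 < n \<Longrightarrow> Y n \<noteq> Y 0"
  shows "inj Y"
proof -
  have lem: "le (Y n) (Y m)" if "n \<le> m" for n m by (rule orbit_le[of f X Y, OF assms(4) compsD(1)[OF Y(1)] Y(2) that])
  have "Y i \<noteq> Y j" if "i < j" for i j
    using that
  proof (induction i arbitrary: j)
    case 0 then show ?case using Y(3)[of j] by auto
  next
    case (Suc i)
    then obtain j' where j': "j = Suc j'" "i < j'" by (metis Suc_lessE)
    show ?case
    proof
      assume a: "Y (Suc i) = Y j"
      have ne: "Y j' \<noteq> Y i" using Suc.IH[OF j'(2)] by simp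
      show False
        by (rule comps_soft[OF assms(1-4) Y(1) Y(1) ne Y(1)[of "Suc i"] _ Y(2)]) (use a j' Y(2)[of j'] lem[of "Suc i" j'] in simp_all)
    qed
  qed
  then show ?thesis by (metis injI nat_neq_iff)
qed

text \<open>\<open>f\<close> induces a map \<open>\<phi>\<close> on the components, and
  \<open>mult\<close> restricts its orbits: with \<open>K = Z\<close> it shows that
  \<open>\<phi> Z\<close> embeds into \<open>Z\<close>, with \<open>K\<close> a single vertex that
  every larger component is in the range of \<open>\<phi>\<close>. Hence each larger component meets
  \<open>A\<close> in a sibling of itself. Single vertices may be left out by \<open>f\<close>, but
  they only have to be counted.\<close>

lemma sum_one:
  assumes XU: "X \<subseteq> U" and fX: "fin X" and d: "disc t X" and o: "\<And>Z. Z \<in> comps t X \<Longrightarrow> one Z"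
  shows "one X"
  unfolding one_def
proof
  fix A assume A: "A \<in> Sib X"
  obtain f where f: "emb f X A" and AX: "A \<subseteq> X" using A unfolding Sib_def le_def by blast
  have fX': "emb f X X" using emb_mono[OF f subset_refl AX] .
  define \<phi> where "\<phi> Z = (SOME W. W \<in> comps t X \<and> f ` Z \<subseteq> W)" for Z
  have \<phi>: "\<phi> Z \<in> comps t X" "f ` Z \<subseteq> \<phi> Z" if Z: "Z \<in> comps t X" for Z
  proof -
    have "\<not> disc t (f ` Z)" using disc_emb_img[OF emb_mono[OF f compsD(1)[OF Z] subset_refl]] compsD(3)[OF Z] by simp
    moreover have "f ` Z \<subseteq> X" "f ` Z \<noteq> {}" using embD(2)[OF fX'] compsD(1,2)[OF Z] by blast+
    ultimately have "\<exists>W. W \<in> comps t X \<and> f ` Z \<subseteq> W" using comps_in by blast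
    from someI_ex[OF this] show "\<phi> Z \<in> comps t X" "f ` Z \<subseteq> \<phi> Z" unfolding \<phi>_def by blast+
  qed
  have orb: "(\<phi> ^^ n) Z \<in> comps t X" if "Z \<in> comps t X" for n Z by (induction n) (use that \<phi>(1) in auto)
  have orb2: "f ` (\<phi> ^^ n) Z \<subseteq> (\<phi> ^^ Suc n) Z" if "Z \<in> comps t X" for n Z using \<phi>(2)[OF orb[OF that]] by simp
  have orble: "le ((\<phi> ^^ n) Z) ((\<phi> ^^ m) Z)" if "Z \<in> comps t X" "n \<le> m" for n m Z
    using orbit_le[of f X "\<lambda>n. (\<phi> ^^ n) Z", OF fX' compsD(1)[OF orb[OF that(1)]] orb2[OF that(1)] that(2)] .
  have I: "le (\<phi> Z) Z" if Z: "Z \<in> comps t X" for Z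
  proof (rule ccontr)
    assume n: "\<not> le (\<phi> Z) Z"
    have pos: "\<not> le ((\<phi> ^^ Suc n) Z) Z" for n
    proof
      assume "le ((\<phi> ^^ Suc n) Z) Z"
      then show False using le_trans[OF orble[OF Z, of 1 "Suc n"]] n by simp
    qed
    have "(\<phi> ^^ n) Z \<noteq> (\<phi> ^^ 0) Z" if "0 < n" for n
      using pos[of "n - 1"] that le_refl[of Z Z] by (cases n) auto
    then have inj: "inj (\<lambda>n. (\<phi> ^^ n) Z)" using orbit_inj[of X t f "\<lambda>n. (\<phi> ^^ n) Z", OF XU fX d fX' orb[OF Z] orb2[OF Z]] by blast
    have "\<not> fin X"
    proof (rule mult[OF XU, of "\<lambda>n. (\<phi> ^^ Suc n) Z" t Z])
      show "inj (\<lambda>n. (\<phi> ^^ Suc n) Z)"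
      proof (rule injI)
        fix n m assume "(\<phi> ^^ Suc n) Z = (\<phi> ^^ Suc m) Z"
        then have "Suc n = Suc m" by (rule injD[OF inj])
        then show "n = m" by simp
      qed
      show "le Z ((\<phi> ^^ Suc n) Z)" for n using orble[OF Z, of 0 "Suc n"] by simp
      show "Z \<noteq> {}" "\<not> disc t Z" using compsD(2,3)[OF Z] by blast+
      show "(\<phi> ^^ Suc n) Z \<in> comps t X" for n by (rule orb[OF Z])
      show "le ((\<phi> ^^ Suc n) Z) ((\<phi> ^^ Suc m) Z)" if "n \<le> m" for n m by (rule orble[OF Z]) (use that in simp)
      show "\<not> le ((\<phi> ^^ Suc n) Z) Z" for n by (rule pos)
    qed
    then show False using fX by blast
  qed
  have II: "Z \<in> \<phi> ` comps t X" if Z: "Z \<in> comps t X" and ns: "\<And>x. Z \<noteq> {x}" for Z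
  proof (rule ccontr)
    assume n: "Z \<notin> \<phi> ` comps t X"
    have "(\<phi> ^^ n) Z \<noteq> (\<phi> ^^ 0) Z" if n0: "0 < n" for n
    proof -
      obtain m where m: "n = Suc m" using n0 gr0_conv_Suc by blast
      have "(\<phi> ^^ n) Z \<in> \<phi> ` comps t X" unfolding m using orb[OF Z, of m] by simp
      then show ?thesis using n by auto
    qed
    then have inj: "inj (\<lambda>n. (\<phi> ^^ n) Z)" using orbit_inj[of X t f "\<lambda>n. (\<phi> ^^ n) Z", OF XU fX d fX' orb[OF Z] orb2[OF Z]] by blast
    obtain x where x: "x \<in> Z" using compsD(2)[OF Z] by blast
    have lz: "le Z ((\<phi> ^^ n) Z)" for n using orble[OF Z, of 0 n] by simp
    have "\<not> fin X"
    proof (rule mult[OF XU, of "\<lambda>n. (\<phi> ^^ n) Z" t "{x}"])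
      show "le {x} ((\<phi> ^^ n) Z)" for n using le_trans[OF le_refl[of "{x}" Z] lz] x by blast
      show "\<not> disc t {x}" unfolding disc_def by (auto simp: Un_singleton_iff)
      show "\<not> le ((\<phi> ^^ n) Z) {x}" for n
      proof
        assume "le ((\<phi> ^^ n) Z) {x}"
        then obtain g where g: "emb g Z {x}" using le_trans[OF lz] unfolding le_def by blast
        obtain y where "y \<in> Z" "y \<noteq> x" using x ns[of x] by blast
        then show False using embD(2)[OF g] embD(4)[OF g, of x y] x by blast
      qed
    qed (use inj orb[OF Z] orble[OF Z] in auto)
    then show False using fX by blast
  qed
  have iso: "ism Z (A \<inter> Z)" if Z: "Z \<in> comps t X" and ns: "\<And>x. Z \<noteq> {x}" for Z
  proof -
    obtain W where W: "W \<in> comps t X" "Z = \<phi> W" using II[OF Z ns] by blast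
    obtain g where g: "emb g Z W" using I[OF W(1)] W(2) unfolding le_def by blast
    have "emb f W (A \<inter> Z)"
      by (rule emb_mono[OF emb_image[OF f compsD(1)[OF W(1)]] subset_refl]) (use \<phi>(2)[OF W(1)] W(2) embD(2)[OF f] compsD(1)[OF W(1)] in blast)
    then have "A \<inter> Z \<in> Sib Z" using SibI[OF _ emb_comp[OF g]] by blast
    then show ?thesis using oneD[OF o[OF Z]] ism_sym by blast
  qed
  define S where "S = {x\<in>X. {x} \<in> comps t X}"
  have fS: "f ` S \<subseteq> A \<inter> S"
  proof (rule image_subsetI)
    fix x assume "x \<in> S"
    then have x: "{x} \<in> comps t X" "x \<in> X" unfolding S_def by blast+
    obtain g where g: "emb g (\<phi> {x}) {x}" using I[OF x(1)] unfolding le_def by blast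
    have fx: "f x \<in> \<phi> {x}" using \<phi>(2)[OF x(1)] by blast
    have "y = f x" if "y \<in> \<phi> {x}" for y using embD(2)[OF g that] embD(2)[OF g fx] embD(4)[OF g that fx] by auto
    then have "\<phi> {x} = {f x}" using fx by blast
    then show "f x \<in> A \<inter> S" using \<phi>(1)[OF x(1)] embD(2)[OF f x(2)] AX unfolding S_def by auto
  qed
  have SX: "S \<subseteq> X" unfolding S_def by blast
  have "\<exists>b. bij_betw b S (A \<inter> S)"
    by (rule Schroeder_Bernstein[OF inj_on_subset[OF embD(1)[OF f] SX] fS inj_on_id]) auto
  then obtain b where b: "bij_betw b S (A \<inter> S)" by blast
  define \<psi> where "\<psi> Z = (if \<exists>x. Z = {x} then b else SOME h. emb h Z (A \<inter> Z) \<and> h ` Z = A \<inter> Z)" for Z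
  have \<psi>1: "\<psi> {x} = b" for x unfolding \<psi>_def by simp
  have \<psi>2: "emb (\<psi> Z) Z (A \<inter> Z)" "\<psi> Z ` Z = A \<inter> Z" if Z: "Z \<in> comps t X" and ns: "\<And>x. Z \<noteq> {x}" for Z
  proof -
    have e: "\<exists>h. emb h Z (A \<inter> Z) \<and> h ` Z = A \<inter> Z" using iso[OF that] unfolding ism_def .
    have "\<psi> Z = (SOME h. emb h Z (A \<inter> Z) \<and> h ` Z = A \<inter> Z)" unfolding \<psi>_def using ns by simp
    then show "emb (\<psi> Z) Z (A \<inter> Z)" "\<psi> Z ` Z = A \<inter> Z" using someI_ex[OF e] by simp_all
  qed
  have bS: "b x \<in> A \<inter> S" if "x \<in> S" for x using b that unfolding bij_betw_def by blast
  have sS: "x \<in> S" if "{x} \<in> comps t X" for x using that compsD(1)[OF that] unfolding S_def by blast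
  define \<tau> where "\<tau> Z = (if \<exists>x. Z = {x} then b ` Z else Z)" for Z
  have \<tau>1: "\<tau> {x} = {b x}" for x unfolding \<tau>_def by simp
  have \<tau>2: "\<tau> Z = Z" if "\<And>x. Z \<noteq> {x}" for Z unfolding \<tau>_def using that by simp
  have \<tau>c: "\<tau> Z \<in> comps t X" if Z: "Z \<in> comps t X" for Z
  proof (cases "\<exists>x. Z = {x}")
    case True
    then obtain x where x: "Z = {x}" by blast
    have "b x \<in> S" using bS[OF sS[of x]] Z x by blast
    then show ?thesis unfolding x \<tau>1 S_def by blast
  qed (use Z in \<open>simp add: \<tau>_def\<close>)
  have \<tau>i: "\<tau> Z \<noteq> \<tau> W" if Z: "Z \<in> comps t X" "W \<in> comps t X" "Z \<noteq> W" for Z W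
  proof (cases "\<exists>x. Z = {x}")
    case z: True
    then obtain x where x: "Z = {x}" by blast
    show ?thesis
    proof (cases "\<exists>x. W = {x}")
      case True
      then obtain y where y: "W = {y}" by blast
      have "x \<in> S" "y \<in> S" "x \<noteq> y" using sS[of x] sS[of y] Z x y by blast+
      then have "b x \<noteq> b y" using b unfolding bij_betw_def inj_on_def by blast
      then show ?thesis unfolding x y \<tau>1 by simp
    next
      case False then show ?thesis unfolding x \<tau>1 using \<tau>2[of W] by auto
    qed
  next
    case z: False
    then show ?thesis using \<tau>2[of Z] Z(3) \<tau>1 \<tau>2[of W] by metis
  qed
  have \<psi>\<tau>: "emb (\<psi> Z) Z (A \<inter> \<tau> Z)" if Z: "Z \<in> comps t X" for Z
  proof (cases "\<exists>x. Z = {x}")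
    case True
    then obtain x where x: "Z = {x}" by blast
    have "b x \<in> A" using bS[OF sS[of x]] Z x by blast
    then show ?thesis unfolding x \<tau>1 \<psi>1 emb_def by simp
  next
    case False then show ?thesis using \<psi>2(1)[OF Z] \<tau>2[of Z] by auto
  qed
  obtain F where F: "emb F (\<Union>Z\<in>comps t X. Z) (\<Union>Z\<in>comps t X. A \<inter> \<tau> Z)" "F ` (\<Union>Z\<in>comps t X. Z) = (\<Union>Z\<in>comps t X. \<psi> Z ` Z)"
  proof (rule pieces[of "comps t X" "\<lambda>Z. Z" \<psi> "\<lambda>Z. A \<inter> \<tau> Z"])
    show "V \<inter> W = {}" if "V \<in> comps t X" "W \<in> comps t X" "V \<noteq> W" for V W using comps_disjoint that .
    show "emb (\<psi> W) W (A \<inter> \<tau> W)" if "W \<in> comps t X" for W using \<psi>\<tau> that .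
    fix V W x y assume a: "V \<in> comps t X" "W \<in> comps t X" "V \<noteq> W" "x \<in> V" "y \<in> W"
    have "\<psi> V x \<in> \<tau> V" "\<psi> W y \<in> \<tau> W" using embD(2)[OF \<psi>\<tau>[OF a(1)] a(4)] embD(2)[OF \<psi>\<tau>[OF a(2)] a(5)] by blast+
    then show "\<psi> V x \<noteq> \<psi> W y \<and> e (\<psi> V x) (\<psi> W y) = e x y"
      using comps_cross[OF a] comps_cross[OF \<tau>c[OF a(1)] \<tau>c[OF a(2)] \<tau>i[OF a(1-3)]] by metis
  qed (rule that)
  have im: "(\<Union>Z\<in>comps t X. \<psi> Z ` Z) = A"
  proof
    show "(\<Union>Z\<in>comps t X. \<psi> Z ` Z) \<subseteq> A" using embD(2)[OF \<psi>\<tau>] by blast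
    show "A \<subseteq> (\<Union>Z\<in>comps t X. \<psi> Z ` Z)"
    proof
      fix a assume a: "a \<in> A"
      then have aX: "a \<in> X" using AX by blast
      define Z where "Z = cpt t X a"
      have Z: "Z \<in> comps t X" "a \<in> Z" unfolding Z_def using comps_cpt[OF aX] cpt_self[OF aX] by blast+
      show "a \<in> (\<Union>Z\<in>comps t X. \<psi> Z ` Z)"
      proof (cases "\<exists>x. Z = {x}")
        case True
        then have "a \<in> A \<inter> S" using Z a sS[of a] by auto
        then obtain x where x: "x \<in> S" "a = b x" using b unfolding bij_betw_def by blast
        then have "{x} \<in> comps t X" "a \<in> \<psi> {x} ` {x}" unfolding \<psi>1 S_def by auto
        then show ?thesis by blast
      next
        case False
        then have "\<psi> Z ` Z = A \<inter> Z" using \<psi>2(2)[OF Z(1)] by blast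
        then show ?thesis using Z a by blast
      qed
    qed
  qed
  have "emb F X A" "F ` X = A" using F im emb_image[OF F(1) subset_refl] unfolding comps_Un by auto
  then have "ism X A" unfolding ism_def by blast
  then show "ism A X" by (rule ism_sym)
qed

section \<open>Towers\<close>

text \<open>A module of the new graph that misses \<open>J\<close> is a module of \<open>X\<close>;
  one that meets \<open>J\<close> becomes a module of \<open>X\<close> when \<open>Q\<close> is
  added. In both cases it can be compared with \<open>S\<close> in \<open>X\<close>.\<close>

lemma strong_outside:
  assumes S: "strong S X" and Q: "modl Q X" and SQ: "S \<inter> Q = {}" and J: "J \<noteq> {}" "J \<subseteq> Q"
  shows "strong S ((X - Q) \<union> J)"
proof -
  let ?Y = "(X - Q) \<union> J"
  have YX: "?Y \<subseteq> X" using J(2) modlD(1)[OF Q] by blast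
  have SY: "S \<subseteq> ?Y" using SQ strongD(2)[OF S] by blast
  have mS: "modl S ?Y" by (rule modl_sub[OF strongD(1)[OF S] SY YX])
  have "Q \<inter> ?Y = J" using J(2) by blast
  then have mJ: "modl J ?Y" using modl_restrict[OF Q YX] J(1) by simp
  have mX: "modl T X" if T: "modl T ?Y" "T \<inter> J = {}" for T
  proof (rule modlI)
    have TQ: "T \<inter> Q = {}" using modlD(1)[OF T(1)] T(2) by blast
    show "T \<subseteq> X" "T \<noteq> {}" using modlD(1,2)[OF T(1)] YX by blast+
    fix z a b assume z: "z \<in> X" "z \<notin> T" and ab: "a \<in> T" "b \<in> T"
    obtain j where j: "j \<in> J" using J(1) by blast
    have aX: "a \<in> X" "a \<notin> Q" "b \<in> X" "b \<notin> Q" using ab modlD(1)[OF T(1)] YX TQ by blast+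
    show "e z a = e z b"
    proof (cases "z \<in> Q")
      case True
      have jQ: "j \<in> Q" using j J(2) by blast
      have "e a z = e a j" "e b z = e b j" using modlD(3)[OF Q aX(1,2) True jQ] modlD(3)[OF Q aX(3,4) True jQ] .
      moreover have "e j a = e j b" using modlD(3)[OF T(1) _ _ ab, of j] j T(2) by blast
      ultimately show ?thesis using esym[of a z] esym[of b z] esym[of a j] esym[of b j] by simp
    next
      case False
      then show ?thesis using modlD(3)[OF T(1) _ z(2) ab] z(1) by blast
    qed
  qed
  have mXQ: "modl (T \<union> Q) X" if T: "modl T ?Y" "J \<subseteq> T" for T
  proof (rule modlI)
    show "T \<union> Q \<subseteq> X" "T \<union> Q \<noteq> {}" using modlD(1,2)[OF T(1)] YX modlD(1)[OF Q] by blast+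
    fix z a b assume z: "z \<in> X" "z \<notin> T \<union> Q" and ab: "a \<in> T \<union> Q" "b \<in> T \<union> Q"
    obtain j where j: "j \<in> J" using J(1) by blast
    have zz: "z \<in> X" "z \<notin> Q" "z \<in> ?Y" "z \<notin> T" using z by blast+
    have "e z c = e z j" if "c \<in> T \<union> Q" for c
    proof (cases "c \<in> T")
      case True then show ?thesis using modlD(3)[OF T(1) zz(3,4) True, of j] j T(2) by blast
    next
      case False
      then have "c \<in> Q" using that by blast
      then show ?thesis using modlD(3)[OF Q zz(1,2), of c j] j J(2) by blast
    qed
    then show "e z a = e z b" using ab by simp
  qed
  have "T \<subseteq> S \<or> S \<subseteq> T \<or> T \<inter> S = {}" if T: "modl T ?Y" for T
  proof (cases "T \<inter> J = {}")
    case True then show ?thesis using strongD(5)[OF S mX[OF T True]] by blast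
  next
    case False
    have "modl (T \<union> J) ?Y" by (rule modl_union[OF T mJ False])
    then have "modl (T \<union> J \<union> Q) X" using mXQ by blast
    from strongD(5)[OF S this] have "S \<subseteq> T \<union> J \<union> Q \<or> (T \<union> J \<union> Q) \<inter> S = {}" using SQ J by blast
    then show ?thesis using SQ J(2) by blast
  qed
  then show ?thesis using mS unfolding strong_def by blast
qed

lemma strong_rep:
  assumes "strong M X" "K \<subseteq> M" "K \<noteq> {}" "strong T ((X - M) \<union> K)"
  shows "T \<inter> K = {} \<Longrightarrow> strong T X" "K \<subseteq> T \<Longrightarrow> strong (T \<union> M) X"
proof -
  have Rp: "Rp X {M} (\<lambda>_. K) = X - \<Union>{M} \<union> \<Union>((\<lambda>_. K) ` {M})" by (rule Rp_def) (use assms in auto)+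
  have upd: "up {M} (\<lambda>_. K) T = T \<union> \<Union>{N\<in>{M}. K \<subseteq> T}" by (rule up_def) (use assms in auto)+
  have satd: "sat {M} (\<lambda>_. K) T = (\<forall>N\<in>{M}. K \<subseteq> T \<or> T \<inter> K = {})" by (rule sat_def) (use assms in auto)+
  have "strong T (Rp X {M} (\<lambda>_. K))" using assms(4) Rp by simp
  then have su: "strong (up {M} (\<lambda>_. K) T) X" if "sat {M} (\<lambda>_. K) T"
    using strong_up[of "{M}" X "\<lambda>_. K" T] assms that by auto
  show "strong T X" if "T \<inter> K = {}"
  proof -
    have "up {M} (\<lambda>_. K) T = T" using that assms(3) unfolding upd by auto
    then show ?thesis using su that unfolding satd by simp
  qed
  show "strong (T \<union> M) X" if "K \<subseteq> T"
  proof -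
    have "up {M} (\<lambda>_. K) T = T \<union> M" using that unfolding upd by auto
    then show ?thesis using su that unfolding satd by simp
  qed
qed

lemma pieces_nat:
  fixes P P' :: "nat \<Rightarrow> 'a set"
  assumes d: "\<And>i j. i < j \<Longrightarrow> P i \<inter> P j = {}" and d': "\<And>i j. i < j \<Longrightarrow> P' i \<inter> P' j = {}"
    and m: "\<And>i. emb (\<phi> i) (P i) (P' i)" "\<And>i. \<phi> i ` P i = P' i"
    and c: "\<And>i j x y. \<lbrakk>i < j; x \<in> P i; y \<in> P j\<rbrakk> \<Longrightarrow> e (\<phi> i x) (\<phi> j y) = e x y"
  shows "ism (\<Union>i. P i) (\<Union>i. P' i)"
proof -
  obtain F where F: "emb F (\<Union>i\<in>UNIV. P i) (\<Union>i\<in>UNIV. P' i)" "F ` (\<Union>i\<in>UNIV. P i) = (\<Union>i\<in>UNIV. \<phi> i ` P i)"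
  proof (rule pieces[of UNIV P \<phi> P'])
    show "P i \<inter> P j = {}" if "i \<noteq> j" for i j using d[of i j] d[of j i] that by (cases i j rule: linorder_cases) auto
    show "emb (\<phi> i) (P i) (P' i)" for i by (rule m(1))
    fix i j x y assume a: "i \<noteq> j" "x \<in> P i" "y \<in> P j"
    have xy: "\<phi> i x \<in> P' i" "\<phi> j y \<in> P' j" using embD(2)[OF m(1)] a by blast+
    show "\<phi> i x \<noteq> \<phi> j y \<and> e (\<phi> i x) (\<phi> j y) = e x y"
    proof (cases "i < j")
      case True then show ?thesis using d'[OF True] c[OF True a(2,3)] xy by (metis disjoint_iff)
    next
      case False
      then have "j < i" using a(1) by simp
      then show ?thesis using d'[of j i] c[of j i y x] xy a esym[of "\<phi> i x" "\<phi> j y"] esym[of x y] by (metis disjoint_iff)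
    qed
  qed (rule that)
  then show ?thesis unfolding ism_def m(2) by blast
qed

text \<open>Since \<open>cxi\<close> compares each ring with the inner module contracted to a point,
  the isomorphisms of the rings fit together whatever has been chosen inside.\<close>

lemma tower_up:
  fixes M N :: "nat \<Rightarrow> 'a set"
  assumes "\<And>i. M i \<subseteq> M (Suc i)" "\<And>i. N i \<subseteq> N (Suc i)" "ism (M 0) (N 0)"
    and c: "\<And>i. cxi (M (Suc i)) (M i) (N (Suc i)) (N i)"
  shows "ism (\<Union>i. M i) (\<Union>i. N i)"
proof -
  have mono: "M i \<subseteq> M j" "N i \<subseteq> N j" if "i \<le> j" for i j
    using lift_Suc_mono_le[of M] lift_Suc_mono_le[of N] assms(1,2) that by blast+
  define P where "P = case_nat (M 0) (\<lambda>i. M (Suc i) - M i)"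
  define P' where "P' = case_nat (N 0) (\<lambda>i. N (Suc i) - N i)"
  have PM: "P i \<subseteq> M i" "P' i \<subseteq> N i" for i unfolding P_def P'_def by (cases i; simp)+
  have S: "P (Suc i) = M (Suc i) - M i" "P' (Suc i) = N (Suc i) - N i" for i unfolding P_def P'_def by simp_all
  have UP: "M n \<subseteq> (\<Union>i. P i)" "N n \<subseteq> (\<Union>i. P' i)" for n
  proof (induction n)
    case 0
    have "P 0 = M 0" "P' 0 = N 0" unfolding P_def P'_def by simp_all
    { case 1 then show ?case using \<open>P 0 = M 0\<close> by blast }
    { case 2 then show ?case using \<open>P' 0 = N 0\<close> by blast }
  next
    case (Suc n)
    { case 1 then show ?case using S(1)[of n] Suc(1) by blast }
    { case 2 then show ?case using S(2)[of n] Suc(2) by blast }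
  qed
  have "\<exists>h. emb h (P i) (P' i) \<and> h ` P i = P' i \<and>
      (\<forall>k. i = Suc k \<longrightarrow> (\<forall>v\<in>P i. \<forall>m\<in>M k. \<forall>n\<in>N k. e (h v) n = e v m))" for i
  proof (cases i)
    case 0 then show ?thesis using assms(3) unfolding ism_def P_def P'_def by auto
  next
    case (Suc k)
    obtain h where "emb h (P i) (P' i)" "h ` P i = P' i" "\<forall>v\<in>P i. \<forall>m\<in>M k. \<forall>n\<in>N k. e (h v) n = e v m"
      using c[of k] unfolding cxi_def Suc S by blast
    then show ?thesis using Suc by (intro exI[of _ h]) simp
  qed
  then obtain \<phi> where \<phi>: "\<And>i. emb (\<phi> i) (P i) (P' i)" "\<And>i. \<phi> i ` P i = P' i"
    "\<And>k v m n. \<lbrakk>v \<in> P (Suc k); m \<in> M k; n \<in> N k\<rbrakk> \<Longrightarrow> e (\<phi> (Suc k) v) n = e v m" by metis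
  have "ism (\<Union>i. P i) (\<Union>i. P' i)"
  proof (rule pieces_nat[OF _ _ \<phi>(1,2)])
    show "P i \<inter> P j = {}" if "i < j" for i j
    proof -
      obtain k where k: "j = Suc k" "i \<le> k" using \<open>i < j\<close> by (cases j) auto
      then show ?thesis using PM(1)[of i] mono(1)[OF k(2)] S(1)[of k] by blast
    qed
    show "P' i \<inter> P' j = {}" if "i < j" for i j
    proof -
      obtain k where k: "j = Suc k" "i \<le> k" using \<open>i < j\<close> by (cases j) auto
      then show ?thesis using PM(2)[of i] mono(2)[OF k(2)] S(2)[of k] by blast
    qed
    fix i j x y assume a: "i < j" "x \<in> P i" "y \<in> P j"
    obtain k where k: "j = Suc k" "i \<le> k" using a(1) by (cases j) auto
    have 1: "x \<in> M k" using a(2) PM(1)[of i] mono(1)[OF k(2)] by blast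
    have 2: "\<phi> i x \<in> N k" using embD(2)[OF \<phi>(1) a(2)] PM(2)[of i] mono(2)[OF k(2)] by blast
    have "e (\<phi> j y) (\<phi> i x) = e y x" using \<phi>(3)[OF _ 1 2, of y] a(3) k(1) by blast
    then show "e (\<phi> i x) (\<phi> j y) = e x y" using esym[of "\<phi> i x" "\<phi> j y"] esym[of x y] by simp
  qed
  moreover have "(\<Union>i. P i) = (\<Union>i. M i)" by (rule subset_antisym[OF UN_mono[OF subset_refl PM(1)] UN_least[OF UP(1)]])
  moreover have "(\<Union>i. P' i) = (\<Union>i. N i)" by (rule subset_antisym[OF UN_mono[OF subset_refl PM(2)] UN_least[OF UP(2)]])
  ultimately show ?thesis by simp
qed

text \<open>There is no innermost ring, so the gluing starts from the intersection; every other
  vertex leaves the tower at a first index and so lies in a ring.\<close>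

lemma tower_down:
  fixes M N :: "nat \<Rightarrow> 'a set"
  assumes "\<And>i. M (Suc i) \<subseteq> M i" "\<And>i. N (Suc i) \<subseteq> N i" "ism (\<Inter>i. M i) (\<Inter>i. N i)"
    and c: "\<And>i. cxi (M i) (M (Suc i)) (N i) (N (Suc i))"
  shows "ism (M 0) (N 0)"
proof -
  have mono: "M j \<subseteq> M i" "N j \<subseteq> N i" if "i \<le> j" for i j
    using lift_Suc_antimono_le[of M] lift_Suc_antimono_le[of N] assms(1,2) that by blast+
  define P where "P = case_nat (\<Inter>i. M i) (\<lambda>i. M i - M (Suc i))"
  define P' where "P' = case_nat (\<Inter>i. N i) (\<lambda>i. N i - N (Suc i))"
  have S: "P (Suc i) = M i - M (Suc i)" "P' (Suc i) = N i - N (Suc i)" for i unfolding P_def P'_def by simp_all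
  have Z: "P 0 = (\<Inter>i. M i)" "P' 0 = (\<Inter>i. N i)" unfolding P_def P'_def by simp_all
  have up: "N 0 \<subseteq> (\<Union>i. Q i)" if Q: "\<And>i. Q (Suc i) = N i - N (Suc i)" "Q 0 = (\<Inter>i. N i)" for Q N :: "nat \<Rightarrow> 'a set"
  proof
    fix x assume x: "x \<in> N 0"
    show "x \<in> (\<Union>i. Q i)"
    proof (cases "x \<in> (\<Inter>i. N i)")
      case True then show ?thesis using Q(2) by blast
    next
      case False
      define k where "k = (LEAST k. x \<notin> N k)"
      have k: "x \<notin> N k" unfolding k_def by (rule LeastI_ex) (use False in blast)
      have "k \<noteq> 0" using k x by (metis)
      then obtain k' where k': "k = Suc k'" using not0_implies_Suc by blast
      have "x \<in> N k'" using not_less_Least[of k' "\<lambda>k. x \<notin> N k"] k' unfolding k_def by simp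
      then have "x \<in> Q (Suc k')" using Q(1) k k' by simp
      then show ?thesis by blast
    qed
  qed
  have "\<exists>h. emb h (P i) (P' i) \<and> h ` P i = P' i \<and>
      (\<forall>k. i = Suc k \<longrightarrow> (\<forall>v\<in>P i. \<forall>m\<in>M (Suc k). \<forall>n\<in>N (Suc k). e (h v) n = e v m))" for i
  proof (cases i)
    case 0 then show ?thesis using assms(3) unfolding ism_def P_def P'_def by auto
  next
    case (Suc k)
    obtain h where "emb h (P i) (P' i)" "h ` P i = P' i" "\<forall>v\<in>P i. \<forall>m\<in>M (Suc k). \<forall>n\<in>N (Suc k). e (h v) n = e v m"
      using c[of k] unfolding cxi_def Suc S by blast
    then show ?thesis using Suc by (intro exI[of _ h]) simp
  qed
  then obtain \<phi> where \<phi>: "\<And>i. emb (\<phi> i) (P i) (P' i)" "\<And>i. \<phi> i ` P i = P' i"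
    "\<And>k v m n. \<lbrakk>v \<in> P (Suc k); m \<in> M (Suc k); n \<in> N (Suc k)\<rbrakk> \<Longrightarrow> e (\<phi> (Suc k) v) n = e v m" by metis
  have after: "Q j \<subseteq> N (Suc i)" if Q: "\<And>i. Q (Suc i) = N i - N (Suc i)" "\<And>i. N (Suc i) \<subseteq> N i" "Suc i < j"
    for Q N :: "nat \<Rightarrow> 'a set" and i j
  proof -
    obtain k where k: "j = Suc k" "Suc i \<le> k" using Q(3) by (cases j) auto
    have "N k \<subseteq> N (Suc i)" by (rule lift_Suc_antimono_le[of N "Suc i" k, OF Q(2) k(2)])
    then show ?thesis using Q(1)[of k] k(1) by blast
  qed
  have "ism (\<Union>i. P i) (\<Union>i. P' i)"
  proof (rule pieces_nat[OF _ _ \<phi>(1,2)])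
    show "P i \<inter> P j = {}" if ij: "i < j" for i j
    proof (cases i)
      case 0
      obtain k where "j = Suc k" using ij by (cases j) auto
      then show ?thesis using 0 Z(1) S(1)[of k] by blast
    next
      case (Suc k) then show ?thesis using after[of P M k j, OF S(1) assms(1)] S(1)[of k] ij by blast
    qed
    show "P' i \<inter> P' j = {}" if ij: "i < j" for i j
    proof (cases i)
      case 0
      obtain k where "j = Suc k" using ij by (cases j) auto
      then show ?thesis using 0 Z(2) S(2)[of k] by blast
    next
      case (Suc k) then show ?thesis using after[of P' N k j, OF S(2) assms(2)] S(2)[of k] ij by blast
    qed
    fix i j x y assume a: "i < j" "x \<in> P i" "y \<in> P j"
    show "e (\<phi> i x) (\<phi> j y) = e x y"
    proof (cases i)
      case 0
      obtain k where k: "j = Suc k" using a(1) by (cases j) auto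
      have 1: "x \<in> M (Suc k)" using a(2) 0 Z(1) by blast
      have 2: "\<phi> i x \<in> N (Suc k)" using embD(2)[OF \<phi>(1) a(2)] 0 Z(2) by blast
      have "e (\<phi> j y) (\<phi> i x) = e y x" using \<phi>(3)[OF _ 1 2, of y] a(3) k by blast
      then show ?thesis using esym[of "\<phi> i x" "\<phi> j y"] esym[of x y] by simp
    next
      case (Suc k)
      have 1: "y \<in> M (Suc k)" using after[of P M k j, OF S(1) assms(1)] a Suc by blast
      have 2: "\<phi> j y \<in> N (Suc k)" using after[of P' N k j, OF S(2) assms(2)] embD(2)[OF \<phi>(1) a(3)] a(1) Suc by blast
      show ?thesis using \<phi>(3)[OF _ 1 2, of x] a(2) Suc by blast
    qed
  qed
  moreover have "(\<Union>i. P i) = M 0"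
  proof
    show "(\<Union>i. P i) \<subseteq> M 0"
    proof (rule UN_least)
      fix i show "P i \<subseteq> M 0" by (cases i) (use Z(1) S(1) mono(1)[of 0] in blast)+
    qed
  qed (rule up[OF S(1) Z(1)])
  moreover have "(\<Union>i. P' i) = N 0"
  proof
    show "(\<Union>i. P' i) \<subseteq> N 0"
    proof (rule UN_least)
      fix i show "P' i \<subseteq> N 0" by (cases i) (use Z(2) S(2) mono(2)[of 0] in blast)+
    qed
  qed (rule up[OF S(2) Z(2)])
  ultimately show ?thesis by simp
qed

lemma one_single: "one {x}"
  unfolding one_def
proof
  fix A assume "A \<in> Sib {x}"
  then obtain f where "A \<subseteq> {x}" "emb f {x} A" unfolding Sib_def le_def by blast
  moreover from this have "f x \<in> A" using embD(2)[of f "{x}" A x] by simp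
  ultimately have "A = {x}" by auto
  then show "ism A {x}" using ism_refl by simp
qed

lemma one_empty: "one {}"
  unfolding one_def Sib_def using ism_refl[of "{}"] by auto

lemma strong_single: "x \<in> X \<Longrightarrow> strong {x} X"
  unfolding strong_def modl_def by blast

section \<open>Minimal counterexamples\<close>

text \<open>By \<open>node\<close>, a graph that splits in neither way is the union of an increasing
  sequence of proper strong modules \<open>M n\<close>. If \<open>A\<close> is another sibling,
  infinitely many of its rings differ from those of \<open>L\<close> (\<open>tower_up\<close>).
  Restoring the rings of \<open>L\<close> on disjoint infinite sets of such indices gives siblings
  \<open>B p\<close>; an isomorphism between two of them would respect the sequence from some index
  on.\<close>

lemma limit_one:
  assumes LU: "L \<subseteq> U" and fL: "fin L" and nd: "\<And>t. \<not> disc t L"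
    and sub: "\<And>M. \<lbrakk>strong M L; M \<noteq> L\<rbrakk> \<Longrightarrow> one M"
  shows "one L"
proof (cases "L = {} \<or> (\<exists>x. L = {x})")
  case True then show ?thesis using one_single one_empty by auto
next
  case ns: False
  show ?thesis unfolding one_def
  proof (rule ballI, rule ccontr)
    fix A assume A: "A \<in> Sib L" and nA: "\<not> ism A L"
    obtain f where f: "emb f L A" and AL: "A \<subseteq> L" using A unfolding Sib_def le_def by blast
    have fL': "emb f L L" using emb_mono[OF f subset_refl AL] .
    obtain x where x: "x \<in> L" using ns by blast
    have hne: "hull L x z \<noteq> L" if z: "z \<in> L" for z
    proof (cases "x = z")
      case True
      then have "hull L x z \<subseteq> {x}" using hull_least[OF strong_single[OF x]] by simp
      then show ?thesis using ns x by blast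
    next
      case False
      then show ?thesis using node(2)[OF LU x z False] nd by metis
    qed
    define y where "y = from_nat_into L"
    have yL: "y n \<in> L" for n unfolding y_def by (rule from_nat_into) (use x in blast)
    have cL: "countable L" using LU ctb countable_subset by blast
    have yr: "range y = L" unfolding y_def by (rule range_from_nat_into[OF _ cL]) (use x in blast)
    \<comment> \<open>Starting from the hull of \<open>x\<close> and \<open>f x\<close> puts
      \<open>x\<close> into the preimage of every \<open>M n\<close>; then \<open>shift\<close>
      shows that \<open>f\<close> preserves \<open>M n\<close>.\<close>
    define M where "M = rec_nat (hull L x (f x)) (\<lambda>n S. S \<union> hull L x (y n))"
    have M0: "M 0 = hull L x (f x)" and MS: "M (Suc n) = M n \<union> hull L x (y n)" for n unfolding M_def by simp_all
    have fx: "f x \<in> L" "f x \<in> A" using embD(2)[OF fL' x] embD(2)[OF f x] .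
    have M: "strong (M n) L \<and> M n \<noteq> L \<and> x \<in> M n \<and> f x \<in> M n" for n
    proof (induction n)
      case 0 then show ?case using hull_strong[OF x fx(1)] hne[OF fx(1)] hull_in unfolding M0 by blast
    next
      case (Suc n)
      have h: "strong (hull L x (y n)) L" "hull L x (y n) \<noteq> L" "x \<in> hull L x (y n)"
        using hull_strong[OF x yL] hne[OF yL] hull_in by blast+
      have "M n \<subseteq> hull L x (y n) \<or> hull L x (y n) \<subseteq> M n"
        using strong_cmp[OF _ strongD(1)[OF h(1)], of "M n" x] Suc h(3) by blast
      then have "M (Suc n) = M n \<or> M (Suc n) = hull L x (y n)" unfolding MS by blast
      then show ?case
      proof
        assume "M (Suc n) = M n" then show ?case using Suc by simp
      next
        assume a: "M (Suc n) = hull L x (y n)"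
        have "f x \<in> M (Suc n)" using Suc unfolding MS by blast
        then show ?case using h unfolding a by simp
      qed
    qed
    have Ms: "strong (M n) L" "M n \<noteq> L" "x \<in> M n" "f x \<in> M n" for n using M by blast+
    have MSS: "M n \<subseteq> M (Suc n)" for n unfolding MS by blast
    have Mm: "M i \<subseteq> M j" if "i \<le> j" for i j using lift_Suc_mono_le[of M, OF MSS that] .
    have MsL: "M n \<subseteq> L" for n using strongD(2)[OF Ms(1)] .
    have MU: "(\<Union>n. M n) = L"
    proof
      show "L \<subseteq> (\<Union>n. M n)"
      proof
        fix z assume "z \<in> L"
        then obtain n where "z = y n" using yr by blast
        then have "z \<in> M (Suc n)" using hull_in(2) unfolding MS by blast
        then show "z \<in> (\<Union>n. M n)" by blast
      qed
    qed (use MsL in blast)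
    have fM: "f ` M n \<subseteq> M n" for n
    proof -
      let ?W = "{z\<in>L. f z \<in> M n}"
      have xW: "x \<in> ?W" using x Ms(4) by blast
      have "modl ?W L" using modl_vimg[OF fL' strongD(1)[OF Ms(1)]] xW by blast
      then have "?W \<subseteq> M n \<or> M n \<subseteq> ?W" using strong_cmp[OF Ms(1) _ Ms(3) xW] by blast
      moreover have "\<not> ?W \<subset> M n" using shift[OF LU fL' Ms(1)[of n]] fL xW by blast
      ultimately show ?thesis by blast
    qed
    have cut: "B \<in> Sib L" "strong (B \<inter> M n) B" "B \<inter> M n \<in> Sib (M n)" if B: "A \<subseteq> B" "B \<subseteq> L" for B n
    proof -
      show "B \<in> Sib L" by (rule Sib_between[OF A B])
      have fB: "emb f L B" using emb_mono[OF f subset_refl B(1)] .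
      show "strong (B \<inter> M n) B" by (rule restrict_strong[OF LU fL Ms(1) fB B(2) fM])
      have "f ` M n \<subseteq> B \<inter> M n" using fM[of n] embD(2)[OF fB] MsL[of n] by blast
      then have "emb f (M n) (B \<inter> M n)" using emb_mono[OF emb_image[OF fB MsL] subset_refl] by blast
      then show "B \<inter> M n \<in> Sib (M n)" using SibI by blast
    qed
    define I where "I = {i. \<not> cxi (M (Suc i)) (M i) (A \<inter> M (Suc i)) (A \<inter> M i)}"
    have inf: "infinite I"
    proof
      assume "finite I"
      then obtain i0 where i0: "\<forall>i\<in>I. i < i0" using finite_nat_set_iff_bounded by blast
      have "ism (\<Union>i. M (i0 + i)) (\<Union>i. A \<inter> M (i0 + i))"
      proof (rule tower_up)
        show "ism (M (i0 + 0)) (A \<inter> M (i0 + 0))"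
          using oneD[OF sub[OF Ms(1,2)] cut(3)[OF subset_refl AL]] ism_sym by blast
        show "cxi (M (i0 + Suc i)) (M (i0 + i)) (A \<inter> M (i0 + Suc i)) (A \<inter> M (i0 + i))" for i
        proof -
          have "i0 + i \<notin> I" using i0 by auto
          then show ?thesis unfolding I_def by simp
        qed
        show "M (i0 + i) \<subseteq> M (i0 + Suc i)" for i using MSS[of "i0 + i"] by simp
        then show "A \<inter> M (i0 + i) \<subseteq> A \<inter> M (i0 + Suc i)" for i by blast
      qed
      moreover have "(\<Union>i. M (i0 + i)) = L"
      proof
        show "L \<subseteq> (\<Union>i. M (i0 + i))"
        proof
          fix z assume "z \<in> L"
          then obtain n where "z \<in> M n" using MU by blast
          then have "z \<in> M (i0 + n)" using Mm[of n "i0 + n"] by auto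
          then show "z \<in> (\<Union>i. M (i0 + i))" by blast
        qed
      qed (use MsL in blast)
      moreover have "(\<Union>i. A \<inter> M (i0 + i)) = A \<inter> (\<Union>i. M (i0 + i))" by blast
      ultimately have "ism L (A \<inter> L)" by simp
      then have "ism L A" using AL by (simp add: Int_absorb2)
      then show False using nA ism_sym by blast
    qed
    \<comment> \<open>\<open>prod_encode\<close> divides \<open>I\<close> into infinitely many
      infinite parts.\<close>
    define S where "S p = {enumerate I (prod_encode (p, m)) |m. True}" for p
    define B where "B p = A \<union> (\<Union>i\<in>S p. M (Suc i) - M i)" for p
    have BA: "A \<subseteq> B p" "B p \<subseteq> L" for p unfolding B_def using AL MsL by blast+
    have rd: "i = j" if z: "z \<in> M (Suc i) - M i" "z \<in> M (Suc j) - M j" for z i j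
    proof (rule ccontr)
      assume "i \<noteq> j"
      then consider "Suc i \<le> j" | "Suc j \<le> i" by linarith
      then show False using Mm[of "Suc i" j] Mm[of "Suc j" i] z by cases blast+
    qed
    have ring1: "B p \<inter> M (Suc i) - B p \<inter> M i = M (Suc i) - M i" if "i \<in> S p" for i p
      using that unfolding B_def by blast
    have ring2: "B p \<inter> M (Suc i) - B p \<inter> M i = A \<inter> M (Suc i) - A \<inter> M i" if i: "i \<notin> S p" for i p
    proof
      show "B p \<inter> M (Suc i) - B p \<inter> M i \<subseteq> A \<inter> M (Suc i) - A \<inter> M i"
      proof
        fix z assume z: "z \<in> B p \<inter> M (Suc i) - B p \<inter> M i"
        have "z \<in> A"
        proof (rule ccontr)
          assume "z \<notin> A"
          then obtain j where "j \<in> S p" "z \<in> M (Suc j) - M j" using z unfolding B_def by blast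
          then show False using rd[of z i j] z i by blast
        qed
        then show "z \<in> A \<inter> M (Suc i) - A \<inter> M i" using z BA(1)[of p] by blast
      qed
    qed (use BA(1)[of p] in blast)
    have "\<not> fin L"
    proof (rule not_fin_seq[of B])
      show "B p \<in> Sib L" for p by (rule cut(1)[OF BA])
      fix p q assume "ism (B p) (B q)"
      then obtain \<psi> where \<psi>: "emb \<psi> (B p) (B q)" "\<psi> ` B p = B q" unfolding ism_def by blast
      show "p = q"
      proof (rule ccontr)
        assume pq: "p \<noteq> q"
        have fB: "f x \<in> B p" using fx(2) BA(1) by blast
        then have "\<psi> (f x) \<in> L" using embD(2)[OF \<psi>(1)] BA(2) by blast
        then obtain i1 where i1: "\<psi> (f x) \<in> M i1" using MU by blast
        \<comment> \<open>Both sides are strong in \<open>B q\<close>, equimorphic, and contain the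
          image of \<open>f x\<close>; so \<open>nested_strong\<close> makes them equal.\<close>
        have eq: "\<psi> ` (B p \<inter> M i) = B q \<inter> M i" if i: "i1 \<le> i" for i
        proof -
          have s1: "strong (\<psi> ` (B p \<inter> M i)) (B q)" by (rule strong_img[OF \<psi> cut(2)[OF BA]])
          have s2: "strong (B q \<inter> M i) (B q)" by (rule cut(2)[OF BA])
          have z1: "\<psi> (f x) \<in> \<psi> ` (B p \<inter> M i)" using fB Ms(4) by blast
          have z2: "\<psi> (f x) \<in> B q \<inter> M i" using i1 Mm[OF i] embD(2)[OF \<psi>(1) fB] by blast
          have c: "\<psi> ` (B p \<inter> M i) \<subseteq> B q \<inter> M i \<or> B q \<inter> M i \<subseteq> \<psi> ` (B p \<inter> M i)"
            using strong_cmp[OF s2 strongD(1)[OF s1] z2 z1] .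
          have "eqm (\<psi> ` (B p \<inter> M i)) (B p \<inter> M i)"
            by (rule eqm_sym[OF ism_eqm[OF emb_ism[OF \<psi>(1)]]]) blast
          then have q1: "eqm (\<psi> ` (B p \<inter> M i)) (B q \<inter> M i)"
            using eqm_trans[OF _ eqm_trans[OF Sib_eqm[OF cut(3)[OF BA]] eqm_sym[OF Sib_eqm[OF cut(3)[OF BA]]]]] by blast
          have BU: "B q \<subseteq> U" "fin (B q)" using BA(2) LU fin_Sib[OF fL cut(1)[OF BA]] by blast+
          show ?thesis
            using c nested_strong[OF BU s1 s2 _ q1] nested_strong[OF BU s2 s1 _ eqm_sym[OF q1]] by blast
        qed
        \<comment> \<open>The second coordinate \<open>i1\<close> is chosen to obtain a member of
          \<open>S p\<close> that is at least \<open>i1\<close>.\<close>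
        define i where "i = enumerate I (prod_encode (p, i1))"
        have "i1 \<le> prod_encode (p, i1)" by (rule le_prod_encode_2)
        also have "\<dots> \<le> i" unfolding i_def by (rule le_enumerate[OF inf])
        finally have ii: "i1 \<le> i" .
        have iI: "i \<in> I" unfolding i_def by (rule enumerate_in_set[OF inf])
        have iS: "i \<in> S p" unfolding i_def S_def by blast
        have inS: "i \<notin> S q"
        proof
          assume "i \<in> S q"
          then obtain m where "enumerate I (prod_encode (p, i1)) = enumerate I (prod_encode (q, m))" unfolding i_def S_def by blast
          then have "prod_encode (p, i1) = prod_encode (q, m)"
            using strict_mono_enumerate[OF inf] strict_mono_eq by blast
          then show False using pq by (simp add: prod_encode_eq)
        qed
        have "\<psi> ` (B p \<inter> M (Suc i) - B p \<inter> M i) = \<psi> ` (B p \<inter> M (Suc i)) - \<psi> ` (B p \<inter> M i)"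
          by (rule inj_on_image_set_diff[OF embD(1)[OF \<psi>(1)]]) auto
        also have "\<dots> = B q \<inter> M (Suc i) - B q \<inter> M i" using eq[OF ii] eq[of "Suc i"] ii by simp
        finally have im: "\<psi> ` (M (Suc i) - M i) = A \<inter> M (Suc i) - A \<inter> M i" unfolding ring1[OF iS] ring2[OF inS] .
        have RB: "M (Suc i) - M i \<subseteq> B p" using iS unfolding B_def by blast
        have "cxi (M (Suc i)) (M i) (A \<inter> M (Suc i)) (A \<inter> M i)"
        proof (rule cxiI[OF _ im])
          show "emb \<psi> (M (Suc i) - M i) (A \<inter> M (Suc i) - A \<inter> M i)" using emb_image[OF \<psi>(1) RB] im by simp
          fix v m n assume v: "v \<in> M (Suc i) - M i" and m: "m \<in> M i" and n: "n \<in> A \<inter> M i"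
          have p1: "\<psi> v \<in> A \<inter> M (Suc i) - A \<inter> M i" using v im by blast
          then have pv: "\<psi> v \<in> L" "\<psi> v \<notin> M i" using AL by blast+
          have pz: "\<psi> (f x) \<in> M i" using i1 Mm[OF ii] by blast
          have vL: "v \<in> L" "v \<notin> M i" using v MsL by blast+
          have "e (\<psi> v) n = e (\<psi> v) (\<psi> (f x))" using strongD(4)[OF Ms(1) pv _ pz] n by blast
          also have "\<dots> = e v (f x)" using embD(3)[OF \<psi>(1) _ fB, of v] v RB Ms(4)[of i] by blast
          also have "\<dots> = e v m" using strongD(4)[OF Ms(1) vL Ms(4) m] .
          finally show "e (\<psi> v) n = e v m" .
        qed
        then show False using iI unfolding I_def by blast
      qed
    qed
    then show False using fL by blast
  qed
qed

section \<open>Strong modules with several siblings in a minimal counterexample\<close>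

definition Bad :: "'a set \<Rightarrow> 'a set set" where
  "Bad X = {M. strong M X \<and> \<not> one M}"

context
  fixes X :: "'a set"
  assumes XU: "X \<subseteq> U" and fX: "fin X" and nX: "\<not> one X"
    and mini: "\<And>Y. \<lbrakk>Y \<subseteq> U; fin Y; \<not> one Y\<rbrakk> \<Longrightarrow> card (cls X) \<le> card (cls Y)"
begin

lemma BadD:
  assumes "M \<in> Bad X"
  shows "strong M X" "\<not> one M" "M \<subseteq> X" "M \<subseteq> U" "M \<noteq> {}" "fin M" "card (cls M) = card (cls X)"
proof -
  show s: "strong M X" and n: "\<not> one M" using assms unfolding Bad_def by blast+
  show MX: "M \<subseteq> X" and "M \<noteq> {}" using strongD(2,3)[OF s] .
  show MU: "M \<subseteq> U" using MX XU by blast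
  show f: "fin M" using strong_fin(1)[OF XU fX s] .
  show "card (cls M) = card (cls X)" using mini[OF MU f n] strong_fin(2)[OF XU fX s] by simp
qed

text \<open>By minimality, the injection of \<open>transfer\<close> reaches every sibling of
  \<open>X\<close> up to isomorphism, and in \<open>\<Phi> A\<close> all copies of \<open>M\<close>
  are isomorphic to \<open>A\<close>.\<close>

lemma Bad_homog:
  assumes M: "M \<in> Bad X" and B: "B \<in> Sib X"
  shows "Eq B M \<noteq> {}" "\<lbrakk>N \<in> Eq B M; N' \<in> Eq B M\<rbrakk> \<Longrightarrow> ism N N'"
proof -
  obtain \<Phi> where \<Phi>: "\<And>A. A \<in> Sib M \<Longrightarrow> \<Phi> A \<in> Sib X" "\<And>A. A \<in> Sib M \<Longrightarrow> Eq (\<Phi> A) M \<noteq> {}"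
    "\<And>A N. \<lbrakk>A \<in> Sib M; N \<in> Eq (\<Phi> A) M\<rbrakk> \<Longrightarrow> ism N A"
    "\<And>A A'. \<lbrakk>A \<in> Sib M; A' \<in> Sib M; ism (\<Phi> A) (\<Phi> A')\<rbrakk> \<Longrightarrow> ism A A'"
    by (rule transfer[OF XU fX BadD(1)[OF M]]) (rule that)
  have "\<exists>A\<in>Sib M. ism B (\<Phi> A)" by (rule cls_inj(3)[OF fX _ _ BadD(7)[OF M] B]) (fact \<Phi>)+
  then obtain A where A: "A \<in> Sib M" "ism B (\<Phi> A)" by blast
  obtain N0 where "N0 \<in> Eq (\<Phi> A) M" using \<Phi>(2)[OF A(1)] by blast
  then show "Eq B M \<noteq> {}" using Eq_ism[OF ism_sym[OF A(2)]] by blast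
  have "ism N A" if "N \<in> Eq B M" for N
    using Eq_ism[OF A(2) that] \<Phi>(3)[OF A(1)] ism_trans by blast
  then show "\<lbrakk>N \<in> Eq B M; N' \<in> Eq B M\<rbrakk> \<Longrightarrow> ism N N'" using ism_sym ism_trans by blast
qed

text \<open>If there were a second copy, \<open>M\<close> alone could be replaced by a sibling not
  isomorphic to it, and the two copies would violate \<open>Bad_homog\<close>.\<close>

lemma Bad_Eq: assumes M: "M \<in> Bad X" shows "Eq X M = {M}"
proof -
  have ME: "M \<in> Eq X M" using BadD(1)[OF M] eqm_refl unfolding Eq_def by blast
  obtain A where A: "A \<in> Sib M" "\<not> ism A M" using BadD(2)[OF M] unfolding one_def by blast
  have "N = M" if N: "N \<in> Eq X M" for N
  proof (rule ccontr)
    assume ne: "N \<noteq> M"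
    define r where "r N = (if N = M then A else N)" for N
    have r1: "r N \<subseteq> N" for N using A(1) unfolding r_def Sib_def by auto
    have r2: "eqm (r N) M" if "N \<in> Eq X M" for N using Sib_eqm[OF A(1)] EqD(2)[OF that] unfolding r_def by simp
    note R = replace_Eq[OF XU fX BadD(5)[OF M], of r, OF r1 r2]
    have "r M \<in> Eq (Rp X (Eq X M) r) M" "r N \<in> Eq (Rp X (Eq X M) r) M" using R(2) ME N by blast+
    then have "A \<in> Eq (Rp X (Eq X M) r) M" "N \<in> Eq (Rp X (Eq X M) r) M" using ne unfolding r_def by simp_all
    then have "ism A N" using Bad_homog(2)[OF M R(1)] by blast
    moreover have "ism N M" using Bad_homog(2)[OF M Sib_self N ME] .
    ultimately show False using A(2) ism_trans by blast
  qed
  then show ?thesis using ME by blast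
qed

lemma Bad_rep:
  assumes M: "M \<in> Bad X" and A: "A \<in> Sib M"
  shows "(X - M) \<union> A \<in> Sib X" "Eq ((X - M) \<union> A) M = {A}"
proof -
  have A1: "A \<subseteq> M" "A \<noteq> {}"
    using A BadD(5)[OF M] embD(2) unfolding Sib_def le_def by blast+
  have E: "Eq X M = {M}" by (rule Bad_Eq[OF M])
  have Rp: "Rp X (Eq X M) (\<lambda>_. A) = X - \<Union>(Eq X M) \<union> \<Union>((\<lambda>_. A) ` Eq X M)"
    by (rule Rp_def) (use E A1 BadD(1)[OF M] in auto)
  then have Rp: "Rp X (Eq X M) (\<lambda>_. A) = (X - M) \<union> A" unfolding E by simp
  have "N \<in> Eq X M \<Longrightarrow> A \<subseteq> N" "N \<in> Eq X M \<Longrightarrow> eqm A M" for N using E A1(1) Sib_eqm[OF A] by blast+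
  note R = replace_Eq[OF XU fX BadD(5)[OF M], of "\<lambda>_. A", OF this]
  show "(X - M) \<union> A \<in> Sib X" using R(1) unfolding Rp .
  show "Eq ((X - M) \<union> A) M = {A}" using R(2) unfolding Rp unfolding E by simp
qed

text \<open>As \<open>M\<close> is the only copy, the injection from its siblings has the simple
  form used here; it is again onto by minimality.\<close>

lemma Bad_iso:
  assumes M: "M \<in> Bad X" and B: "B \<in> Sib X"
  shows "\<exists>A\<in>Sib M. ism B ((X - M) \<union> A)"
proof (rule cls_inj(3)[OF fX _ _ BadD(7)[OF M] B])
  show "(X - M) \<union> A \<in> Sib X" if "A \<in> Sib M" for A using Bad_rep(1)[OF M that] .
  show "ism A A'" if a: "A \<in> Sib M" "A' \<in> Sib M" "ism ((X - M) \<union> A) ((X - M) \<union> A')" for A A'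
    using Eq_ism[OF a(3), of A M] Bad_rep(2)[OF M a(1)] Bad_rep(2)[OF M a(2)] by simp
qed

lemma Bad_unique:
  assumes M: "M \<in> Bad X" and B: "B \<in> Sib X"
  shows "\<exists>N. Eq B M = {N}"
proof -
  obtain A where A: "A \<in> Sib M" "ism B ((X - M) \<union> A)" using Bad_iso[OF assms] by blast
  obtain f where f: "emb f B ((X - M) \<union> A)" "f ` B = (X - M) \<union> A" using A(2) unfolding ism_def by blast
  have fN: "f ` N = A" if "N \<in> Eq B M" for N using Eq_img[OF f that] Bad_rep(2)[OF M A(1)] by simp
  obtain N where N: "N \<in> Eq B M" using Bad_homog(1)[OF assms] by blast
  have "N' = N" if N': "N' \<in> Eq B M" for N'
    using inj_on_image_eq_iff[OF embD(1)[OF f(1)] EqD(4)[OF N'] EqD(4)[OF N]] fN[OF N] fN[OF N'] by simp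
  then show ?thesis using N by blast
qed

text \<open>If the modules were disjoint, a change of \<open>M1\<close> would amount, up to
  isomorphism, to a change of \<open>M2\<close>, which leaves \<open>M1\<close> intact as the only
  copy.\<close>

lemma Bad_chain:
  assumes M1: "M1 \<in> Bad X" and M2: "M2 \<in> Bad X"
  shows "M1 \<subseteq> M2 \<or> M2 \<subseteq> M1"
proof (rule ccontr)
  assume "\<not> ?thesis"
  then have d: "M1 \<inter> M2 = {}" using strongD(5)[OF BadD(1)[OF M2] strongD(1)[OF BadD(1)[OF M1]]] by blast
  obtain A where A: "A \<in> Sib M1" "\<not> ism A M1" using BadD(2)[OF M1] unfolding one_def by blast
  let ?B = "(X - M1) \<union> A"
  obtain A' where A': "A' \<in> Sib M2" "ism ?B ((X - M2) \<union> A')" using Bad_iso[OF M2 Bad_rep(1)[OF M1 A(1)]] by blast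
  let ?C = "(X - M2) \<union> A'"
  have "A' \<subseteq> M2" "A' \<noteq> {}" using A'(1) BadD(5)[OF M2] embD(2) unfolding Sib_def le_def by blast+
  then have "strong M1 ?C" using strong_outside[OF BadD(1)[OF M1] strongD(1)[OF BadD(1)[OF M2]] d] by blast
  then have C1: "M1 \<in> Eq ?C M1" using eqm_refl unfolding Eq_def by blast
  have "A \<in> Eq ?B M1" using Bad_rep(2)[OF M1 A(1)] by blast
  then obtain N where N: "N \<in> Eq ?C M1" "ism A N" using Eq_ism[OF A'(2)] by blast
  obtain N0 where "Eq ?C M1 = {N0}" using Bad_unique[OF M1 Bad_rep(1)[OF M2 A'(1)]] by blast
  then have "N = M1" using N(1) C1 by blast
  then show False using N(2) A(2) by blast
qed

text \<open>By \<open>shift\<close> the preimage \<open>Q\<close> is disjoint from \<open>M\<close>.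
  Since \<open>f\<close> reaches no vertex of \<open>M\<close> outside \<open>K\<close>, cutting
  \<open>M\<close> down to \<open>K\<close> leaves a sibling \<open>?B\<close>. It contains a unique
  copy \<open>N\<close> of \<open>M\<close>, and each position of \<open>N\<close> relative to
  \<open>K\<close> turns out to be impossible.\<close>

lemma Bad_invariant:
  assumes f: "emb f X X" and M: "M \<in> Bad X"
  shows "f ` M \<subseteq> M"
proof (rule ccontr)
  assume nf: "\<not> f ` M \<subseteq> M"
  note s = BadD(1)[OF M]
  define Q where "Q = {x\<in>X. f x \<in> M}"
  have mQ: "modl Q X" if "Q \<noteq> {}" using modl_vimg[OF f strongD(1)[OF s]] that unfolding Q_def by blast
  have QM: "Q \<inter> M = {}"
  proof (rule ccontr)
    assume a: "Q \<inter> M \<noteq> {}"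
    then have "Q \<noteq> {}" by blast
    then have "Q \<subseteq> M \<or> M \<subseteq> Q" using strongD(5)[OF s mQ] a by blast
    moreover have "\<not> M \<subseteq> Q" using nf unfolding Q_def by blast
    ultimately have "Q \<subset> M" by blast
    then show False using shift[OF XU f s] fX \<open>Q \<noteq> {}\<close> unfolding Q_def by blast
  qed
  obtain m0 where m0: "m0 \<in> M" using BadD(5)[OF M] by blast
  \<comment> \<open>If \<open>f\<close> avoids \<open>M\<close>, one vertex is kept so that
    \<open>K\<close> is a module of \<open>?B\<close>, hence comparable with or disjoint from
    \<open>N\<close>.\<close>
  define K where "K = (if Q = {} then {m0} else f ` Q)"
  have K: "K \<subseteq> M" "K \<noteq> {}" using m0 unfolding K_def Q_def by auto
  have fK: "f z \<in> K" if "z \<in> X" "f z \<in> M" for z using that unfolding K_def Q_def by auto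
  let ?B = "(X - M) \<union> K"
  have BX: "?B \<subseteq> X" using K(1) BadD(3)[OF M] by blast
  have fB: "emb f X ?B"
  proof (rule emb_mono[OF emb_image[OF f subset_refl] subset_refl])
    show "f ` X \<subseteq> ?B" using embD(2)[OF f] fK by blast
  qed
  have BS: "?B \<in> Sib X" by (rule SibI[OF BX fB])
  obtain N where N: "Eq ?B M = {N}" using Bad_unique[OF M BS] by blast
  then have NE: "N \<in> Eq ?B M" by blast
  note sN = EqD(1)[OF NE]
  have "M \<inter> ?B = K" using K(1) by blast
  then have mK: "modl K ?B" using modl_restrict[OF strongD(1)[OF s] BX] K(2) by simp
  consider "N \<inter> K = {}" | "K \<subset> N" | "N \<subseteq> K" using strongD(5)[OF sN mK] by blast
  then show False
  proof cases
    case 1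
    then have "strong N X" using strong_rep(1)[OF s K sN] by blast
    then have "N \<in> Eq X M" using EqD(2)[OF NE] unfolding Eq_def by blast
    then have "N = M" using Bad_Eq[OF M] by blast
    then show False using 1 K by blast
  next
    case 2
    let ?V = "N \<union> M"
    have sV: "strong ?V X" using strong_rep(2)[OF s K sN] 2 by blast
    obtain z where z: "z \<in> N" "z \<notin> K" using 2 by blast
    then have "z \<in> X - M" using EqD(4)[OF NE] by blast
    then have MV: "M \<subset> ?V" using z by blast
    obtain A where A: "A \<in> Sib M" "ism ?B ((X - M) \<union> A)" using Bad_iso[OF M BS] by blast
    obtain g where g: "emb g ?B ((X - M) \<union> A)" "g ` ?B = (X - M) \<union> A" using A(2) unfolding ism_def by blast
    have AM: "A \<subseteq> M" using A(1) unfolding Sib_def by blast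
    have gN: "g ` N = A" using Eq_img[OF g NE] Bad_rep(2)[OF M A(1)] by blast
    have BV: "?B - N = X - ?V" using 2 by blast
    have "g ` (?B - N) = g ` ?B - g ` N" by (rule inj_on_image_set_diff[OF embD(1)[OF g(1)]]) (use EqD(4)[OF NE] in auto)
    then have im: "g ` (X - ?V) = X - M" unfolding BV g(2) gN using AM by blast
    have VB: "X - ?V \<subseteq> ?B" by blast
    \<comment> \<open>The isomorphism \<open>g\<close> maps \<open>N\<close> onto \<open>A\<close>,
      hence the complement of \<open>?V\<close> onto that of \<open>M\<close>; the two contractions
      of \<open>X\<close> agree and \<open>cxi_shift\<close> applies.\<close>
    have "cxi X ?V X M"
    proof (rule cxiI[OF _ im])
      show "emb g (X - ?V) (X - M)" using emb_image[OF g(1) VB] im by simp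
      fix v m n assume v: "v \<in> X - ?V" and m: "m \<in> ?V" and n: "n \<in> M"
      obtain k where k: "k \<in> K" using K(2) by blast
      have kN: "k \<in> N" "k \<in> ?B" "k \<in> ?V" using k 2 by blast+
      have gk: "g k \<in> M" using gN kN(1) AM by blast
      have gv: "g v \<in> X" "g v \<notin> M" using v im by blast+
      have vv: "v \<in> X" "v \<notin> ?V" "v \<noteq> k" "v \<in> ?B" using v kN by blast+
      have "e (g v) n = e (g v) (g k)" using strongD(4)[OF s gv n gk] .
      also have "\<dots> = e v k" using embD(3)[OF g(1) vv(4) kN(2) vv(3)] .
      also have "\<dots> = e v m" using strongD(4)[OF sV vv(1,2) kN(3) m] .
      finally show "e (g v) n = e v m" .
    qed
    then have "cxi X M X ?V" by (rule cxi_sym)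
    moreover have "X \<noteq> {}" "?V \<subseteq> X" using strongD(2)[OF sV] strongD(3)[OF sV] by blast+
    ultimately have "\<not> fin X" using cxi_shift[OF XU s sV MV modl_self] by blast
    then show False using fX by blast
  next
    case 3
    have leMK: "le M K" using EqD(2)[OF NE] le_refl[OF 3] le_trans unfolding eqm_def by blast
    show False
    proof (cases "Q = {}")
      case True
      then obtain g where g: "emb g M {m0}" using leMK unfolding K_def le_def by auto
      have "z = m0" if "z \<in> M" for z using embD(2)[OF g that] embD(2)[OF g m0] embD(4)[OF g that m0] by auto
      then have "M = {m0}" using m0 by blast
      then show False using BadD(2)[OF M] one_single by simp
    next
      case False
      have QX: "Q \<subseteq> X" unfolding Q_def by blast
      have KQ: "K = f ` Q" using False unfolding K_def by simp
      have "ism Q K" unfolding KQ by (rule emb_ism[OF f QX])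
      then have leMQ: "le M Q" using le_trans[OF leMK ism_le[OF ism_sym]] by blast
      have fQ: "emb f Q M" using emb_mono[OF emb_image[OF f QX] subset_refl] K(1) unfolding KQ by blast
      then have eqQ: "eqm Q M" using leMQ unfolding eqm_def le_def by blast
      have nQ: "\<not> strong Q X"
      proof
        assume "strong Q X"
        then have "Q \<in> Eq X M" using eqQ unfolding Eq_def by blast
        then have "Q = M" using Bad_Eq[OF M] by blast
        then show False using QM BadD(5)[OF M] by blast
      qed
      then obtain \<tau> where \<tau>: "disc \<tau> Q" using strong_ndisc[OF mQ[OF False]] by blast
      then have dM: "disc \<tau> M" using disc_eqm[OF XU fX s eqQ] by blast
      \<comment> \<open>By \<open>sum_one\<close>, some component \<open>M1\<close> of
        \<open>M\<close> has several siblings and is thus bad itself. Putting a copy of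
        \<open>M\<close> in place of \<open>Q\<close> will produce a second copy of
        \<open>M1\<close>.\<close>
      then obtain M1 where M1: "M1 \<in> comps \<tau> M" "\<not> one M1"
        using sum_one[OF BadD(4,6)[OF M] dM] BadD(2)[OF M] by blast
      have sM1: "strong M1 X" using strong_trans[OF comps_strong[OF dM M1(1)] s] .
      have M1B: "M1 \<in> Bad X" using sM1 M1(2) unfolding Bad_def by blast
      obtain j where j: "emb j M Q" using leMQ unfolding le_def by blast
      define J where "J = j ` M"
      have JQ: "J \<subseteq> Q" "J \<noteq> {}" using embD(2)[OF j] BadD(5)[OF M] unfolding J_def by blast+
      have jJ: "emb j M J" unfolding J_def by (rule emb_image[OF j subset_refl])
      have JS: "J \<in> Sib Q" by (rule SibI[OF JQ(1) emb_comp[OF fQ jJ]])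
      let ?Y = "(X - Q) \<union> J"
      have YS: "?Y \<in> Sib X" by (rule rep_Sib[OF mQ[OF False] JS])
      have YX: "?Y \<subseteq> X" using JQ(1) QX by blast
      have M1Q: "M1 \<inter> Q = {}" using compsD(1)[OF M1(1)] QM by blast
      have "strong M1 ?Y" by (rule strong_outside[OF sM1 mQ[OF False] M1Q JQ(2,1)])
      then have E1: "M1 \<in> Eq ?Y M1" using eqm_refl unfolding Eq_def by blast
      have "Q \<inter> ?Y = J" using JQ(1) by blast
      then have mJ: "modl J ?Y" using modl_restrict[OF mQ[OF False] YX] JQ(2) by simp
      have dJ: "disc \<tau> J" using disc_emb_img[OF j] dM unfolding J_def by blast
      have c: "j ` M1 \<in> comps \<tau> J" by (rule comps_img[OF jJ J_def[symmetric] M1(1)])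
      obtain w where w: "w \<in> j ` M1" using compsD(2)[OF c] by blast
      have "strong (cpt \<tau> J w) ?Y" using strong_cpt[OF mJ dJ] w compsD(1)[OF c] by blast
      then have "strong (j ` M1) ?Y" using compsD(4)[OF c w] by simp
      moreover have "eqm (j ` M1) M1"
        by (rule eqm_sym[OF ism_eqm[OF emb_ism[OF j compsD(1)[OF M1(1)]]]])
      ultimately have E2: "j ` M1 \<in> Eq ?Y M1" unfolding Eq_def by blast
      obtain N1 where "Eq ?Y M1 = {N1}" using Bad_unique[OF M1B YS] by blast
      then have "M1 = j ` M1" using E1 E2 by simp
      then show False using M1Q w compsD(1)[OF c] JQ(1) by blast
    qed
  qed
qed

lemma Bad_cut:
  assumes M: "M \<in> Bad X" and B: "B \<in> Sib X"
  shows "Eq B M = {B \<inter> M}"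
proof -
  obtain f where f: "emb f X B" and BX: "B \<subseteq> X" using B unfolding Sib_def le_def by blast
  have fM: "f ` M \<subseteq> M" by (rule Bad_invariant[OF emb_mono[OF f subset_refl BX] M])
  have s: "strong (B \<inter> M) B" by (rule restrict_strong[OF XU fX BadD(1)[OF M] f BX fM])
  have "f ` M \<subseteq> B \<inter> M" using fM embD(2)[OF f] BadD(3)[OF M] by blast
  then have "emb f M (B \<inter> M)" using emb_mono[OF emb_image[OF f BadD(3)[OF M]] subset_refl] by blast
  then have "B \<inter> M \<in> Sib M" using SibI by blast
  then have "B \<inter> M \<in> Eq B M" using s Sib_eqm unfolding Eq_def by blast
  then show ?thesis using Bad_unique[OF M B] by blast
qed

text \<open>\<open>A\<close> is isomorphic to a graph that agrees with \<open>X\<close> outside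
  \<open>M2\<close>, and by \<open>Bad_cut\<close> the isomorphism respects the traces of both bad
  modules.\<close>

lemma Bad_ring:
  assumes M1: "M1 \<in> Bad X" and M2: "M2 \<in> Bad X" and M: "M2 \<subseteq> M1" and A: "A \<in> Sib X"
  shows "cxi M1 M2 (A \<inter> M1) (A \<inter> M2)"
proof -
  obtain C where C: "C \<in> Sib M2" "ism A ((X - M2) \<union> C)" using Bad_iso[OF M2 A] by blast
  let ?B = "(X - M2) \<union> C"
  obtain g where g: "emb g A ?B" "g ` A = ?B" using C(2) unfolding ism_def by blast
  have CM: "C \<subseteq> M2" using C(1) unfolding Sib_def by blast
  have BS: "?B \<in> Sib X" by (rule Bad_rep(1)[OF M2 C(1)])
  have gM: "g ` (A \<inter> M) = ?B \<inter> M" if "M \<in> Bad X" for M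
    using Eq_img[OF g, of "A \<inter> M" M] Bad_cut[OF that A] Bad_cut[OF that BS] by simp
  have "g ` (A \<inter> M1 - A \<inter> M2) = g ` (A \<inter> M1) - g ` (A \<inter> M2)"
    by (rule inj_on_image_set_diff[OF embD(1)[OF g(1)]]) auto
  then have im: "g ` (A \<inter> M1 - A \<inter> M2) = M1 - M2"
    unfolding gM[OF M1] gM[OF M2] using CM BadD(3)[OF M1] by blast
  have sub: "A \<inter> M1 - A \<inter> M2 \<subseteq> A" by blast
  have "cxi (A \<inter> M1) (A \<inter> M2) M1 M2"
  proof (rule cxiI[OF _ im])
    show "emb g (A \<inter> M1 - A \<inter> M2) (M1 - M2)" using emb_image[OF g(1) sub] im by simp
    fix v m n assume v: "v \<in> A \<inter> M1 - A \<inter> M2" and m: "m \<in> A \<inter> M2" and n: "n \<in> M2"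
    have gv: "g v \<in> X" "g v \<notin> M2" using v im BadD(3)[OF M1] by blast+
    have gm: "g m \<in> M2" using m gM[OF M2] by blast
    have "v \<noteq> m" "v \<in> A" "m \<in> A" using v m by blast+
    then have "e (g v) (g m) = e v m" using embD(3)[OF g(1)] by blast
    then show "e (g v) n = e v m" using strongD(4)[OF BadD(1)[OF M2] gv n gm] by simp
  qed
  then show ?thesis by (rule cxi_sym)
qed

lemma Bad_False: False
proof -
  have "X \<noteq> {}" using nX one_empty by blast
  then have XB: "X \<in> Bad X" using strong_self nX unfolding Bad_def by blast
  define N where "N = \<Inter>(Bad X)"
  have NX: "N \<subseteq> X" using XB unfolding N_def by blast
  have NM: "N \<subseteq> M" if "M \<in> Bad X" for M using that unfolding N_def by blast
  show False
  proof (cases "N \<in> Bad X")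
    case True
    note s = BadD(1)[OF True]
    have sub: "one M" if M: "strong M N" "M \<noteq> N" for M
    proof (rule ccontr)
      assume "\<not> one M"
      then have "M \<in> Bad X" using strong_trans[OF M(1) s] unfolding Bad_def by blast
      then show False using NM strongD(2)[OF M(1)] M(2) by blast
    qed
    have "\<not> disc t N" for t
    proof
      assume d: "disc t N"
      have "one Z" if Z: "Z \<in> comps t N" for Z
        by (rule sub[OF comps_strong[OF d Z]]) (use compsD(3)[OF Z] d in blast)
      then have "one N" by (rule sum_one[OF BadD(4,6)[OF True] d])
      then show False using BadD(2)[OF True] by blast
    qed
    then have "one N" using limit_one[OF BadD(4,6)[OF True] _ sub] by blast
    then show False using BadD(2)[OF True] by blast
  next
    case False
    obtain A where A: "A \<in> Sib X" "\<not> ism A X" using nX unfolding one_def by blast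
    obtain f where f: "emb f X A" and AX: "A \<subseteq> X" using A(1) unfolding Sib_def le_def by blast
    have fM: "f ` M \<subseteq> M" if "M \<in> Bad X" for M
      by (rule Bad_invariant[OF emb_mono[OF f subset_refl AX] that])
    have isoN: "ism N (A \<inter> N)"
    proof (cases "N = {}")
      case True then show ?thesis using ism_refl[of "{}"] by simp
    next
      case ne: False
      have "strong N X" using strong_Inter[of "Bad X" X] XB BadD(1) ne unfolding N_def by blast
      then have o: "one N" using False unfolding Bad_def by blast
      have fN: "f ` N \<subseteq> A \<inter> N"
      proof (rule image_subsetI)
        fix z assume z: "z \<in> N"
        have "f z \<in> M" if "M \<in> Bad X" for M using fM[OF that] NM[OF that] z by blast
        then show "f z \<in> A \<inter> N" using z NX embD(2)[OF f] unfolding N_def by blast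
      qed
      have "emb f N (A \<inter> N)" by (rule emb_mono[OF emb_image[OF f NX] subset_refl fN])
      then have "A \<inter> N \<in> Sib N" using SibI by blast
      then show ?thesis using oneD[OF o] ism_sym by blast
    qed
    \<comment> \<open>A bad module avoiding \<open>z\<close>. For \<open>z\<close> in
      \<open>N\<close> there is none, and the default \<open>X\<close> leaves intersections
      unchanged.\<close>
    define pick where "pick z = (if z \<in> N then X else SOME M. M \<in> Bad X \<and> z \<notin> M)" for z
    have pick: "pick z \<in> Bad X" "z \<notin> N \<Longrightarrow> z \<notin> pick z" for z
    proof -
      have "pick z \<in> Bad X \<and> z \<notin> pick z" if z: "z \<notin> N"
      proof -
        have "\<exists>M. M \<in> Bad X \<and> z \<notin> M" using z unfolding N_def by blast
        from someI_ex[OF this] show ?thesis using z unfolding pick_def by simp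
      qed
      moreover have "pick z = X" if "z \<in> N" using that unfolding pick_def by simp
      ultimately show "pick z \<in> Bad X" using XB by metis
      show "z \<notin> N \<Longrightarrow> z \<notin> pick z" using \<open>z \<notin> N \<Longrightarrow> pick z \<in> Bad X \<and> z \<notin> pick z\<close> by blast
    qed
    define y where "y = from_nat_into X"
    have "countable X" using XU ctb countable_subset by blast
    then have yr: "range y = X" unfolding y_def using range_from_nat_into[OF \<open>X \<noteq> {}\<close>] by blast
    define M where "M = rec_nat X (\<lambda>n S. S \<inter> pick (y n))"
    have M0: "M 0 = X" and MS: "M (Suc n) = M n \<inter> pick (y n)" for n unfolding M_def by simp_all
    have MB: "M n \<in> Bad X" for n
    proof (induction n)
      case 0 then show ?case using XB M0 by simp
    next
      case (Suc n)
      have "M (Suc n) = M n \<or> M (Suc n) = pick (y n)" using Bad_chain[OF Suc pick(1)[of "y n"]] unfolding MS by blast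
      then show ?case using Suc pick(1) by metis
    qed
    have MN: "(\<Inter>n. M n) = N"
    proof
      show "N \<subseteq> (\<Inter>n. M n)" using NM[OF MB] by blast
      show "(\<Inter>n. M n) \<subseteq> N"
      proof
        fix z assume z: "z \<in> (\<Inter>n. M n)"
        then have "z \<in> X" using M0 by blast
        then obtain n where n: "z = y n" using yr by blast
        have "z \<in> M (Suc n)" using z by blast
        then have "z \<in> pick z" using n unfolding MS by blast
        then show "z \<in> N" using pick(2) by blast
      qed
    qed
    have dec: "M (Suc n) \<subseteq> M n" for n unfolding MS by blast
    have "ism (M 0) (A \<inter> M 0)"
    proof (rule tower_down[of M "\<lambda>n. A \<inter> M n"])
      show "M (Suc n) \<subseteq> M n" for n by (rule dec)
      show "A \<inter> M (Suc n) \<subseteq> A \<inter> M n" for n using dec by blast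
      have "(\<Inter>n. A \<inter> M n) = A \<inter> N" using MN by blast
      then show "ism (\<Inter>n. M n) (\<Inter>n. A \<inter> M n)" using isoN MN by simp
      show "cxi (M n) (M (Suc n)) (A \<inter> M n) (A \<inter> M (Suc n))" for n by (rule Bad_ring[OF MB MB dec A(1)])
    qed
    then have "ism X A" using AX M0 by (simp add: Int_absorb2)
    then show False using A(2) ism_sym by blast
  qed
qed

end

lemma fin_one:
  assumes "X \<subseteq> U" "fin X" shows "one X"
proof (rule ccontr)
  assume n: "\<not> one X"
  let ?P = "\<lambda>X. X \<subseteq> U \<and> fin X \<and> \<not> one X"
  have "\<exists>Y. ?P Y \<and> (\<forall>Z. ?P Z \<longrightarrow> card (cls Y) \<le> card (cls Z))"
    using ex_has_least_nat[of ?P X "\<lambda>X. card (cls X)"] assms n by blast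
  then obtain Y where "?P Y" "\<And>Z. ?P Z \<Longrightarrow> card (cls Y) \<le> card (cls Z)" by blast
  then show False using Bad_False[of Y] by blast
qed

end

section \<open>Graphs\<close>

lemma graph_iso_sym:
  assumes "graph_iso G H" shows "graph_iso H G"
proof -
  obtain f where f: "bij_betw f (verts G) (verts H)" "\<forall>x\<in>verts G. \<forall>y\<in>verts G. adj G x y \<longleftrightarrow> adj H (f x) (f y)"
    using assms unfolding graph_iso_def by blast
  let ?g = "the_inv_into (verts G) f"
  have g: "bij_betw ?g (verts H) (verts G)" using bij_betw_the_inv_into[OF f(1)] .
  have "adj H x y \<longleftrightarrow> adj G (?g x) (?g y)" if "x \<in> verts H" "y \<in> verts H" for x y
  proof -
    have "?g x \<in> verts G" "?g y \<in> verts G" using g that unfolding bij_betw_def by blast+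
    moreover have "f (?g x) = x" "f (?g y) = y" using f_the_inv_into_f_bij_betw[OF f(1)] that by blast+
    ultimately show ?thesis using f(2) by metis
  qed
  then show ?thesis using g unfolding graph_iso_def by blast
qed

lemma graph_iso_trans:
  assumes "graph_iso G H" "graph_iso H K" shows "graph_iso G K"
proof -
  obtain f where f: "bij_betw f (verts G) (verts H)" "\<forall>x\<in>verts G. \<forall>y\<in>verts G. adj G x y \<longleftrightarrow> adj H (f x) (f y)"
    using assms(1) unfolding graph_iso_def by blast
  obtain g where g: "bij_betw g (verts H) (verts K)" "\<forall>x\<in>verts H. \<forall>y\<in>verts H. adj H x y \<longleftrightarrow> adj K (g x) (g y)"
    using assms(2) unfolding graph_iso_def by blast
  have fv: "f x \<in> verts H" if "x \<in> verts G" for x using f(1) that unfolding bij_betw_def by blast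
  have "adj G x y \<longleftrightarrow> adj K ((g \<circ> f) x) ((g \<circ> f) y)" if "x \<in> verts G" "y \<in> verts G" for x y
    using f(2) g(2) fv that by simp
  then show ?thesis using bij_betw_trans[OF f(1) g(1)] unfolding graph_iso_def by blast
qed

lemma graph_iso_embeds: "graph_iso G H \<Longrightarrow> embeds G H"
  unfolding graph_iso_def embeds_def bij_betw_def by blast

lemma embeds_trans:
  assumes "embeds G H" "embeds H K" shows "embeds G K"
proof -
  obtain f where f: "inj_on f (verts G)" "f ` verts G \<subseteq> verts H" "\<forall>x\<in>verts G. \<forall>y\<in>verts G. adj G x y \<longleftrightarrow> adj H (f x) (f y)"
    using assms(1) unfolding embeds_def by blast
  obtain g where g: "inj_on g (verts H)" "g ` verts H \<subseteq> verts K" "\<forall>x\<in>verts H. \<forall>y\<in>verts H. adj H x y \<longleftrightarrow> adj K (g x) (g y)"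
    using assms(2) unfolding embeds_def by blast
  have fv: "f x \<in> verts H" if "x \<in> verts G" for x using f(2) that by blast
  have "inj_on (g \<circ> f) (verts G)" using comp_inj_on[OF f(1) inj_on_subset[OF g(1) f(2)]] .
  moreover have "(g \<circ> f) ` verts G \<subseteq> verts K" using f(2) g(2) by auto
  moreover have "adj G x y \<longleftrightarrow> adj K ((g \<circ> f) x) ((g \<circ> f) y)" if "x \<in> verts G" "y \<in> verts G" for x y
    using f(3) g(3) fv that by simp
  ultimately show ?thesis unfolding embeds_def by blast
qed

definition induced :: "'a graph \<Rightarrow> 'a set \<Rightarrow> 'a graph" where
  "induced G A = (A, \<lambda>x y. x \<in> A \<and> y \<in> A \<and> adj G x y)"

lemma induced_sel [simp]:
  "verts (induced G A) = A" "adj (induced G A) x y \<longleftrightarrow> x \<in> A \<and> y \<in> A \<and> adj G x y"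
  unfolding induced_def verts_def adj_def by simp_all

lemma P4_sel [simp]:
  "verts P4 = {0, 1, 2, 3}" "adj P4 x y \<longleftrightarrow> x \<in> {0, 1, 2, 3} \<and> y \<in> {0, 1, 2, 3} \<and> (x = y + 1 \<or> y = x + 1)"
  unfolding P4_def verts_def adj_def by simp_all

lemma embeds_P4:
  assumes G: "is_graph G" and V: "{a, b, c, d} \<subseteq> verts G" "distinct [a, b, c, d]"
    and E: "adj G a b" "adj G b c" "adj G c d" "\<not> adj G a c" "\<not> adj G a d" "\<not> adj G b d"
  shows "embeds P4 G"
proof -
  have sym: "adj G x y \<longleftrightarrow> adj G y x" for x y using G unfolding is_graph_def by blast
  have irr: "\<not> adj G x x" for x using G unfolding is_graph_def by blast
  define f where "f n = (if n = 0 then a else if n = 1 then b else if n = 2 then c else d)" for n :: nat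
  have f: "f 0 = a" "f 1 = b" "f 2 = c" "f 3 = d" unfolding f_def by simp_all
  have E': "adj G b a" "adj G c b" "adj G d c" "\<not> adj G c a" "\<not> adj G d a" "\<not> adj G d b"
    using E sym[of a b] sym[of b c] sym[of c d] sym[of a c] sym[of a d] sym[of b d] by simp_all
  have "inj_on f {0, 1, 2, 3}" using V(2) unfolding f_def by (auto simp: inj_on_def)
  moreover have "f ` {0, 1, 2, 3} \<subseteq> verts G" using V(1) f by simp
  moreover have "\<forall>x\<in>verts P4. \<forall>y\<in>verts P4. adj P4 x y \<longleftrightarrow> adj G (f x) (f y)"
    using f E E' irr by simp
  ultimately show ?thesis unfolding embeds_def by (intro exI[of _ f]) simp
qed

lemma cograph_cog:
  assumes G: "is_graph G" "countable (verts G)" "cograph G"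
  shows "cog (adj G) (verts G)"
proof
  show sym: "adj G x y = adj G y x" for x y using G(1) unfolding is_graph_def by blast
  show "countable (verts G)" by (rule G(2))
  fix a b c d :: 'a and t
  assume a: "a \<in> verts G" "b \<in> verts G" "c \<in> verts G" "d \<in> verts G" "distinct [a, b, c, d]"
    "adj G a b = t" "adj G b c = t" "adj G c d = t" "adj G a c = (\<not> t)" "adj G a d = (\<not> t)" "adj G b d = (\<not> t)"
  have "embeds P4 G"
  proof (cases t)
    case True
    then show ?thesis using embeds_P4[OF G(1), of a b c d] a by simp
  next
    case False
    \<comment> \<open>the complement of the path a, b, c, d is the path c, a, d, b\<close>
    then show ?thesis
      using embeds_P4[OF G(1), of c a d b] a sym[of c a] sym[of d b] sym[of c b] by auto
  qed
  then show False using G(3) unfolding cograph_def by blast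
qed

theorem theorem1:
  fixes G :: "'a graph"
  assumes "is_graph G" and "countable (verts G)" and "cograph G"
  shows "card (sibling_classes G) = 1 \<or> infinite (sibling_classes G)"
proof -
  interpret cog "adj G" "verts G" by (rule cograph_cog[OF assms])
  let ?U = "verts G"
  let ?R = "{(H, H'). graph_iso H H'} :: (nat graph \<times> nat graph) set"
  have irr: "\<not> adj G x x" for x using assms(1) unfolding is_graph_def by blast
  \<comment> \<open>\<open>emb\<close> ignores the diagonal; without loops, including it adds no
    condition.\<close>
  have emb_iff: "emb f A B \<longleftrightarrow> inj_on f A \<and> f ` A \<subseteq> B \<and> (\<forall>x\<in>A. \<forall>y\<in>A. adj G x y \<longleftrightarrow> adj G (f x) (f y))" for f A B
    unfolding emb_def using irr by metis
  have ism_iff: "ism A B \<longleftrightarrow> graph_iso (induced G A) (induced G B)" for A B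
    unfolding ism_def emb_iff graph_iso_def bij_betw_def by auto
  have le_iff: "le A B \<longleftrightarrow> embeds (induced G A) (induced G B)" for A B
  proof -
    have "inj_on f A \<and> f ` A \<subseteq> B \<and> (\<forall>x\<in>A. \<forall>y\<in>A. adj G x y \<longleftrightarrow> adj G (f x) (f y)) \<longleftrightarrow> inj_on f A \<and> f ` A \<subseteq> B \<and>
      (\<forall>x\<in>A. \<forall>y\<in>A. (x \<in> A \<and> y \<in> A \<and> adj G x y) \<longleftrightarrow> (f x \<in> B \<and> f y \<in> B \<and> adj G (f x) (f y)))" for f by blast
    then show ?thesis unfolding le_def emb_iff embeds_def induced_sel by simp
  qed
  have GU: "induced G ?U = G" using assms(1) unfolding induced_def is_graph_def verts_def adj_def
    by (cases G) (auto intro!: ext)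
  \<comment> \<open>The classes to be counted consist of graphs on \<open>nat\<close>, so subsets of
    the vertex set are copied there along \<open>c\<close>.\<close>
  define c where "c = to_nat_on ?U"
  define cp where "cp A = (c ` A, \<lambda>x y. \<exists>u\<in>A. \<exists>v\<in>A. x = c u \<and> y = c v \<and> adj G u v)" for A
  have ci: "inj_on c ?U" unfolding c_def by (rule inj_on_to_nat_on[OF assms(2)])
  have cp: "is_graph (cp A)" "graph_iso (induced G A) (cp A)" if A: "A \<subseteq> ?U" for A
  proof -
    have v: "verts (cp A) = c ` A" and ad: "\<And>x y. adj (cp A) x y \<longleftrightarrow> (\<exists>u\<in>A. \<exists>v\<in>A. x = c u \<and> y = c v \<and> adj G u v)"
      unfolding cp_def verts_def adj_def by simp_all
    have inj: "u = v" if "u \<in> A" "v \<in> A" "c u = c v" for u v using ci A that unfolding inj_on_def by blast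
    have "\<not> adj (cp A) x x" for x unfolding ad using inj irr by metis
    then show "is_graph (cp A)" unfolding is_graph_def v ad using esym by blast
    have "adj G x y \<longleftrightarrow> adj (cp A) (c x) (c y)" if "x \<in> A" "y \<in> A" for x y unfolding ad using that inj by metis
    then show "graph_iso (induced G A) (cp A)" unfolding graph_iso_def
      by (intro exI[of _ c]) (use inj_on_imp_bij_betw[OF inj_on_subset[OF ci A]] v in simp)
  qed
  have SibU: "A \<subseteq> ?U" if "A \<in> Sib ?U" for A using that unfolding Sib_def by blast
  have cpS: "cp A \<in> siblings G" if A: "A \<in> Sib ?U" for A
  proof -
    note i = cp(2)[OF SibU[OF A]]
    have "embeds (induced G A) G" using le_iff[of A ?U] le_refl[OF SibU[OF A]] GU by simp
    moreover have "embeds G (induced G A)" using le_iff[of ?U A] A GU unfolding Sib_def by simp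
    ultimately have "embeds (cp A) G" "embeds G (cp A)"
      using embeds_trans graph_iso_embeds[OF i] graph_iso_embeds[OF graph_iso_sym[OF i]] by blast+
    then show ?thesis using cp(1)[OF SibU[OF A]] unfolding siblings_def equimorphic_def by blast
  qed
  have ex: "\<exists>A\<in>Sib ?U. graph_iso H (induced G A)" if H: "H \<in> siblings G" for H
  proof -
    have "embeds H G" using H unfolding siblings_def equimorphic_def by blast
    then obtain f where f: "inj_on f (verts H)" "f ` verts H \<subseteq> ?U" "\<forall>x\<in>verts H. \<forall>y\<in>verts H. adj H x y \<longleftrightarrow> adj G (f x) (f y)"
      unfolding embeds_def by blast
    let ?A = "f ` verts H"
    have i: "graph_iso H (induced G ?A)" unfolding graph_iso_def
      by (intro exI[of _ f]) (use f inj_on_imp_bij_betw[OF f(1)] in simp)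
    have "embeds G (induced G ?A)"
      using H embeds_trans[OF _ graph_iso_embeds[OF i]] unfolding siblings_def equimorphic_def by blast
    then have "?A \<in> Sib ?U" using le_iff[of ?U ?A] GU f(2) unfolding Sib_def by simp
    then show ?thesis using i by blast
  qed
  show ?thesis
  proof (cases "fin ?U")
    case True
    then have o: "one ?U" using fin_one by blast
    have "graph_iso H (cp ?U)" if "H \<in> siblings G" for H
    proof -
      obtain A where A: "A \<in> Sib ?U" "graph_iso H (induced G A)" using ex[OF \<open>H \<in> siblings G\<close>] by blast
      have "graph_iso (induced G A) (induced G ?U)" using oneD[OF o A(1)] ism_iff by blast
      then show ?thesis using graph_iso_trans[OF A(2)] graph_iso_trans cp(2)[OF subset_refl] by blast
    qed
    then have "?R `` {H} = ?R `` {cp ?U}" if "H \<in> siblings G" for H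
      using graph_iso_trans graph_iso_sym that by blast
    then have "sibling_classes G = {?R `` {cp ?U}}"
      using cpS[OF Sib_self] unfolding sibling_classes_def quotient_def by blast
    then show ?thesis by simp
  next
    case False
    \<comment> \<open>\<open>\<beta>\<close> recovers the class of vertex sets from a class of
      graphs on \<open>nat\<close>; infinitely many values need infinitely many arguments.\<close>
    define \<beta> where "\<beta> C = {B. \<exists>H\<in>C. graph_iso H (induced G B)}" for C :: "nat graph set"
    have "cls ?U \<subseteq> \<beta> ` sibling_classes G"
    proof
      fix x assume "x \<in> cls ?U"
      then obtain A where A: "A \<in> Sib ?U" "x = {B. ism A B}" unfolding cls_def by blast
      note i = cp(2)[OF SibU[OF A(1)]]
      have "ism A B \<longleftrightarrow> (\<exists>H :: nat graph. graph_iso (cp A) H \<and> graph_iso H (induced G B))" for B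
      proof
        assume "ism A B"
        then have "graph_iso (cp A) (induced G B)" using graph_iso_trans[OF graph_iso_sym[OF i]] ism_iff by blast
        moreover have "graph_iso (cp A) (cp A)" using graph_iso_trans[OF graph_iso_sym[OF i] i] .
        ultimately show "\<exists>H :: nat graph. graph_iso (cp A) H \<and> graph_iso H (induced G B)" by blast
      next
        assume "\<exists>H :: nat graph. graph_iso (cp A) H \<and> graph_iso H (induced G B)"
        then show "ism A B" using ism_iff[of A B] graph_iso_trans[OF i] graph_iso_trans by blast
      qed
      then have "x = \<beta> (?R `` {cp A})" unfolding A(2) \<beta>_def by auto
      moreover have "?R `` {cp A} \<in> sibling_classes G" using cpS[OF A(1)] unfolding sibling_classes_def quotient_def by blast
      ultimately show "x \<in> \<beta> ` sibling_classes G" by blast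
    qed
    then have "infinite (sibling_classes G)" using False finite_surj fin_cls by blast
    then show ?thesis by blast
  qed
qed

end
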